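(* Fix $c_0>0$. For $f_0\in H^2(\mathbb{R}^d)$, $d\ge 1$, let $$u(t,x):=\mathbb{E}\big[w_c(\tau_t,x)\big]\quad\text{with } a>0,\ c\ge c_0,\qquad\text{and}\qquad h(t,x):=\mathbb{E}\big[w_1(\sigma W(t),x)\big]\quad\text{with } \sigma^2:=\frac{c^2}{a},\ \sigma>0,$$ where $w_c$ is the solution of the undamped wave equation with velocity $c$ and initial data $(f_0,0)$, $\tau_t=\int_0^t(-1)^{N(s)}\,\mathrm{d}s$ with $N$ a homogeneous Poisson process with rate $a$, and $W$ is a one-dimensional Wiener process. Then there exists a constant $C=C(c_0,d)$ such that $$\|h(t,\cdot)-u(t,\cdot)\|_{L_2(\mathbb{R}^d)}\le C\Big(\frac{1}{at}+\frac{1}{c\,(ta)^{1/2}}\Big)\qquad\text{for all } t>0.$$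
   Context: For $c>0$, $w_c(t,x)$ denotes the solution of the undamped wave equation $\partial_{tt}w=c^2\Delta w$ on $\mathbb{R}^d$ with $w(0,\cdot)=f_0$ and $\partial_t w(0,\cdot)=0$, evaluated also at negative times where needed (it is even in time). $H^2(\mathbb{R}^d)$ is the $L_2$-Sobolev space of order 2. (The function $u$ is the solution of the damped wave equation $\partial_{tt}u+2a\,\partial_t u=c^2\Delta u$, $u(0,\cdot)=f_0$, $\partial_tu(0,\cdot)=0$; the function $h$ is the solution of $\partial_t h=\frac{\sigma^2}{2}\Delta h$, $h(0,\cdot)=f_0$.)
   Formalization: The right-hand side carries the factor ‖f_0‖_{H²}: the bound proved is C‖f_0‖_{H²}(1/(at)+1/(c(ta)^{1/2})) with C=C(c_0,d), since without it the inequality fails when f_0 is multiplied by a large constant. *)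

theory Defs
  imports "HOL-Probability.Probability"
begin

text \<open>
  Elements of the Lebesgue and Sobolev spaces are represented by Borel functions; equality in
  these spaces is equality almost everywhere.
\<close>

definition L2 :: "('a::euclidean_space \<Rightarrow> complex) set" where
  "L2 = {f. f \<in> borel_measurable lborel \<and> integrable lborel (\<lambda>x. (cmod (f x))\<^sup>2)}"

text \<open>Only meaningful on \<^const>\<open>L2\<close>: the Bochner integral of a non-integrable function is 0.\<close>

definition L2_norm :: "('a::euclidean_space \<Rightarrow> complex) \<Rightarrow> real" where
  "L2_norm f = sqrt (\<integral>x. (cmod (f x))\<^sup>2 \<partial>lborel)"

text \<open>
  A list \<open>[b\<^sub>1, \<dots>, b\<^sub>k]\<close> of basis vectors stands for the operator
  \<open>\<partial>\<^sub>b\<^sub>1 \<dots> \<partial>\<^sub>b\<^sub>k\<close> of order \<open>k\<close>.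
\<close>

primrec partial_deriv :: "'a::euclidean_space list \<Rightarrow> ('a \<Rightarrow> real) \<Rightarrow> 'a \<Rightarrow> real" where
  "partial_deriv [] f = f"
| "partial_deriv (b # bs) f = (\<lambda>x. frechet_derivative (partial_deriv bs f) (at x) b)"

text \<open>
  Total differentiability of all iterated partial derivatives makes all of them continuous,
  so it amounts to smoothness.
\<close>

definition test_function :: "('a::euclidean_space \<Rightarrow> real) \<Rightarrow> bool" where
  "test_function \<phi> \<longleftrightarrow>
     (\<forall>bs. set bs \<subseteq> Basis \<longrightarrow> (\<forall>x. partial_deriv bs \<phi> differentiable (at x))) \<and>
     compact (closure {x. \<phi> x \<noteq> 0})"

definition has_weak_deriv ::
    "'a::euclidean_space list \<Rightarrow> ('a \<Rightarrow> complex) \<Rightarrow> ('a \<Rightarrow> complex) \<Rightarrow> bool" where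
  "has_weak_deriv bs f g \<longleftrightarrow>
     (\<forall>\<phi>. test_function \<phi> \<longrightarrow>
        (\<integral>x. partial_deriv bs \<phi> x *\<^sub>R f x \<partial>lborel) =
        (-1) ^ length bs * (\<integral>x. \<phi> x *\<^sub>R g x \<partial>lborel))"

definition H2 :: "('a::euclidean_space \<Rightarrow> complex) set" where
  "H2 = {f \<in> L2. \<forall>bs. set bs \<subseteq> Basis \<and> length bs \<le> 2 \<longrightarrow> (\<exists>g\<in>L2. has_weak_deriv bs f g)}"

text \<open>Weak derivatives are unique up to null sets; this picks a representative.\<close>

definition weak_deriv :: "'a::euclidean_space list \<Rightarrow> ('a \<Rightarrow> complex) \<Rightarrow> 'a \<Rightarrow> complex" where
  "weak_deriv bs f = (SOME g. g \<in> L2 \<and> has_weak_deriv bs f g)"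

definition weak_laplacian :: "('a::euclidean_space \<Rightarrow> complex) \<Rightarrow> 'a \<Rightarrow> complex" where
  "weak_laplacian f x = (\<Sum>b\<in>Basis. weak_deriv [b, b] f x)"

text \<open>
  The sum runs over lists rather than multi-indices, so mixed second derivatives are counted
  twice, as in the Frobenius norm of the Hessian.
\<close>

definition H2_norm :: "('a::euclidean_space \<Rightarrow> complex) \<Rightarrow> real" where
  "H2_norm f = sqrt (\<Sum>bs | set bs \<subseteq> Basis \<and> length bs \<le> 2. (L2_norm (weak_deriv bs f))\<^sup>2)"

definition has_L2_derivative ::
    "(real \<Rightarrow> 'a::euclidean_space \<Rightarrow> complex) \<Rightarrow> ('a \<Rightarrow> complex) \<Rightarrow> real \<Rightarrow> bool" where
  "has_L2_derivative w g t \<longleftrightarrow>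
     ((\<lambda>s. L2_norm (\<lambda>x. (w (t + s) x - w t x) /\<^sub>R s - g x)) \<longlongrightarrow> 0) (at 0)"

text \<open>
  Strong solution of \<open>\<partial>\<^sub>t\<^sub>t w = c\<^sup>2 \<Delta> w\<close> on the whole time axis with data \<open>(f\<^sub>0, 0)\<close> at time 0:
  \<open>w\<close> is twice continuously differentiable in time with values in \<^const>\<open>L2\<close>, and takes values
  in \<^const>\<open>H2\<close>. Such a \<open>w\<close> is unique up to a null set of points \<open>x\<close> for each \<open>t\<close>. Joint
  measurability makes \<open>w (T \<omega>) x\<close>, for a random time \<open>T\<close> and almost every \<open>x\<close>,
  a random variable whose law does not depend on the chosen version of \<open>w\<close>.
\<close>

definition wave_solution ::
    "real \<Rightarrow> ('a::euclidean_space \<Rightarrow> complex) \<Rightarrow> (real \<Rightarrow> 'a \<Rightarrow> complex) \<Rightarrow> bool" where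
  "wave_solution c f0 w \<longleftrightarrow>
     (\<lambda>(t, x). w t x) \<in> borel_measurable (lborel \<Otimes>\<^sub>M lborel) \<and>
     (\<forall>t. w t \<in> H2) \<and>
     (\<exists>w' w''.
        (\<forall>t. w' t \<in> L2 \<and> has_L2_derivative w (w' t) t) \<and>
        (\<forall>t. w'' t \<in> L2 \<and> has_L2_derivative w' (w'' t) t) \<and>
        (\<forall>t. ((\<lambda>s. L2_norm (\<lambda>x. w'' s x - w'' t x)) \<longlongrightarrow> 0) (at t)) \<and>
        (\<forall>t. AE x in lborel. w'' t x = of_real (c\<^sup>2) * weak_laplacian (w t) x) \<and>
        (AE x in lborel. w 0 x = f0 x) \<and>
        (AE x in lborel. w' 0 x = 0))"

text \<open>Processes are indexed by \<^typ>\<open>real\<close>, but only their values at times \<open>t \<ge> 0\<close> matter.\<close>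

definition independent_increments :: "'p measure \<Rightarrow> (real \<Rightarrow> 'p \<Rightarrow> real) \<Rightarrow> bool" where
  "independent_increments M X \<longleftrightarrow>
     (\<forall>t :: nat \<Rightarrow> real. 0 \<le> t 0 \<and> mono t \<longrightarrow>
        prob_space.indep_vars M (\<lambda>_. borel) (\<lambda>i \<omega>. X (t (Suc i)) \<omega> - X (t i) \<omega>) UNIV)"

definition poisson_process :: "'p measure \<Rightarrow> real \<Rightarrow> (real \<Rightarrow> 'p \<Rightarrow> nat) \<Rightarrow> bool" where
  "poisson_process M a N \<longleftrightarrow>
     prob_space M \<and>
     (\<forall>t\<ge>0. N t \<in> M \<rightarrow>\<^sub>M count_space UNIV) \<and>
     (\<forall>\<omega>\<in>space M. N 0 \<omega> = 0 \<and> mono_on {0..} (\<lambda>t. N t \<omega>) \<and>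
        (\<forall>t\<ge>0. continuous (at_right t) (\<lambda>s. N s \<omega>))) \<and>
     independent_increments M (\<lambda>t \<omega>. real (N t \<omega>)) \<and>
     (\<forall>s t. 0 \<le> s \<and> s < t \<longrightarrow>
        distr M (count_space UNIV) (\<lambda>\<omega>. N t \<omega> - N s \<omega>) = measure_pmf (poisson_pmf (a * (t - s))))"

definition wiener_process :: "'p measure \<Rightarrow> (real \<Rightarrow> 'p \<Rightarrow> real) \<Rightarrow> bool" where
  "wiener_process M W \<longleftrightarrow>
     prob_space M \<and>
     (\<forall>t\<ge>0. W t \<in> borel_measurable M) \<and>
     (\<forall>\<omega>\<in>space M. W 0 \<omega> = 0 \<and> continuous_on {0..} (\<lambda>t. W t \<omega>)) \<and>
     independent_increments M W \<and>
     (\<forall>s t. 0 \<le> s \<and> s < t \<longrightarrow>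
        distributed M lborel (\<lambda>\<omega>. W t \<omega> - W s \<omega>) (normal_density 0 (sqrt (t - s))))"

definition random_time :: "(real \<Rightarrow> 'p \<Rightarrow> nat) \<Rightarrow> real \<Rightarrow> 'p \<Rightarrow> real" where
  "random_time N t \<omega> = (LBINT s:{0..t}. (-1) ^ N s \<omega>)"

end

theory Submission
  imports Defs
begin

text \<open>
  The estimate already holds with \<open>\<parallel>f\<^sub>0\<parallel>\<close> in place of the \<open>H\<^sup>2\<close> norm and with the first error term
  alone. A wave solution \<open>w\<close> of speed 1 behaves like \<open>cos (t \<surd>-\<Delta>) f\<^sub>0\<close>: symmetry of the weak Laplacian and
  d'Alembert's formula give \<open>\<langle>w t, w s\<rangle> = (g (t + s) + g (t - s)) / 2\<close> for an even function \<open>g\<close>, which is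
  bounded by \<open>g 0 = \<parallel>f\<^sub>0\<parallel>\<^sup>2\<close> because the Laplacian is nonpositive. Both \<open>h t\<close> and \<open>u t\<close> are averages of \<open>w\<close> over
  random times, with laws \<open>\<alpha>\<close> and \<open>\<beta>\<close>. Positive definiteness of \<open>g\<close>, tested against Gaussians instead of
  using Bochner's theorem, yields \<open>\<parallel>h t - u t\<parallel> \<le> \<surd>2 M \<parallel>f\<^sub>0\<parallel>\<close>, where \<open>M\<close> bounds the difference of the cosine
  transforms of \<open>\<alpha>\<close> and \<open>\<beta>\<close> uniformly in the frequency. The transform of \<open>\<alpha>\<close> is Gaussian; that of \<open>\<beta>\<close> solves
  the telegraph equation, and Lyapunov functions show that the two differ by at most \<open>37 / (a t)\<close>.
\<close>

section \<open>The space of square-integrable functions\<close>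

text \<open>If \<mu> were the spectral measure of the datum, \<open>g\<close> would be its cosine
  transform and the squared distance of \<open>h t\<close> and \<open>u t\<close> the \<mu>-integral
  of the squared difference of the transforms of \<alpha> and \<beta>. Two obstacles shape the
  proof. Weak derivatives are tested against smooth functions of compact support, while symmetry of
  the Laplacian pairs two elements of \<open>H2\<close>. In place of a density argument,
  \<open>F\<close> is correlated with the translates of \<open>G\<close>: this is a bounded function
  of the shift, continuous at 0, on which test functions act, and its value at shift 0 is the inner
  product. Secondly, \<mu> is not at hand; Gaussian-damped cosine integrals of \<open>g\<close>
  stand for its density smoothed at scale \<delta>, and \<delta> tends to 0 at the end. After a
  change of time scale both solutions have speed 1, and the laws to compare are those of
  \<open>\<sigma> * W t\<close> and \<open>c * \<tau> t\<close>. The relation between \<sigma>,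
  \<open>c\<close> and \<open>a\<close> makes their transforms agree to leading order at low
  frequencies; at high frequencies both are exponentially small in a t. The constant 53 is 37 times
  sqrt 2, rounded up.\<close>

definition ip :: "('a::euclidean_space \<Rightarrow> complex) \<Rightarrow> ('a \<Rightarrow> complex) \<Rightarrow> real" where
  "ip f g = (\<integral>x. f x \<bullet> g x \<partial>lborel)"

lemma L2I:
  "f \<in> borel_measurable lborel \<Longrightarrow> integrable lborel (\<lambda>x. (cmod (f x))\<^sup>2) \<Longrightarrow> f \<in> L2"
  by (simp add: L2_def)

lemma L2_measurable [measurable_dest]: "f \<in> L2 \<Longrightarrow> f \<in> borel_measurable borel"
  by (simp add: L2_def)

lemma L2_integrable: "f \<in> L2 \<Longrightarrow> integrable lborel (\<lambda>x. (cmod (f x))\<^sup>2)"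
  by (simp add: L2_def)

lemma L2_norm_nonneg: "0 \<le> L2_norm f"
  by (simp add: L2_norm_def)

lemma L2_norm_sq: "(L2_norm f)\<^sup>2 = ip f f"
  by (simp add: L2_norm_def ip_def power2_norm_eq_inner flip: power2_norm_eq_inner)

lemma two_norms_le: "2 * (cmod a * cmod b) \<le> (cmod a)\<^sup>2 + (cmod b)\<^sup>2"
  using sum_squares_bound[of "cmod a" "cmod b"] by (simp add: mult.assoc)

lemma integrable_cmod_mult:
  assumes "f \<in> L2" "g \<in> L2"
  shows "integrable lborel (\<lambda>x. cmod (f x) * cmod (g x))"
proof (rule Bochner_Integration.integrable_bound)
  show "integrable lborel (\<lambda>x. (cmod (f x))\<^sup>2 + (cmod (g x))\<^sup>2)"
    using assms by (intro Bochner_Integration.integrable_add L2_integrable)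
  show "(\<lambda>x. cmod (f x) * cmod (g x)) \<in> borel_measurable lborel"
    using assms by (auto dest!: L2_measurable)
  have "cmod a * cmod b \<le> (cmod a)\<^sup>2 + (cmod b)\<^sup>2" for a b
    using two_norms_le[of a b] mult_nonneg_nonneg[OF norm_ge_zero[of a] norm_ge_zero[of b]] by linarith
  then show "AE x in lborel. norm (cmod (f x) * cmod (g x)) \<le> norm ((cmod (f x))\<^sup>2 + (cmod (g x))\<^sup>2)"
    by auto
qed

lemma integrable_ip:
  assumes "f \<in> L2" "g \<in> L2"
  shows "integrable lborel (\<lambda>x. f x \<bullet> g x)"
proof (rule Bochner_Integration.integrable_bound[OF integrable_cmod_mult[OF assms]])
  show "(\<lambda>x. f x \<bullet> g x) \<in> borel_measurable lborel"
    using assms by (auto dest!: L2_measurable)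
qed (auto simp: Cauchy_Schwarz_ineq2)

lemma L2_add: assumes "f \<in> L2" "g \<in> L2" shows "(\<lambda>x. f x + g x) \<in> L2"
proof (rule L2I)
  show "(\<lambda>x. f x + g x) \<in> borel_measurable lborel"
    using assms by (auto dest!: L2_measurable)
  have "(\<lambda>x. (cmod (f x + g x))\<^sup>2) = (\<lambda>x. (cmod (f x))\<^sup>2 + 2 * (f x \<bullet> g x) + (cmod (g x))\<^sup>2)"
    by (simp add: power2_norm_eq_inner inner_add inner_commute algebra_simps)
  then show "integrable lborel (\<lambda>x. (cmod (f x + g x))\<^sup>2)"
    using assms by (simp add: L2_integrable integrable_ip)
qed

lemma L2_scaleR: assumes "f \<in> L2" shows "(\<lambda>x. c *\<^sub>R f x) \<in> L2"
  using assms L2_integrable[OF assms]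
  by (auto intro!: L2I dest!: L2_measurable simp: power_mult_distrib)

lemma L2_diff: "f \<in> L2 \<Longrightarrow> g \<in> L2 \<Longrightarrow> (\<lambda>x. f x - g x) \<in> L2"
  using L2_add[of f "\<lambda>x. (-1) *\<^sub>R g x"] L2_scaleR[of g "-1"] by simp

lemma L2_zero: "(\<lambda>x. 0) \<in> L2"
  by (auto intro!: L2I)

lemma ip_commute: "ip f g = ip g f"
  by (simp add: ip_def inner_commute)

lemma ip_add_left: "f \<in> L2 \<Longrightarrow> g \<in> L2 \<Longrightarrow> h \<in> L2 \<Longrightarrow> ip (\<lambda>x. f x + g x) h = ip f h + ip g h"
  by (simp add: ip_def inner_add_left integrable_ip)

lemma ip_diff_left: "f \<in> L2 \<Longrightarrow> g \<in> L2 \<Longrightarrow> h \<in> L2 \<Longrightarrow> ip (\<lambda>x. f x - g x) h = ip f h - ip g h"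
  by (simp add: ip_def inner_diff_left integrable_ip)

lemma ip_add_right: "f \<in> L2 \<Longrightarrow> g \<in> L2 \<Longrightarrow> h \<in> L2 \<Longrightarrow> ip h (\<lambda>x. f x + g x) = ip h f + ip h g"
  by (simp add: ip_def inner_add_right integrable_ip)

lemma ip_diff_right: "f \<in> L2 \<Longrightarrow> g \<in> L2 \<Longrightarrow> h \<in> L2 \<Longrightarrow> ip h (\<lambda>x. f x - g x) = ip h f - ip h g"
  by (simp add: ip_def inner_diff_right integrable_ip)

lemma ip_scaleR_left: "ip (\<lambda>x. c *\<^sub>R f x) g = c * ip f g"
  by (simp add: ip_def)

lemma ip_scaleR_right: "ip f (\<lambda>x. c *\<^sub>R g x) = c * ip f g"
  by (simp add: ip_def)

lemma ip_nonneg: "0 \<le> ip f f"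
  by (simp add: ip_def)

lemma ip_cong_AE:
  assumes "f \<in> L2" "f' \<in> L2" "g \<in> L2" "g' \<in> L2"
    and "AE x in lborel. f x = f' x" "AE x in lborel. g x = g' x"
  shows "ip f g = ip f' g'"
  unfolding ip_def using assms
  by (intro integral_cong_AE) (auto dest!: L2_measurable)

lemma ip_sum_left:
  assumes "finite I" "\<And>i. i \<in> I \<Longrightarrow> f i \<in> L2" "g \<in> L2"
  shows "ip (\<lambda>x. \<Sum>i\<in>I. f i x) g = (\<Sum>i\<in>I. ip (f i) g)"
  unfolding ip_def inner_sum_left using assms
  by (intro Bochner_Integration.integral_sum integrable_ip) auto

lemma L2_sum:
  assumes "finite I" "\<And>i. i \<in> I \<Longrightarrow> f i \<in> L2"
  shows "(\<lambda>x. \<Sum>i\<in>I. f i x) \<in> L2"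
  using assms by (induction I rule: finite_induct) (auto intro: L2_zero L2_add)

lemma ip_expand:
  assumes "f \<in> L2" "g \<in> L2"
  shows "ip (\<lambda>x. s *\<^sub>R f x - t *\<^sub>R g x) (\<lambda>x. s *\<^sub>R f x - t *\<^sub>R g x) =
    s\<^sup>2 * ip f f - 2 * s * t * ip f g + t\<^sup>2 * ip g g"
proof -
  note L = assms L2_scaleR[OF assms(1)] L2_scaleR[OF assms(2)]
  show ?thesis
    by (simp add: L L2_diff ip_diff_left ip_diff_right ip_scaleR_left ip_scaleR_right
        ip_commute[of g f] power2_eq_square algebra_simps)
qed

lemma ip_Cauchy_Schwarz:
  assumes "f \<in> L2" "g \<in> L2"
  shows "\<bar>ip f g\<bar> \<le> L2_norm f * L2_norm g"
proof -
  have q: "0 \<le> s\<^sup>2 * ip f f - 2 * s * t * ip f g + t\<^sup>2 * ip g g" for s t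
    using ip_nonneg ip_expand[OF assms, of s t] by metis
  have "(ip f g)\<^sup>2 \<le> ip f f * ip g g"
  proof (cases "ip g g = 0")
    case True
    have "ip f g = 0"
    proof (rule ccontr)
      assume n: "ip f g \<noteq> 0"
      \<comment> \<open>With \<open>ip g g = 0\<close> the form is affine in the second coefficient,
        which is chosen so that the value is -1.\<close>
      have "0 \<le> ip f f - 2 * ((ip f f + 1) / (2 * ip f g)) * ip f g"
        using q[of 1 "(ip f f + 1) / (2 * ip f g)"] True by simp
      then show False using n by (simp add: field_simps)
    qed
    then show ?thesis using True by simp
  next
    case False
    then have p: "ip g g > 0" using ip_nonneg[of g] by linarith
    have "0 \<le> ip g g * (ip f f * ip g g - (ip f g)\<^sup>2)"
      using q[of "ip g g" "ip f g"] by (simp add: power2_eq_square algebra_simps)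
    with p show ?thesis by (simp add: zero_le_mult_iff)
  qed
  also have "\<dots> = (L2_norm f * L2_norm g)\<^sup>2"
    by (simp add: power_mult_distrib L2_norm_sq)
  finally have "\<bar>ip f g\<bar>\<^sup>2 \<le> (L2_norm f * L2_norm g)\<^sup>2" by simp
  then show ?thesis
    by (rule power2_le_imp_le) (simp add: L2_norm_nonneg)
qed

lemma L2_norm_scaleR: "L2_norm (\<lambda>x. c *\<^sub>R f x) = \<bar>c\<bar> * L2_norm f"
  by (simp add: L2_norm_def power_mult_distrib real_sqrt_mult)

lemma L2_norm_triangle:
  assumes "f \<in> L2" "g \<in> L2"
  shows "L2_norm (\<lambda>x. f x + g x) \<le> L2_norm f + L2_norm g"
proof -
  have "(L2_norm (\<lambda>x. f x + g x))\<^sup>2 = (L2_norm f)\<^sup>2 + 2 * ip f g + (L2_norm g)\<^sup>2"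
    by (simp add: L2_norm_sq assms ip_add_left ip_add_right L2_add ip_commute[of g f])
  also have "\<dots> \<le> (L2_norm f + L2_norm g)\<^sup>2"
    using ip_Cauchy_Schwarz[OF assms] by (simp add: power2_sum)
  finally show ?thesis
    by (rule power2_le_imp_le) (simp add: L2_norm_nonneg)
qed

section \<open>Invariance of the L2 norm under translation\<close>

lemma integral_lborel_shift:
  fixes f :: "'a::euclidean_space \<Rightarrow> 'b::{banach, second_countable_topology}"
  assumes [measurable]: "f \<in> borel_measurable borel"
  shows "(\<integral>x. f (x + c) \<partial>lborel) = (\<integral>x. f x \<partial>lborel)"
proof -
  have "(\<integral>x. f x \<partial>lborel) = (\<integral>x. f x \<partial>distr lborel borel ((+) c))"
    by (simp add: lborel_distr_plus)
  also have "\<dots> = (\<integral>x. f (c + x) \<partial>lborel)"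
    by (rule integral_distr) auto
  finally show ?thesis by (simp add: add.commute)
qed

lemma integrable_lborel_shift:
  fixes f :: "'a::euclidean_space \<Rightarrow> 'b::{banach, second_countable_topology}"
  assumes "integrable lborel f"
  shows "integrable lborel (\<lambda>x. f (x + c))"
proof -
  have "integrable (distr lborel borel ((+) c)) f"
    using assms by (simp add: lborel_distr_plus)
  then show ?thesis
    by (subst (asm) integrable_distr_eq) (use assms in \<open>auto simp: add.commute\<close>)
qed

lemma L2_shift:
  assumes "f \<in> L2" shows "(\<lambda>x. f (x + c)) \<in> L2"
proof (rule L2I)
  show "(\<lambda>x. f (x + c)) \<in> borel_measurable lborel"
    using assms by (auto dest!: L2_measurable)
qed (rule integrable_lborel_shift[OF L2_integrable[OF assms]])

lemma L2_norm_shift: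
  assumes "f \<in> L2" shows "L2_norm (\<lambda>x. f (x + c)) = L2_norm f"
  unfolding L2_norm_def using L2_measurable[OF assms]
  by (subst integral_lborel_shift[of "\<lambda>x. (cmod (f x))\<^sup>2"]) auto

section \<open>Test functions\<close>

text \<open>A family closed under differentiation: a derivative changes the numerator
  \<open>p\<close> and raises the exponent \<open>n\<close> by 2. For \<open>p = 1\<close> and
  \<open>n = 0\<close> it is the standard smooth bump on (-1, 1); the general form makes all
  iterated derivatives of this bump explicit.\<close>

definition bump_fun :: "real poly \<Rightarrow> nat \<Rightarrow> real \<Rightarrow> real" where
  "bump_fun p n t = (if \<bar>t\<bar> < 1 then poly p t / (1 - t\<^sup>2) ^ n * exp (- 1 / (1 - t\<^sup>2)) else 0)"

text \<open>With v = 1 - t^2, the three summands come from differentiating \<open>p\<close>, v^(-n)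
  and exp (- 1 / v), brought to the common denominator v^(n + 2).\<close>

definition bump_deriv :: "real poly \<Rightarrow> nat \<Rightarrow> real poly" where
  "bump_deriv p n = pderiv p * [:1, 0, -1:] ^ 2 + smult (2 * real n) ([:0, 1:] * p * [:1, 0, -1:])
     - smult 2 ([:0, 1:] * p)"

text \<open>The constant comes from exp y >= (1 + y / m)^m >= (y / m)^m.\<close>

lemma power_mult_exp_neg_le:
  assumes "0 \<le> y" "0 < m"
  shows "y ^ m * exp (- y) \<le> real m ^ m"
proof -
  have "(y / real m) ^ m \<le> (1 + y / real m) ^ m"
    using assms by (intro power_mono) auto
  also have "\<dots> \<le> exp y"
    using assms exp_ge_one_plus_x_over_n_power_n[of m y] by simp
  finally have "y ^ m \<le> real m ^ m * exp y"
    using assms by (simp add: power_divide pos_divide_le_eq mult.commute)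
  then show ?thesis by (simp add: exp_minus field_simps)
qed

text \<open>Serves differentiability at the endpoints of the support, where the difference quotient
  is then at most \<open>K * \<bar>s - t\<bar>\<close>. With v = 1 - s^2, the exponential absorbs
  the pole v^(-n) and two further powers, which leaves a multiple of v^2, and v is at most twice the
  distance of \<open>s\<close> to \<open>t\<close>.\<close>

lemma bump_fun_quadratic_bound:
  obtains K where "0 \<le> K" "\<And>s t. \<bar>t\<bar> = 1 \<Longrightarrow> \<bar>bump_fun p n s\<bar> \<le> K * (s - t)\<^sup>2"
proof -
  have "compact (poly p ` {-1..1})"
    by (intro compact_continuous_image continuous_intros) auto
  then obtain B where B: "\<And>s. \<bar>s\<bar> \<le> 1 \<Longrightarrow> \<bar>poly p s\<bar> \<le> B"
    unfolding compact_eq_bounded_closed bounded_iff by (fastforce simp: abs_le_iff)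
  define L where "L = real (n + 2) ^ (n + 2)"
  have L: "0 \<le> L" by (simp add: L_def)
  have B0: "0 \<le> B" using B[of 0] by simp
  show thesis
  proof (rule that[of "B * (4 * L)"])
    show "0 \<le> B * (4 * L)" using B0 L by simp
    fix s t :: real assume t: "\<bar>t\<bar> = 1"
    show "\<bar>bump_fun p n s\<bar> \<le> B * (4 * L) * (s - t)\<^sup>2"
    proof (cases "\<bar>s\<bar> < 1")
      case False
      then show ?thesis using B0 L by (simp add: bump_fun_def)
    next
      case True
      define v where "v = 1 - s\<^sup>2"
      have v: "0 < v" using True by (simp add: v_def abs_square_less_1)
      have "v = (1 - \<bar>s\<bar>) * (1 + \<bar>s\<bar>)" by (simp add: v_def power2_eq_square algebra_simps)
      also have "\<dots> \<le> (1 - \<bar>s\<bar>) * 2" using True by (intro mult_left_mono) auto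
      also have "\<dots> \<le> \<bar>s - t\<bar> * 2" using t abs_triangle_ineq2_sym[of t s] by simp
      finally have v2: "v\<^sup>2 \<le> 4 * (s - t)\<^sup>2"
        using v power_mono[of v "\<bar>s - t\<bar> * 2" 2] by (simp add: power_mult_distrib)
      have "(1 / v) ^ (n + 2) * exp (- (1 / v)) \<le> L"
        unfolding L_def using v by (intro power_mult_exp_neg_le) auto
      then have "1 / v ^ n * exp (- 1 / v) \<le> L * v\<^sup>2"
        using v by (simp add: field_simps power_add power2_eq_square)
      also have "\<dots> \<le> L * (4 * (s - t)\<^sup>2)" using v2 L by (rule mult_left_mono)
      finally have e: "1 / v ^ n * exp (- 1 / v) \<le> L * (4 * (s - t)\<^sup>2)" .
      have "\<bar>bump_fun p n s\<bar> = \<bar>poly p s\<bar> * (1 / v ^ n * exp (- 1 / v))"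
        using True v by (simp add: bump_fun_def v_def abs_mult)
      also have "\<dots> \<le> B * (L * (4 * (s - t)\<^sup>2))"
        by (rule mult_mono[OF B e]) (use True B0 v in auto)
      finally show ?thesis by (simp add: mult_ac)
    qed
  qed
qed

lemma bump_fun_has_derivative:
  "(bump_fun p n has_real_derivative bump_fun (bump_deriv p n) (n + 2) t) (at t)"
proof -
  consider "\<bar>t\<bar> < 1" | "\<bar>t\<bar> > 1" | "\<bar>t\<bar> = 1" by linarith
  then show ?thesis
  proof cases
    case 1
    define v where "v = 1 - t\<^sup>2"
    \<comment> \<open>In terms of y = 1 / (1 - s^2) the function is a product without quotients, and
      y' = 2 s y^2; the relation \<open>v * y t = 1\<close> converts back.\<close>
    define y where "y s = inverse (1 - s\<^sup>2)" for s :: real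
    have "0 < v" using 1 by (simp add: v_def abs_square_less_1)
    then have vy: "v * y t = 1" by (simp add: y_def v_def)
    have dy: "(y has_real_derivative 2 * t * (y t)\<^sup>2) (at t)"
      unfolding y_def using \<open>0 < v\<close>
      by (auto intro!: derivative_eq_intros simp: v_def power2_eq_square)
    have dyn: "((\<lambda>t. y t ^ n) has_real_derivative 2 * real n * t * y t * y t ^ n) (at t)"
    proof (cases n)
      case (Suc m)
      show ?thesis unfolding Suc
        by (rule DERIV_cong[OF DERIV_power[OF dy]]) (simp add: power2_eq_square algebra_simps)
    qed simp
    have de: "((\<lambda>t. exp (- y t)) has_real_derivative exp (- y t) * - (2 * t * (y t)\<^sup>2)) (at t)"
      by (rule DERIV_chain2[OF DERIV_exp DERIV_minus[OF dy]])
    have "((\<lambda>t. poly p t * y t ^ n * exp (- y t)) has_real_derivative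
        (poly (pderiv p) t + 2 * real n * t * poly p t * y t - 2 * t * poly p t * (y t)\<^sup>2) * y t ^ n * exp (- y t)) (at t)"
      by (rule DERIV_cong[OF DERIV_mult[OF DERIV_mult[OF poly_DERIV dyn] de]])
        (simp add: algebra_simps)
    also have "(poly (pderiv p) t + 2 * real n * t * poly p t * y t - 2 * t * poly p t * (y t)\<^sup>2) * y t ^ n * exp (- y t)
        = bump_fun (bump_deriv p n) (n + 2) t"
    proof -
      have "poly (bump_deriv p n) t = poly (pderiv p) t * v\<^sup>2 + 2 * real n * t * poly p t * v - 2 * t * poly p t"
        by (simp add: bump_deriv_def poly_power v_def power2_eq_square algebra_simps)
      then have "poly (bump_deriv p n) t * (y t)\<^sup>2 =
          poly (pderiv p) t * (v * y t)\<^sup>2 + 2 * real n * t * poly p t * (v * y t) * y t - 2 * t * poly p t * (y t)\<^sup>2"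
        by (simp only:) (simp add: algebra_simps power2_eq_square)
      then have *: "poly (bump_deriv p n) t * (y t)\<^sup>2 =
          poly (pderiv p) t + 2 * real n * t * poly p t * y t - 2 * t * poly p t * (y t)\<^sup>2"
        by (simp add: vy)
      have "bump_fun (bump_deriv p n) (n + 2) t = poly (bump_deriv p n) t * y t ^ (n + 2) * exp (- y t)"
        using 1 by (simp only: bump_fun_def y_def) (simp add: divide_inverse power_inverse)
      also have "\<dots> = (poly (bump_deriv p n) t * (y t)\<^sup>2) * y t ^ n * exp (- y t)"
        by (simp add: power2_eq_square mult_ac)
      finally show ?thesis by (simp only: *)
    qed
    finally have "((\<lambda>t. poly p t * y t ^ n * exp (- y t)) has_real_derivative
        bump_fun (bump_deriv p n) (n + 2) t) (at t)" .
    then show ?thesis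
      by (rule has_field_derivative_transform_within_open[where S = "{-1<..<1}"])
        (use 1 in \<open>auto simp: bump_fun_def y_def divide_inverse power_inverse\<close>)
  next
    case 2
    have "((\<lambda>_. 0) has_real_derivative bump_fun (bump_deriv p n) (n + 2) t) (at t)"
      using 2 by (simp add: bump_fun_def)
    moreover have "open (- {-1..1::real})" by (intro open_Compl closed_real_atLeastAtMost)
    ultimately show ?thesis
      by (rule has_field_derivative_transform_within_open) (use 2 in \<open>auto simp: bump_fun_def\<close>)
  next
    case 3
    obtain K where K: "0 \<le> K" "\<And>s t. \<bar>t\<bar> = 1 \<Longrightarrow> \<bar>bump_fun p n s\<bar> \<le> K * (s - t)\<^sup>2"
      using bump_fun_quadratic_bound by blast
    have z: "bump_fun p n t = 0" "bump_fun (bump_deriv p n) (n + 2) t = 0"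
      using 3 by (auto simp: bump_fun_def)
    have "((\<lambda>s. (bump_fun p n s - bump_fun p n t) / (s - t)) \<longlongrightarrow> 0) (at t)"
    proof (rule Lim_null_comparison)
      show "((\<lambda>s. K * \<bar>s - t\<bar>) \<longlongrightarrow> 0) (at t)"
        by (auto intro!: tendsto_eq_intros)
      show "\<forall>\<^sub>F s in at t. norm ((bump_fun p n s - bump_fun p n t) / (s - t)) \<le> K * \<bar>s - t\<bar>"
        using K(2)[OF 3] by (auto simp: eventually_at_filter z divide_simps power2_eq_square
            abs_mult_self_eq mult.assoc intro!: always_eventually)
    qed
    then show ?thesis by (simp only: has_field_derivative_iff z)
  qed
qed

text \<open>A partial derivative in direction \<open>c\<close> acts on the factor belonging to
  \<open>c\<close> alone, so products of members of the one-dimensional family stay such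
  products.\<close>

lemma partial_deriv_prod_bump:
  fixes p :: "'a::euclidean_space \<Rightarrow> real poly"
  assumes "set bs \<subseteq> Basis"
  shows "\<exists>q m. partial_deriv bs (\<lambda>x. \<Prod>b\<in>Basis. bump_fun (p b) (n b) (x \<bullet> b)) =
    (\<lambda>x. \<Prod>b\<in>Basis. bump_fun (q b) (m b) (x \<bullet> b))"
  using assms
proof (induction bs)
  case Nil
  then show ?case by auto
next
  case (Cons c bs)
  then obtain q m where qm: "partial_deriv bs (\<lambda>x. \<Prod>b\<in>Basis. bump_fun (p b) (n b) (x \<bullet> b)) =
    (\<lambda>x. \<Prod>b\<in>Basis. bump_fun (q b) (m b) (x \<bullet> b))" by auto
  have c: "c \<in> Basis" using Cons by simp
  let ?d = "\<lambda>b. bump_deriv (q b) (m b)"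
  have "frechet_derivative (\<lambda>x. \<Prod>b\<in>Basis. bump_fun (q b) (m b) (x \<bullet> b)) (at x) c =
     (\<Prod>b\<in>Basis. bump_fun ((q(c := ?d c)) b) ((m(c := m c + 2)) b) (x \<bullet> b))" for x
  proof -
    have "((\<lambda>x. bump_fun (q b) (m b) (x \<bullet> b)) has_derivative
        (\<lambda>h. (h \<bullet> b) * bump_fun (?d b) (m b + 2) (x \<bullet> b))) (at x)" for b
      using bump_fun_has_derivative[of "q b" "m b" "x \<bullet> b"]
      by (rule DERIV_compose_FDERIV) (auto intro!: derivative_eq_intros)
    then have "((\<lambda>x. \<Prod>b\<in>Basis. bump_fun (q b) (m b) (x \<bullet> b)) has_derivative
        (\<lambda>h. \<Sum>i\<in>Basis. (h \<bullet> i) * bump_fun (?d i) (m i + 2) (x \<bullet> i) *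
           (\<Prod>j\<in>Basis - {i}. bump_fun (q j) (m j) (x \<bullet> j)))) (at x)"
      by (rule has_derivative_prod)
    then have "frechet_derivative (\<lambda>x. \<Prod>b\<in>Basis. bump_fun (q b) (m b) (x \<bullet> b)) (at x) c =
       (\<Sum>i\<in>Basis. (c \<bullet> i) * bump_fun (?d i) (m i + 2) (x \<bullet> i) *
           (\<Prod>j\<in>Basis - {i}. bump_fun (q j) (m j) (x \<bullet> j)))"
      by (rule fun_cong[OF sym[OF frechet_derivative_at]])
    also have "\<dots> = (\<Sum>i\<in>Basis. if i = c then bump_fun (?d c) (m c + 2) (x \<bullet> c) *
           (\<Prod>j\<in>Basis - {c}. bump_fun (q j) (m j) (x \<bullet> j)) else 0)"
      by (rule sum.cong) (use c in \<open>auto simp: inner_Basis\<close>)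
    also have "\<dots> = bump_fun (?d c) (m c + 2) (x \<bullet> c) *
           (\<Prod>j\<in>Basis - {c}. bump_fun (q j) (m j) (x \<bullet> j))"
      using c by simp
    also have "\<dots> = (\<Prod>b\<in>Basis. bump_fun ((q(c := ?d c)) b) ((m(c := m c + 2)) b) (x \<bullet> b))"
      using c by (subst (2) prod.remove[of _ c]) auto
    finally show ?thesis .
  qed
  then show ?case by (auto simp: qm)
qed

text \<open>A tensor product rather than a radial bump, so that partial derivatives reduce to one
  variable. It is positive exactly on the open cube of points whose coordinates are all below 1 in
  modulus.\<close>

definition unit_bump :: "'a::euclidean_space \<Rightarrow> real" where
  "unit_bump x = (\<Prod>b\<in>Basis. bump_fun 1 0 (x \<bullet> b))"

lemma unit_bump_nonneg: "0 \<le> unit_bump x"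
  by (auto simp: unit_bump_def bump_fun_def intro!: prod_nonneg)

lemma unit_bump_pos: "(\<And>b. b \<in> Basis \<Longrightarrow> \<bar>x \<bullet> b\<bar> < 1) \<Longrightarrow> 0 < unit_bump x"
  by (auto simp: unit_bump_def bump_fun_def intro!: prod_pos)

lemma unit_bump_support: "unit_bump x \<noteq> 0 \<Longrightarrow> b \<in> Basis \<Longrightarrow> \<bar>x \<bullet> b\<bar> < 1"
  by (auto simp: unit_bump_def bump_fun_def prod_zero_iff split: if_splits)

lemma test_function_unit_bump: "test_function (unit_bump :: 'a::euclidean_space \<Rightarrow> real)"
  unfolding test_function_def
proof (intro conjI allI impI)
  fix bs :: "'a list" and x :: 'a assume "set bs \<subseteq> Basis"
  then obtain q m where qm: "partial_deriv bs unit_bump =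
    (\<lambda>x::'a. \<Prod>b\<in>Basis. bump_fun (q b) (m b) (x \<bullet> b))"
    using partial_deriv_prod_bump[of bs "\<lambda>_. 1" "\<lambda>_. 0"] by (auto simp: unit_bump_def[abs_def])
  have "((\<lambda>x. bump_fun (q b) (m b) (x \<bullet> b)) has_derivative
        (\<lambda>h. (h \<bullet> b) * bump_fun (bump_deriv (q b) (m b)) (m b + 2) (x \<bullet> b))) (at x)" for b
    using bump_fun_has_derivative[of "q b" "m b" "x \<bullet> b"]
    by (rule DERIV_compose_FDERIV) (auto intro!: derivative_eq_intros)
  from has_derivative_prod[where I = Basis and f = "\<lambda>b x. bump_fun (q b) (m b) (x \<bullet> b)", OF this]
  show "partial_deriv bs unit_bump differentiable at x"
    unfolding qm differentiable_def by blast
next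
  have "{x::'a. unit_bump x \<noteq> 0} \<subseteq> cbox (- One) One"
    using unit_bump_support by (fastforce simp: mem_box abs_less_iff)
  then have "bounded {x::'a. unit_bump x \<noteq> 0}"
    using bounded_cbox bounded_subset by blast
  then show "compact (closure {x::'a. unit_bump x \<noteq> 0})"
    by (simp add: compact_closure)
qed

section \<open>Closure properties and integrability of test functions\<close>

lemma partial_deriv_append: "partial_deriv (cs @ bs) f = partial_deriv cs (partial_deriv bs f)"
  by (induction cs) auto

lemma partial_deriv_zero_on_open:
  assumes "open U" "\<And>x. x \<in> U \<Longrightarrow> f x = 0"
  shows "x \<in> U \<Longrightarrow> partial_deriv bs f x = 0"
proof (induction bs arbitrary: x)
  case (Cons b bs)
  have "((\<lambda>_. 0) has_derivative (\<lambda>_. 0)) (at x)" by simp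
  then have "(partial_deriv bs f has_derivative (\<lambda>_. 0)) (at x)"
    by (rule has_derivative_transform_within_open[OF _ assms(1) Cons.prems]) (use Cons.IH in auto)
  then show ?case by (simp flip: frechet_derivative_at)
qed (use assms in auto)

lemma test_function_partial_deriv:
  assumes "test_function \<phi>" "set bs \<subseteq> Basis"
  shows "test_function (partial_deriv bs \<phi>)"
proof -
  let ?K = "closure {x. \<phi> x \<noteq> 0}"
  have "partial_deriv bs \<phi> x = 0" if "x \<in> - ?K" for x
  proof (rule partial_deriv_zero_on_open[OF _ _ that])
    fix y assume "y \<in> - ?K"
    then show "\<phi> y = 0" using closure_subset[of "{x. \<phi> x \<noteq> 0}"] by blast
  qed (rule open_Compl[OF closed_closure])
  then have "{x. partial_deriv bs \<phi> x \<noteq> 0} \<subseteq> ?K" by blast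
  moreover have "bounded ?K" using assms(1) by (simp add: test_function_def compact_imp_bounded)
  ultimately have "compact (closure {x. partial_deriv bs \<phi> x \<noteq> 0})"
    unfolding compact_closure by (rule bounded_subset[rotated])
  then show ?thesis
    using assms by (simp add: test_function_def flip: partial_deriv_append)
qed

lemma test_function_differentiable:
  "test_function \<phi> \<Longrightarrow> \<phi> differentiable (at x)"
  unfolding test_function_def by (metis empty_subsetI list.set(1) partial_deriv.simps(1))

lemma test_function_continuous: "test_function \<phi> \<Longrightarrow> continuous_on UNIV \<phi>"
  using test_function_differentiable
  by (auto intro!: continuous_at_imp_continuous_on differentiable_imp_continuous_within)

lemma test_function_measurable: "test_function \<phi> \<Longrightarrow> \<phi> \<in> borel_measurable borel"
  by (intro borel_measurable_continuous_onI test_function_continuous)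

lemma test_function_bounded:
  assumes "test_function \<phi>"
  obtains B where "\<And>x. \<bar>\<phi> x\<bar> \<le> B"
proof -
  let ?K = "closure {x. \<phi> x \<noteq> 0}"
  have "compact (\<phi> ` ?K)"
    using assms continuous_on_subset[OF test_function_continuous[OF assms]]
    by (auto simp: test_function_def intro!: compact_continuous_image)
  then obtain B where B: "\<And>x. x \<in> ?K \<Longrightarrow> \<bar>\<phi> x\<bar> \<le> B"
    unfolding compact_eq_bounded_closed bounded_iff by auto
  have "\<bar>\<phi> x\<bar> \<le> max B 0" for x
    using B[of x] closure_subset[of "{x. \<phi> x \<noteq> 0}"] by (cases "\<phi> x = 0") fastforce+
  then show thesis by (rule that)
qed

lemma test_function_integrable:
  assumes "test_function \<phi>"
  shows "integrable lborel \<phi>"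
proof -
  obtain B where B: "\<And>x. \<bar>\<phi> x\<bar> \<le> B" using test_function_bounded[OF assms] by blast
  let ?K = "closure {x. \<phi> x \<noteq> 0}"
  have K: "compact ?K" using assms by (simp add: test_function_def)
  have "integrable lborel (\<lambda>x. B * indicator ?K x)"
    using emeasure_compact_finite[OF K] by (intro integrable_mult_right integrable_real_indicator) auto
  then show ?thesis
  proof (rule Bochner_Integration.integrable_bound)
    show "\<phi> \<in> borel_measurable lborel" using test_function_measurable[OF assms] by simp
    show "AE x in lborel. norm (\<phi> x) \<le> norm (B * indicator ?K x)"
    proof (intro AE_I2)
      fix x show "norm (\<phi> x) \<le> norm (B * indicator ?K x)"
        using B[of x] closure_subset[of "{x. \<phi> x \<noteq> 0}"]
        by (cases "\<phi> x = 0") (auto simp: subset_iff)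
    qed
  qed
qed

lemma test_function_square_integrable:
  assumes "test_function \<phi>"
  shows "integrable lborel (\<lambda>x. (\<phi> x)\<^sup>2)"
proof -
  obtain B where B: "\<And>x. \<bar>\<phi> x\<bar> \<le> B" using test_function_bounded[OF assms] by blast
  have B0: "0 \<le> B" using B[of 0] by linarith
  show ?thesis
  proof (rule Bochner_Integration.integrable_bound)
    show "integrable lborel (\<lambda>x. B * \<phi> x)"
      using test_function_integrable[OF assms] by simp
    show "(\<lambda>x. (\<phi> x)\<^sup>2) \<in> borel_measurable lborel"
      using test_function_measurable[OF assms] by simp
    have "\<bar>\<phi> x\<bar> * \<bar>\<phi> x\<bar> \<le> B * \<bar>\<phi> x\<bar>" for x using B[of x] by (rule mult_right_mono) simp
    then show "AE x in lborel. norm ((\<phi> x)\<^sup>2) \<le> norm (B * \<phi> x)"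
      using B0 by (auto simp: power2_eq_square abs_mult)
  qed
qed

text \<open>One chain rule for the three substitutions that occur: translation
  (\<open>c = 1\<close>), reflection (\<open>c = -1\<close>) and the shrinking of a bump
  (\<open>c = 1 / e\<close>).\<close>

lemma partial_deriv_affine:
  fixes \<phi> :: "'a::euclidean_space \<Rightarrow> real"
  assumes "test_function \<phi>" "set bs \<subseteq> Basis"
  shows "partial_deriv bs (\<lambda>x. \<phi> (c *\<^sub>R x + v)) = (\<lambda>x. c ^ length bs * partial_deriv bs \<phi> (c *\<^sub>R x + v))"
  using assms(2)
proof (induction bs)
  case (Cons b bs)
  have "frechet_derivative (\<lambda>x. c ^ length bs * partial_deriv bs \<phi> (c *\<^sub>R x + v)) (at x) b =
    c ^ Suc (length bs) * frechet_derivative (partial_deriv bs \<phi>) (at (c *\<^sub>R x + v)) b" for x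
  proof -
    let ?D = "frechet_derivative (partial_deriv bs \<phi>) (at (c *\<^sub>R x + v))"
    have D: "(partial_deriv bs \<phi> has_derivative ?D) (at (c *\<^sub>R x + v))"
      using assms(1) Cons.prems by (simp add: test_function_def flip: frechet_derivative_works)
    have "((\<lambda>x. c *\<^sub>R x + v) has_derivative (\<lambda>h. c *\<^sub>R h)) (at x)"
      by (auto intro!: derivative_eq_intros)
    from has_derivative_compose[OF this D]
    have "((\<lambda>x. c ^ length bs * partial_deriv bs \<phi> (c *\<^sub>R x + v)) has_derivative
        (\<lambda>h. c ^ length bs * ?D (c *\<^sub>R h))) (at x)"
      by (auto intro!: derivative_eq_intros)
    then have "frechet_derivative (\<lambda>x. c ^ length bs * partial_deriv bs \<phi> (c *\<^sub>R x + v)) (at x) b =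
        c ^ length bs * ?D (c *\<^sub>R b)"
      by (rule fun_cong[OF sym[OF frechet_derivative_at]])
    also have "?D (c *\<^sub>R b) = c * ?D b"
      using has_derivative_linear[OF D] by (simp add: linear_cmul)
    finally show ?thesis by simp
  qed
  then show ?case using Cons by simp
qed simp

lemma test_function_affine:
  fixes \<phi> :: "'a::euclidean_space \<Rightarrow> real"
  assumes "test_function \<phi>" "c \<noteq> 0"
  shows "test_function (\<lambda>x. \<phi> (c *\<^sub>R x + v))"
  unfolding test_function_def
proof (intro conjI allI impI)
  fix bs :: "'a list" and x :: 'a assume bs: "set bs \<subseteq> Basis"
  have d: "partial_deriv bs \<phi> differentiable at (c *\<^sub>R x + v)"
    using assms bs by (auto simp: test_function_def)
  have "(\<lambda>x. partial_deriv bs \<phi> (c *\<^sub>R x + v)) differentiable at x"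
    by (rule differentiable_compose[of _ "\<lambda>x. c *\<^sub>R x + v"]) (use d in \<open>auto intro!: derivative_intros\<close>)
  then show "partial_deriv bs (\<lambda>x. \<phi> (c *\<^sub>R x + v)) differentiable at x"
    by (simp add: partial_deriv_affine[OF assms(1) bs])
next
  let ?K = "closure {x. \<phi> x \<noteq> 0}"
  have "{x. \<phi> (c *\<^sub>R x + v) \<noteq> 0} \<subseteq> (\<lambda>y. (1 / c) *\<^sub>R (y - v)) ` ?K"
  proof
    fix x assume "x \<in> {x. \<phi> (c *\<^sub>R x + v) \<noteq> 0}"
    then have "c *\<^sub>R x + v \<in> ?K" using closure_subset[of "{x. \<phi> x \<noteq> 0}"] by auto
    moreover have "x = (1 / c) *\<^sub>R ((c *\<^sub>R x + v) - v)" using assms(2) by simp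
    ultimately show "x \<in> (\<lambda>y. (1 / c) *\<^sub>R (y - v)) ` ?K" by blast
  qed
  moreover have "compact ((\<lambda>y. (1 / c) *\<^sub>R (y - v)) ` ?K)"
    using assms by (auto simp: test_function_def intro!: compact_continuous_image continuous_intros)
  ultimately show "compact (closure {x. \<phi> (c *\<^sub>R x + v) \<noteq> 0})"
    by (simp add: compact_closure) (meson bounded_subset compact_imp_bounded)
qed

text \<open>The fundamental lemma of the calculus of variations at one point: by continuity a
  nonzero value at 0 would force a constant sign nearby, and a nonnegative bump supported there
  would have a nonzero integral against \<Phi>.\<close>

lemma bump_localization:
  fixes \<Phi> :: "'a::euclidean_space \<Rightarrow> real"
  assumes meas: "\<Phi> \<in> borel_measurable borel" and bd: "\<And>z. \<bar>\<Phi> z\<bar> \<le> B"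
    and cont: "(\<Phi> \<longlongrightarrow> \<Phi> 0) (at 0)"
    and zero: "\<And>\<rho>. test_function \<rho> \<Longrightarrow> (\<integral>z. \<rho> z * \<Phi> z \<partial>lborel) = 0"
  shows "\<Phi> 0 = 0"
proof (rule ccontr)
  assume ne: "\<Phi> 0 \<noteq> 0"
  define s where "s = sgn (\<Phi> 0)"
  have s: "s * \<Phi> 0 = \<bar>\<Phi> 0\<bar>" by (simp add: s_def abs_sgn)
  have "\<forall>\<^sub>F z in at 0. dist (\<Phi> z) (\<Phi> 0) < \<bar>\<Phi> 0\<bar> / 2"
    using ne by (intro tendstoD[OF cont]) auto
  then obtain d where d: "0 < d" "\<And>z. z \<noteq> 0 \<Longrightarrow> dist z 0 < d \<Longrightarrow> dist (\<Phi> z) (\<Phi> 0) < \<bar>\<Phi> 0\<bar> / 2"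
    by (auto simp: eventually_at)
  \<comment> \<open>The rescaled bump lives in a cube of half-side \<open>e\<close>, whose points
    have norm at most \<open>real DIM('a) * e\<close> by comparison with the l1 norm; the added 1
    makes this strictly less than \<open>d\<close>.\<close>
  define e where "e = d / (real DIM('a) + 1)"
  have e: "0 < e" using d by (simp add: e_def)
  define \<rho> :: "'a \<Rightarrow> real" where "\<rho> x = unit_bump ((1 / e) *\<^sub>R x + 0)" for x
  have \<rho>: "test_function \<rho>"
    unfolding \<rho>_def[abs_def] using e by (intro test_function_affine test_function_unit_bump) auto
  have near: "\<bar>\<Phi> 0\<bar> / 2 \<le> s * \<Phi> z" if "\<rho> z \<noteq> 0" for z
  proof (cases "z = 0")
    case False
    have "\<bar>z \<bullet> b\<bar> \<le> e" if "b \<in> Basis" for b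
      using unit_bump_support[of "(1 / e) *\<^sub>R z" b] \<open>\<rho> z \<noteq> 0\<close> that e
      by (auto simp: \<rho>_def abs_mult divide_simps)
    then have "norm z \<le> (\<Sum>b\<in>(Basis::'a set). e)"
      by (intro order_trans[OF norm_le_l1] sum_mono) auto
    also have "\<dots> = real DIM('a) * e" by simp
    also have "\<dots> < d" using d by (simp add: e_def field_simps)
    finally have "dist (\<Phi> z) (\<Phi> 0) < \<bar>\<Phi> 0\<bar> / 2" using d(2)[OF False] by simp
    moreover have "s = 1 \<and> 0 < \<Phi> 0 \<or> s = -1 \<and> \<Phi> 0 < 0"
      using ne by (auto simp: s_def sgn_real_def)
    ultimately show ?thesis unfolding dist_real_def
      by (elim disjE conjE; simp only: mult_1 mult_minus1 abs_of_pos abs_of_neg; linarith)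
  qed (use s in auto)
  have pos: "0 < \<rho> z" if "z \<in> ball 0 e" for z
    unfolding \<rho>_def
  proof (rule unit_bump_pos)
    fix b :: 'a assume "b \<in> Basis"
    then have "\<bar>z \<bullet> b\<bar> < e" using Basis_le_norm[of b z] that by simp
    then show "\<bar>((1 / e) *\<^sub>R z + 0) \<bullet> b\<bar> < 1" using e by simp
  qed
  have int1: "integrable lborel (\<lambda>z. \<rho> z * \<Phi> z)"
  proof (rule Bochner_Integration.integrable_bound)
    show "integrable lborel (\<lambda>z. B * \<rho> z)" using test_function_integrable[OF \<rho>] by simp
    have "\<bar>\<rho> z * \<Phi> z\<bar> \<le> \<bar>B * \<rho> z\<bar>" for z
      using mult_right_mono[OF bd[of z] abs_ge_zero[of "\<rho> z"]] bd[of z]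
      by (simp add: abs_mult mult.commute)
    then show "AE z in lborel. norm (\<rho> z * \<Phi> z) \<le> norm (B * \<rho> z)" by simp
  qed (use meas test_function_measurable[OF \<rho>] in auto)
  have "0 < (\<integral>z. \<rho> z * (\<bar>\<Phi> 0\<bar> / 2) \<partial>lborel)"
  proof -
    have "0 \<le> (\<integral>z. \<rho> z \<partial>lborel)" by (simp add: \<rho>_def unit_bump_nonneg)
    moreover have "(\<integral>z. \<rho> z \<partial>lborel) \<noteq> 0"
    proof
      assume "(\<integral>z. \<rho> z \<partial>lborel) = 0"
      then have "AE z in lborel. \<rho> z = 0"
        by (subst (asm) integral_nonneg_eq_0_iff_AE)
          (auto simp: test_function_integrable[OF \<rho>] \<rho>_def unit_bump_nonneg)
      then have "AE z in lborel. z \<notin> ball (0 :: 'a) e"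
        by (rule eventually_mono) (metis pos less_irrefl)
      then have "ball (0 :: 'a) e \<in> null_sets lborel"
        by (simp add: AE_iff_null_sets)
      then have "negligible (ball (0 :: 'a) e)"
        by (simp add: negligible_iff_null_sets null_sets_completionI)
      moreover have "ball (0 :: 'a) e \<noteq> {}" using e by simp
      ultimately show False using open_not_negligible[OF open_ball] by blast
    qed
    ultimately have "0 < (\<integral>z. \<rho> z \<partial>lborel)" by (simp only: less_le not_sym simp_thms)
    then have "0 < (\<integral>z. \<rho> z \<partial>lborel) * (\<bar>\<Phi> 0\<bar> / 2)" using ne by (intro mult_pos_pos) auto
    then show ?thesis by (simp only: integral_mult_left_zero)
  qed
  also have "\<dots> \<le> (\<integral>z. s * (\<rho> z * \<Phi> z) \<partial>lborel)"
  proof (rule integral_mono)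
    show "integrable lborel (\<lambda>z. \<rho> z * (\<bar>\<Phi> 0\<bar> / 2))" using test_function_integrable[OF \<rho>] by simp
    show "integrable lborel (\<lambda>z. s * (\<rho> z * \<Phi> z))" using int1 by simp
    fix z
    show "\<rho> z * (\<bar>\<Phi> 0\<bar> / 2) \<le> s * (\<rho> z * \<Phi> z)"
    proof (cases "\<rho> z = 0")
      case False
      have "0 \<le> \<rho> z" by (simp add: \<rho>_def unit_bump_nonneg)
      then have "\<rho> z * (\<bar>\<Phi> 0\<bar> / 2) \<le> \<rho> z * (s * \<Phi> z)" using near[OF False] by (rule mult_left_mono[rotated])
      then show ?thesis by (simp add: mult.left_commute)
    qed simp
  qed
  also have "\<dots> = 0" using zero[OF \<rho>] by simp
  finally show False by simp
qed

section \<open>Weak derivatives and correlation functions\<close>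

text \<open>The cross-correlation of \<open>F\<close> and \<open>G\<close>. A derivative of a test
  function of the shift \<open>z\<close> can be moved onto \<open>G\<close>, or onto
  \<open>F\<close> by way of \<open>corr_swap\<close>, using the definition of weak derivatives
  alone; the value at shift 0 is the inner product.\<close>

definition corr :: "('a::euclidean_space \<Rightarrow> complex) \<Rightarrow> ('a \<Rightarrow> complex) \<Rightarrow> 'a \<Rightarrow> real" where
  "corr F G z = ip F (\<lambda>x. G (x + z))"

lemma corr_measurable:
  assumes F: "F \<in> L2" and G: "G \<in> L2"
  shows "corr F G \<in> borel_measurable borel"
proof -
  note [measurable] = L2_measurable[OF F] L2_measurable[OF G]
  have "(\<lambda>z. \<integral>x. F x \<bullet> G (x + z) \<partial>lborel) \<in> borel_measurable borel"
    by measurable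
  then show ?thesis by (simp add: corr_def[abs_def] ip_def)
qed

lemma corr_bound:
  assumes "F \<in> L2" "G \<in> L2"
  shows "\<bar>corr F G z\<bar> \<le> L2_norm F * L2_norm G"
  using ip_Cauchy_Schwarz[OF assms(1) L2_shift[OF assms(2)], of z] L2_norm_shift[OF assms(2), of z]
  by (simp add: corr_def)

lemma corr_swap:
  assumes F: "F \<in> L2" and G: "G \<in> L2"
  shows "corr F G z = corr G F (- z)"
proof -
  note [measurable] = L2_measurable[OF F] L2_measurable[OF G]
  have "(\<integral>x. F ((x + z) + - z) \<bullet> G (x + z) \<partial>lborel) = (\<integral>x. F (x + - z) \<bullet> G x \<partial>lborel)"
    by (rule integral_lborel_shift) measurable
  then show ?thesis by (simp add: corr_def ip_def inner_commute)
qed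

lemma integral_lborel_uminus:
  fixes f :: "'a::euclidean_space \<Rightarrow> real"
  assumes [measurable]: "f \<in> borel_measurable borel"
  shows "(\<integral>x. f (- x) \<partial>lborel) = (\<integral>x. f x \<partial>lborel)"
proof -
  have "(lborel :: 'a measure) = distr lborel borel uminus"
    using lborel_affine[of "-1::real" "0::'a"] by (simp add: density_1)
  then have "(\<integral>x. f x \<partial>lborel) = (\<integral>x. f x \<partial>distr lborel borel uminus)" by simp
  also have "\<dots> = (\<integral>x. f (- x) \<partial>lborel)" by (rule integral_distr) auto
  finally show ?thesis by simp
qed

lemma integral_corr_swap:
  assumes "\<phi> \<in> borel_measurable borel" "F \<in> L2" "G \<in> L2"
  shows "(\<integral>z. \<phi> z * corr F G z \<partial>lborel) = (\<integral>z. \<phi> (- z) * corr G F z \<partial>lborel)"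
  using integral_lborel_uminus[of "\<lambda>z. \<phi> z * corr F G z"] assms corr_measurable[OF assms(2,3)]
    corr_swap[OF assms(2,3), of "- z" for z] by simp

text \<open>Fubini brings the integral over the shift inside, where it pairs \<open>G\<close> with a
  translate of \<phi>, the form in which weak derivatives are defined.\<close>

lemma integral_corr:
  assumes \<phi>: "test_function \<phi>" and F: "F \<in> L2" and G: "G \<in> L2"
  shows "(\<integral>z. \<phi> z * corr F G z \<partial>lborel) = (\<integral>x. F x \<bullet> (\<integral>y. \<phi> (y - x) *\<^sub>R G y \<partial>lborel) \<partial>lborel)"
proof -
  note [measurable] = L2_measurable[OF F] L2_measurable[OF G] test_function_measurable[OF \<phi>]
  define H where "H p = (case p of (z, x) \<Rightarrow> \<phi> z * (F x \<bullet> G (x + z)))" for p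
  have H: "integrable (lborel \<Otimes>\<^sub>M lborel) H"
  proof (rule lborel_pair.Fubini_integrable)
    show "H \<in> borel_measurable (lborel \<Otimes>\<^sub>M lborel)"
      unfolding H_def[abs_def] by measurable
    show "integrable lborel (\<lambda>z. \<integral>x. norm (H (z, x)) \<partial>lborel)"
    proof (rule Bochner_Integration.integrable_bound)
      show "integrable lborel (\<lambda>z. \<phi> z * (L2_norm F * L2_norm G))"
        using test_function_integrable[OF \<phi>] by simp
      show "(\<lambda>z. \<integral>x. norm (H (z, x)) \<partial>lborel) \<in> borel_measurable lborel"
        unfolding H_def by measurable
      have "(\<integral>x. \<bar>F x \<bullet> G (x + z)\<bar> \<partial>lborel) \<le> L2_norm F * L2_norm G" for z
      proof -
        \<comment> \<open>Multiplying \<open>F\<close> by the sign of the integrand turns the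
          integral of the absolute value into an inner product and leaves the norm unchanged, so
          that Cauchy-Schwarz applies.\<close>
        define s where "s x = (if F x \<bullet> G (x + z) < 0 then - 1 else 1 :: real)" for x
        have [measurable]: "s \<in> borel_measurable borel" unfolding s_def[abs_def] by measurable
        have s: "cmod (s x *\<^sub>R F x) = cmod (F x)" for x by (simp add: s_def)
        have "(\<lambda>x. s x *\<^sub>R F x) \<in> L2"
          by (rule L2I) (simp_all add: s L2_integrable[OF F] del: norm_scaleR)
        then have "\<bar>ip (\<lambda>x. s x *\<^sub>R F x) (\<lambda>x. G (x + z))\<bar> \<le> L2_norm (\<lambda>x. s x *\<^sub>R F x) * L2_norm (\<lambda>x. G (x + z))"
          by (rule ip_Cauchy_Schwarz[OF _ L2_shift[OF G]])
        also have "L2_norm (\<lambda>x. s x *\<^sub>R F x) = L2_norm F" by (simp add: L2_norm_def s del: norm_scaleR)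
        also have "ip (\<lambda>x. s x *\<^sub>R F x) (\<lambda>x. G (x + z)) = (\<integral>x. \<bar>F x \<bullet> G (x + z)\<bar> \<partial>lborel)"
          unfolding ip_def by (rule Bochner_Integration.integral_cong) (auto simp: s_def)
        finally show ?thesis by (simp add: L2_norm_shift[OF G])
      qed
      then have "\<bar>\<phi> z\<bar> * (\<integral>x. \<bar>F x \<bullet> G (x + z)\<bar> \<partial>lborel) \<le> \<bar>\<phi> z\<bar> * (L2_norm F * L2_norm G)" for z
        by (rule mult_left_mono) simp
      then show "AE z in lborel. norm (\<integral>x. norm (H (z, x)) \<partial>lborel) \<le> norm (\<phi> z * (L2_norm F * L2_norm G))"
        by (simp add: H_def abs_mult L2_norm_nonneg)
    qed
    show "AE z in lborel. integrable lborel (\<lambda>x. H (z, x))"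
      unfolding H_def by (simp add: integrable_ip[OF F L2_shift[OF G]])
  qed
  have "(\<integral>z. \<phi> z * corr F G z \<partial>lborel) = (\<integral>z. (\<integral>x. H (z, x) \<partial>lborel) \<partial>lborel)"
    by (simp add: H_def corr_def ip_def)
  also have "\<dots> = (\<integral>x. (\<integral>z. H (z, x) \<partial>lborel) \<partial>lborel)"
    using lborel_pair.Fubini_integral[of "\<lambda>z x. H (z, x)"] H by simp
  also have "\<dots> = (\<integral>x. F x \<bullet> (\<integral>y. \<phi> (y - x) *\<^sub>R G y \<partial>lborel) \<partial>lborel)"
  proof (rule Bochner_Integration.integral_cong)
    fix x
    have int: "integrable lborel (\<lambda>z. \<phi> z *\<^sub>R G (z + x))"
    proof (rule Bochner_Integration.integrable_bound)
      show "integrable lborel (\<lambda>z. (\<phi> z)\<^sup>2 + (cmod (G (z + x)))\<^sup>2)"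
        using test_function_square_integrable[OF \<phi>] L2_integrable[OF L2_shift[OF G]] by simp
      have "\<bar>a\<bar> * b \<le> a\<^sup>2 + b\<^sup>2" if "0 \<le> b" for a b :: real
        using sum_squares_bound[of "\<bar>a\<bar>" b] mult_nonneg_nonneg[OF abs_ge_zero[of a] that] by simp
      then show "AE z in lborel. norm (\<phi> z *\<^sub>R G (z + x)) \<le> norm ((\<phi> z)\<^sup>2 + (cmod (G (z + x)))\<^sup>2)"
        by simp
    qed measurable
    have "(\<integral>z. H (z, x) \<partial>lborel) = (\<integral>z. F x \<bullet> (\<phi> z *\<^sub>R G (z + x)) \<partial>lborel)"
      by (simp add: H_def add.commute)
    also have "\<dots> = F x \<bullet> (\<integral>z. \<phi> z *\<^sub>R G (z + x) \<partial>lborel)"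
      by (rule integral_inner_right) (rule int)
    also have "(\<integral>z. \<phi> z *\<^sub>R G (z + x) \<partial>lborel) = (\<integral>y. \<phi> (y - x) *\<^sub>R G y \<partial>lborel)"
      using integral_lborel_shift[of "\<lambda>y. \<phi> (y - x) *\<^sub>R G y" x] by simp
    finally show "(\<integral>z. H (z, x) \<partial>lborel) = F x \<bullet> (\<integral>y. \<phi> (y - x) *\<^sub>R G y \<partial>lborel)" .
  qed simp
  finally show ?thesis .
qed

lemma inner_neg_one_power: "(a::complex) \<bullet> ((-1) ^ n * b) = (-1) ^ n * (a \<bullet> b)"
  by (induction n) auto

text \<open>For fixed \<open>x\<close> the inner integral in \<open>integral_corr\<close> pairs
  \<open>G\<close> with the translate \<open>\<rho> (y - x)\<close>, again a test function, to which
  the weak derivative \<open>G'\<close> can be applied.\<close>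

lemma integral_corr_weak_deriv:
  assumes \<rho>: "test_function \<rho>" and bs: "set bs \<subseteq> Basis" and L: "F \<in> L2" "G \<in> L2" "G' \<in> L2"
    and w: "has_weak_deriv bs G G'"
  shows "(\<integral>z. partial_deriv bs \<rho> z * corr F G z \<partial>lborel) =
    (-1) ^ length bs * (\<integral>z. \<rho> z * corr F G' z \<partial>lborel)"
proof -
  have "(\<integral>y. partial_deriv bs \<rho> (y - x) *\<^sub>R G y \<partial>lborel) =
    (-1) ^ length bs * (\<integral>y. \<rho> (y - x) *\<^sub>R G' y \<partial>lborel)" for x
  proof -
    have t: "test_function (\<lambda>y. \<rho> (1 *\<^sub>R y + - x))"
      by (rule test_function_affine[OF \<rho>]) simp
    have "partial_deriv bs (\<lambda>y. \<rho> (1 *\<^sub>R y + - x)) = (\<lambda>y. partial_deriv bs \<rho> (y - x))"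
      by (subst partial_deriv_affine[OF \<rho> bs]) simp
    then show ?thesis
      using w t unfolding has_weak_deriv_def by (auto dest!: spec[of _ "\<lambda>y. \<rho> (1 *\<^sub>R y + - x)"])
  qed
  then show ?thesis
    unfolding integral_corr[OF test_function_partial_deriv[OF \<rho> bs] L(1,2)]
      integral_corr[OF \<rho> L(1,3)]
    by (simp add: inner_neg_one_power)
qed

section \<open>Continuity of correlations at shift 0\<close>

lemma integral_dominated_convergence_at:
  fixes s :: "'b::first_countable_topology \<Rightarrow> 'a \<Rightarrow> 'c::{banach, second_countable_topology}"
  assumes meas: "f \<in> borel_measurable M" "\<And>t. s t \<in> borel_measurable M" and w: "integrable M w"
    and bound: "\<And>t. AE x in M. norm (s t x) \<le> w x"
    and lim: "AE x in M. ((\<lambda>t. s t x) \<longlongrightarrow> f x) (at c)"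
  shows "((\<lambda>t. \<integral>x. s t x \<partial>M) \<longlongrightarrow> (\<integral>x. f x \<partial>M)) (at c)"
  unfolding tendsto_at_iff_sequentially comp_def
proof (intro allI impI)
  fix X assume X: "\<forall>i. X i \<in> UNIV - {c}" "X \<longlonglongrightarrow> c"
  show "(\<lambda>n. \<integral>x. s (X n) x \<partial>M) \<longlonglongrightarrow> (\<integral>x. f x \<partial>M)"
  proof (rule integral_dominated_convergence[OF meas(1) meas(2) w _ bound])
    show "AE x in M. (\<lambda>n. s (X n) x) \<longlonglongrightarrow> f x"
      using lim by eventually_elim (use X in \<open>auto simp: tendsto_at_iff_sequentially comp_def\<close>)
  qed
qed

text \<open>\<open>G\<close> is approximated almost everywhere by uniformly bounded continuous
  functions \<open>k n\<close>. On a bounded set the L1 error tends to 0, which makes the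
  correlations close uniformly over all shifts of norm at most 1; for the continuous
  \<open>k n\<close> the limit is dominated convergence.\<close>

lemma corr_tendsto_bounded:
  assumes F: "F \<in> borel_measurable borel" "\<And>x. cmod (F x) \<le> B" "\<And>x. r < norm x \<Longrightarrow> F x = 0"
    and G: "G \<in> borel_measurable borel" "\<And>x. cmod (G x) \<le> B"
  shows "(corr F G \<longlongrightarrow> corr F G 0) (at 0)"
proof (rule tendstoI)
  fix e :: real assume e: "0 < e"
  note [measurable] = F(1) G(1)
  have B: "0 \<le> B" using F(2)[of 0] norm_ge_zero[of "F 0"] by linarith
  \<comment> \<open>Radius \<open>r + 1\<close>, because \<open>x + z\<close> has to stay in
    \<open>K\<close> for \<open>norm x \<le> r\<close> and \<open>norm z \<le> 1\<close>.\<close>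
  define K where "K = cball (0 :: 'a) (r + 1)"
  have [measurable]: "K \<in> sets borel" by (simp add: K_def)
  have intK: "integrable lborel (\<lambda>x. C * indicator K x :: real)" for C
    unfolding K_def using emeasure_compact_finite[OF compact_cball, of 0 "r + 1"]
    by (intro integrable_mult_right integrable_real_indicator) auto
  have "G measurable_on UNIV"
    by (rule lebesgue_measurable_imp_measurable_on) (auto intro: measurable_completion)
  then obtain N g where N: "negligible N" and g: "\<And>n. continuous_on UNIV (g n)"
    and lim: "\<And>x. x \<notin> N \<Longrightarrow> (\<lambda>n. g n x) \<longlonglongrightarrow> G x"
    unfolding measurable_on_def by auto
  \<comment> \<open>The radial retraction onto the ball of radius \<open>B + 1\<close>: continuous,
    bounded, and the identity on the values of \<open>G\<close>. The added 1 keeps the radius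
    positive when \<open>B = 0\<close>.\<close>
  define cut where "cut y = (1 / max 1 (cmod y / (B + 1))) *\<^sub>R y" for y :: complex
  have cut_cont: "continuous_on UNIV cut"
    unfolding cut_def[abs_def] using B by (intro continuous_intros) auto
  have cut_le: "cmod (cut y) \<le> B + 1" for y
  proof (cases "cmod y \<le> B + 1")
    case True
    then have "max 1 (cmod y / (B + 1)) = 1" using B by (simp add: max_def divide_simps)
    then show ?thesis using True by (simp add: cut_def)
  next
    case False
    then have "max 1 (cmod y / (B + 1)) = cmod y / (B + 1)" using B by (simp add: max_def divide_simps)
    then show ?thesis using False B by (simp add: cut_def)
  qed
  have cut_id: "cut (G x) = G x" for x
  proof -
    have "cmod (G x) / (B + 1) \<le> 1" using G(2)[of x] B by (simp add: divide_simps)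
    then show ?thesis by (simp add: cut_def max_def)
  qed
  define k where "k n x = cut (g n x)" for n x
  have k_cont: "continuous_on UNIV (k n)" for n
    unfolding k_def[abs_def] by (rule continuous_on_compose2[OF cut_cont g]) auto
  have [measurable]: "k n \<in> borel_measurable borel" for n
    by (rule borel_measurable_continuous_onI[OF k_cont])
  have k_le: "cmod (k n x) \<le> B + 1" for n x by (simp add: k_def cut_le)
  have k_lim: "(\<lambda>n. k n x) \<longlonglongrightarrow> G x" if "x \<notin> N" for x
  proof -
    have "isCont cut (G x)" using cut_cont by (simp add: continuous_on_eq_continuous_at)
    from isCont_tendsto_compose[OF this lim[OF that]] show ?thesis by (simp add: k_def cut_id)
  qed
  have "AE x in lborel. x \<notin> N"
  proof -
    have "N \<in> null_sets lebesgue" using N by (simp add: negligible_iff_null_sets)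
    then have "AE x in lebesgue. x \<notin> N" by (rule AE_not_in)
    then show ?thesis by (simp only: AE_completion_iff)
  qed
  then have ae: "AE x in lborel. (\<lambda>n. indicator K x * cmod (G x - k n x)) \<longlonglongrightarrow> 0"
  proof (rule eventually_mono)
    fix x assume "x \<notin> N"
    from tendsto_norm[OF tendsto_diff[OF tendsto_const k_lim[OF this]], of "G x"]
    show "(\<lambda>n. indicator K x * cmod (G x - k n x)) \<longlonglongrightarrow> 0"
      by (auto intro!: tendsto_mult_right_zero)
  qed
  have diff_le: "cmod (G x - k n x) \<le> 2 * B + 1" for n x
    using norm_triangle_ineq4[of "G x" "k n x"] G(2)[of x] k_le[of n x] by linarith
  have "(\<lambda>n. \<integral>x. indicator K x * cmod (G x - k n x) \<partial>lborel) \<longlonglongrightarrow> (\<integral>x. 0 \<partial>(lborel :: 'a measure))"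
  proof (rule integral_dominated_convergence[OF _ _ intK[of "2 * B + 1"] ae])
    show "AE x in lborel. norm (indicator K x * cmod (G x - k n x)) \<le> (2 * B + 1) * indicator K x" for n
      using diff_le by (auto simp: indicator_def)
  qed measurable
  then have "(\<lambda>n. \<integral>x. indicator K x * cmod (G x - k n x) \<partial>lborel) \<longlonglongrightarrow> 0" by simp
  from order_tendstoD(2)[OF this, of "e / (4 * (B + 1))"]
  obtain n where n: "(\<integral>x. indicator K x * cmod (G x - k n x) \<partial>lborel) < e / (4 * (B + 1))"
    using e B by (auto dest: eventually_happens)
  have intF: "integrable lborel F"
  proof (rule Bochner_Integration.integrable_bound[OF intK[of B]])
    show "AE x in lborel. norm (F x) \<le> norm (B * indicator K x)"
      using F(2) F(3) B by (fastforce simp: indicator_def K_def)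
  qed measurable
  have intG: "integrable lborel (\<lambda>x. F x \<bullet> h x)"
    if [measurable]: "h \<in> borel_measurable borel" and h: "\<And>x. cmod (h x) \<le> D" for h D
  proof (rule Bochner_Integration.integrable_bound)
    show "integrable lborel (\<lambda>x. D * cmod (F x))" using intF by simp
    have "\<bar>F x \<bullet> h x\<bar> \<le> D * cmod (F x)" for x
      using Cauchy_Schwarz_ineq2[of "F x" "h x"] mult_left_mono[OF h[of x] norm_ge_zero[of "F x"]]
      by (simp add: mult.commute)
    then show "AE x in lborel. norm (F x \<bullet> h x) \<le> norm (D * cmod (F x))"
      by (auto intro: order_trans[OF _ abs_ge_self])
  qed measurable
  have close: "\<bar>corr F G z - corr F (k n) z\<bar> \<le> e / 4" if z: "norm z \<le> 1" for z
  proof -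
    have shift_int: "integrable lborel (\<lambda>x. indicator K x * cmod (G x - k n x))"
    proof (rule Bochner_Integration.integrable_bound[OF intK[of "2 * B + 1"]])
      show "AE x in lborel. norm (indicator K x * cmod (G x - k n x)) \<le> norm ((2 * B + 1) * indicator K x)"
        using diff_le B by (auto simp: indicator_def)
    qed measurable
    have "corr F G z - corr F (k n) z = (\<integral>x. F x \<bullet> (G (x + z) - k n (x + z)) \<partial>lborel)"
      unfolding corr_def ip_def inner_diff_right
      by (intro Bochner_Integration.integral_diff[symmetric] intG[where D = "B + 1"])
        (use G(2) k_le in \<open>auto intro: order_trans[OF G(2)]\<close>)
    then have "\<bar>corr F G z - corr F (k n) z\<bar> = norm (\<integral>x. F x \<bullet> (G (x + z) - k n (x + z)) \<partial>lborel)"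
      by simp
    also have "\<dots> \<le> (\<integral>x. B * (indicator K (x + z) * cmod (G (x + z) - k n (x + z))) \<partial>lborel)"
    proof (rule Bochner_Integration.integral_norm_bound_integral)
      show "integrable lborel (\<lambda>x. F x \<bullet> (G (x + z) - k n (x + z)))"
        by (rule intG[OF _ diff_le]) measurable
      show "integrable lborel (\<lambda>x. B * (indicator K (x + z) * cmod (G (x + z) - k n (x + z))))"
        using integrable_lborel_shift[OF shift_int, of z] by simp
      fix x
      have "\<bar>F x \<bullet> (G (x + z) - k n (x + z))\<bar> \<le> cmod (F x) * cmod (G (x + z) - k n (x + z))"
        by (rule Cauchy_Schwarz_ineq2)
      also have "\<dots> \<le> B * (indicator K (x + z) * cmod (G (x + z) - k n (x + z)))"
      proof (cases "norm x \<le> r")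
        case True
        then have "x + z \<in> K" using z norm_triangle_ineq[of x z] by (simp add: K_def)
        then show ?thesis using F(2)[of x] by (simp add: mult_right_mono)
      qed (use F(3)[of x] B in auto)
      finally show "norm (F x \<bullet> (G (x + z) - k n (x + z))) \<le>
        B * (indicator K (x + z) * cmod (G (x + z) - k n (x + z)))" by simp
    qed
    also have "\<dots> = B * (\<integral>x. indicator K x * cmod (G x - k n x) \<partial>lborel)"
      using integral_lborel_shift[of "\<lambda>x. B * (indicator K x * cmod (G x - k n x))" z] by simp
    also have "\<dots> \<le> (B + 1) * (e / (4 * (B + 1)))"
      using n B by (intro mult_mono) (auto intro!: integral_nonneg_AE)
    also have "\<dots> = e / 4" using B by (simp add: field_simps)
    finally show ?thesis .
  qed
  have "(corr F (k n) \<longlongrightarrow> corr F (k n) 0) (at 0)"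
    unfolding corr_def[abs_def] ip_def
  proof (rule integral_dominated_convergence_at[where w = "\<lambda>x. (B + 1) * cmod (F x)"])
    show "integrable lborel (\<lambda>x. (B + 1) * cmod (F x))" using intF by simp
    show "AE x in lborel. norm (F x \<bullet> k n (x + z)) \<le> (B + 1) * cmod (F x)" for z
    proof (intro AE_I2)
      fix x
      show "norm (F x \<bullet> k n (x + z)) \<le> (B + 1) * cmod (F x)"
        using Cauchy_Schwarz_ineq2[of "F x" "k n (x + z)"] mult_left_mono[OF k_le[of n "x + z"] norm_ge_zero[of "F x"]]
        by (simp add: mult.commute)
    qed
    show "AE x in lborel. ((\<lambda>z. F x \<bullet> k n (x + z)) \<longlongrightarrow> F x \<bullet> k n (x + 0)) (at 0)"
    proof (intro AE_I2 tendsto_inner tendsto_const)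
      fix x
      have "isCont (k n) (x + 0)" using k_cont by (simp add: continuous_on_eq_continuous_at)
      moreover have "((\<lambda>z. x + z) \<longlongrightarrow> x + 0) (at 0)" by (intro tendsto_intros)
      ultimately show "((\<lambda>z. k n (x + z)) \<longlongrightarrow> k n (x + 0)) (at 0)" by (rule isCont_tendsto_compose)
    qed
  qed measurable
  from tendstoD[OF this, of "e / 4"]
  have "\<forall>\<^sub>F z in at 0. dist (corr F (k n) z) (corr F (k n) 0) < e / 4" using e by simp
  moreover have "\<forall>\<^sub>F z in at 0. norm (z::'a) \<le> 1"
    by (auto simp: eventually_at intro!: exI[of _ 1])
  ultimately show "\<forall>\<^sub>F z in at 0. dist (corr F G z) (corr F G 0) < e"
  proof eventually_elim
    case (elim z)
    then show ?case using close[of z] close[of 0] e unfolding dist_real_def norm_zero by linarith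
  qed
qed

lemma L2_truncation:
  assumes F: "F \<in> L2"
  defines "T n x \<equiv> if cmod (F x) \<le> real n \<and> norm x \<le> real n then F x else 0"
  shows "T n \<in> L2" "(\<lambda>n. L2_norm (\<lambda>x. F x - T n x)) \<longlonglongrightarrow> 0"
proof -
  note [measurable] = L2_measurable[OF F]
  have [measurable]: "T n \<in> borel_measurable borel" for n
    unfolding T_def by measurable
  show "T n \<in> L2" for n
  proof (rule L2I)
    show "integrable lborel (\<lambda>x. (cmod (T n x))\<^sup>2)"
      by (rule Bochner_Integration.integrable_bound[OF L2_integrable[OF F]]) (auto simp: T_def)
  qed simp
  have "(\<lambda>n. \<integral>x. (cmod (F x - T n x))\<^sup>2 \<partial>lborel) \<longlonglongrightarrow> (\<integral>x. 0 \<partial>(lborel :: 'a measure))"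
  proof (rule integral_dominated_convergence[OF _ _ L2_integrable[OF F]])
    show "AE x in lborel. (\<lambda>n. (cmod (F x - T n x))\<^sup>2) \<longlonglongrightarrow> 0"
    proof (intro AE_I2)
      fix x
      obtain m where m: "max (cmod (F x)) (norm x) \<le> real m" using real_arch_simple by blast
      have "\<forall>\<^sub>F n in sequentially. (cmod (F x - T n x))\<^sup>2 = 0"
        using eventually_ge_at_top[of m] by eventually_elim (use m in \<open>auto simp: T_def\<close>)
      then show "(\<lambda>n. (cmod (F x - T n x))\<^sup>2) \<longlonglongrightarrow> 0" by (rule tendsto_eventually)
    qed
    show "AE x in lborel. norm ((cmod (F x - T n x))\<^sup>2) \<le> (cmod (F x))\<^sup>2" for n
      by (auto simp: T_def)
  qed measurable
  then have "(\<lambda>n. sqrt (\<integral>x. (cmod (F x - T n x))\<^sup>2 \<partial>lborel)) \<longlonglongrightarrow> sqrt 0"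
    by (intro tendsto_real_sqrt) simp
  then show "(\<lambda>n. L2_norm (\<lambda>x. F x - T n x)) \<longlonglongrightarrow> 0" by (simp add: L2_norm_def)
qed

text \<open>Cauchy-Schwarz bounds the effect of truncating \<open>F\<close> and \<open>G\<close>
  uniformly in the shift, so continuity passes from bounded functions of bounded support to all of
  \<open>L2\<close> by an e / 3 argument.\<close>

lemma corr_tendsto:
  assumes F: "F \<in> L2" and G: "G \<in> L2"
  shows "(corr F G \<longlongrightarrow> corr F G 0) (at 0)"
proof -
  define T where "T H n x = (if cmod (H x) \<le> real n \<and> norm x \<le> real n then H x else 0)"
    for H :: "'a \<Rightarrow> complex" and n x
  have T: "T H n \<in> L2" "(\<lambda>n. L2_norm (\<lambda>x. H x - T H n x)) \<longlonglongrightarrow> 0" if "H \<in> L2" for H n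
    using L2_truncation[OF that] unfolding T_def by auto
  let ?b = "\<lambda>n. L2_norm (\<lambda>x. F x - T F n x) * L2_norm G +
      (L2_norm F + L2_norm (\<lambda>x. F x - T F n x)) * L2_norm (\<lambda>x. G x - T G n x)"
  have b: "\<bar>corr (T F n) (T G n) z - corr F G z\<bar> \<le> ?b n" for n z
  proof -
    have dF: "(\<lambda>x. F x - T F n x) \<in> L2" and dG: "(\<lambda>x. G x - T G n x) \<in> L2"
      using T F G by (auto intro: L2_diff)
    have "corr F G z - corr (T F n) (T G n) z = corr (\<lambda>x. F x - T F n x) G z + corr (T F n) (\<lambda>x. G x - T G n x) z"
      unfolding corr_def using T(1)[OF F, of n] L2_shift[OF T(1)[OF G, of n], of z] F L2_shift[OF G, of z]
      by (simp add: ip_diff_left ip_diff_right)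
    moreover have "\<bar>corr (\<lambda>x. F x - T F n x) G z\<bar> \<le> L2_norm (\<lambda>x. F x - T F n x) * L2_norm G"
      by (rule corr_bound[OF dF G])
    moreover have "\<bar>corr (T F n) (\<lambda>x. G x - T G n x) z\<bar> \<le> L2_norm (T F n) * L2_norm (\<lambda>x. G x - T G n x)"
      by (rule corr_bound[OF T(1)[OF F] dG])
    moreover have "L2_norm (T F n) \<le> L2_norm F + L2_norm (\<lambda>x. F x - T F n x)"
      using L2_norm_triangle[OF F L2_scaleR[OF dF, of "-1"]] by (simp only: L2_norm_scaleR) simp
    then have "L2_norm (T F n) * L2_norm (\<lambda>x. G x - T G n x) \<le>
        (L2_norm F + L2_norm (\<lambda>x. F x - T F n x)) * L2_norm (\<lambda>x. G x - T G n x)"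
      by (rule mult_right_mono) (rule L2_norm_nonneg)
    ultimately show ?thesis by linarith
  qed
  have "?b \<longlonglongrightarrow> 0 * L2_norm G + (L2_norm F + 0) * 0"
    by (intro tendsto_intros T F G)
  then have b0: "?b \<longlonglongrightarrow> 0" by simp
  show ?thesis
  proof (rule tendstoI)
    fix e :: real assume e: "0 < e"
    then obtain n where n: "?b n < e / 3"
      using order_tendstoD(2)[OF b0, of "e / 3"] by (auto dest: eventually_happens)
    have "(corr (T F n) (T G n) \<longlongrightarrow> corr (T F n) (T G n) 0) (at 0)"
      by (rule corr_tendsto_bounded[where B = "real n" and r = "real n"])
        (use L2_measurable[OF T(1)[OF F]] L2_measurable[OF T(1)[OF G]] in \<open>auto simp: T_def[abs_def]\<close>)
    from tendstoD[OF this, of "e / 3"]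
    have "\<forall>\<^sub>F z in at 0. dist (corr (T F n) (T G n) z) (corr (T F n) (T G n) 0) < e / 3" using e by simp
    then show "\<forall>\<^sub>F z in at 0. dist (corr F G z) (corr F G 0) < e"
    proof eventually_elim
      case (elim z)
      then show ?case using b[of n z] b[of n 0] n unfolding dist_real_def by linarith
    qed
  qed
qed

text \<open>Integration by parts for two functions that are both only weakly differentiable. The
  function \<open>?\<Phi>\<close> of the shift integrates to 0 against every test function, because
  a derivative can be moved from the test function to either argument of the correlation; its
  vanishing at 0 is the claim.\<close>

theorem weak_deriv_adjoint:
  assumes bs: "set bs \<subseteq> Basis" and L: "F \<in> L2" "F' \<in> L2" "G \<in> L2" "G' \<in> L2"
    and wF: "has_weak_deriv bs F F'" and wG: "has_weak_deriv bs G G'"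
  shows "ip F' G = (-1) ^ length bs * ip F G'"
proof -
  let ?\<Phi> = "\<lambda>z. corr F' G z - (-1) ^ length bs * corr F G' z"
  have int: "integrable lborel (\<lambda>z. \<rho> z * corr f g z)"
    if "test_function \<rho>" "f \<in> L2" "g \<in> L2" for \<rho> and f g :: "'a \<Rightarrow> complex"
  proof (rule Bochner_Integration.integrable_bound)
    show "integrable lborel (\<lambda>z. (L2_norm f * L2_norm g) * \<rho> z)"
      using test_function_integrable[OF that(1)] by simp
    show "(\<lambda>z. \<rho> z * corr f g z) \<in> borel_measurable lborel"
      using test_function_measurable[OF that(1)] corr_measurable[OF that(2,3)] by simp
    have "\<bar>\<rho> z * corr f g z\<bar> \<le> \<bar>(L2_norm f * L2_norm g) * \<rho> z\<bar>" for z
      using mult_right_mono[OF corr_bound[OF that(2,3), of z] abs_ge_zero[of "\<rho> z"]]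
      by (simp add: abs_mult L2_norm_nonneg mult.commute)
    then show "AE z in lborel. norm (\<rho> z * corr f g z) \<le> norm ((L2_norm f * L2_norm g) * \<rho> z)" by simp
  qed
  have sq: "(-1) ^ n * ((-1) ^ n * x) = (x :: real)" for n x
    by (simp add: mult.assoc[symmetric] flip: power_mult_distrib)
  have "?\<Phi> 0 = 0"
  proof (rule bump_localization)
    show "?\<Phi> \<in> borel_measurable borel"
      using corr_measurable[OF L(2,3)] corr_measurable[OF L(1,4)] by simp
    show "\<bar>?\<Phi> z\<bar> \<le> L2_norm F' * L2_norm G + L2_norm F * L2_norm G'" for z
      using corr_bound[OF L(2,3), of z] corr_bound[OF L(1,4), of z]
        abs_triangle_ineq4[of "corr F' G z" "(-1) ^ length bs * corr F G' z"]
      by (simp add: abs_mult power_abs)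
    show "(?\<Phi> \<longlongrightarrow> ?\<Phi> 0) (at 0)"
      by (intro tendsto_intros corr_tendsto L)
    fix \<rho> :: "'a \<Rightarrow> real" assume \<rho>: "test_function \<rho>"
    \<comment> \<open>Exchanging the arguments of the correlation reflects the shift. The sign
      \<open>(-1) ^ length bs\<close> from the reflected derivative cancels the one from the weak
      derivative of \<open>F\<close>.\<close>
    define \<rho>' where "\<rho>' z = \<rho> ((-1) *\<^sub>R z + 0)" for z
    have \<rho>': "test_function \<rho>'"
      unfolding \<rho>'_def[abs_def] by (rule test_function_affine[OF \<rho>]) simp
    have pd: "partial_deriv bs \<rho> (- z) = (-1) ^ length bs * partial_deriv bs \<rho>' z" for z
      using fun_cong[OF partial_deriv_affine[OF \<rho> bs, of "-1" 0], of z]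
      by (simp add: sq \<rho>'_def[abs_def])
    have "(-1) ^ length bs * (\<integral>z. \<rho> z * corr F G' z \<partial>lborel) = (\<integral>z. partial_deriv bs \<rho> z * corr F G z \<partial>lborel)"
      by (rule integral_corr_weak_deriv[OF \<rho> bs L(1,3,4) wG, symmetric])
    also have "\<dots> = (\<integral>z. partial_deriv bs \<rho> (- z) * corr G F z \<partial>lborel)"
      by (rule integral_corr_swap[OF test_function_measurable[OF test_function_partial_deriv[OF \<rho> bs]] L(1,3)])
    also have "\<dots> = (-1) ^ length bs * (\<integral>z. partial_deriv bs \<rho>' z * corr G F z \<partial>lborel)"
      by (simp add: pd mult.assoc)
    also have "\<dots> = (\<integral>z. \<rho>' z * corr G F' z \<partial>lborel)"
      by (simp only: integral_corr_weak_deriv[OF \<rho>' bs L(3,1,2) wF] sq)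
    also have "\<dots> = (\<integral>z. \<rho> z * corr F' G z \<partial>lborel)"
      using integral_corr_swap[OF test_function_measurable[OF \<rho>] L(2,3)] by (simp add: \<rho>'_def)
    finally show "(\<integral>z. \<rho> z * ?\<Phi> z \<partial>lborel) = 0"
      using int[OF \<rho> L(2,3)] int[OF \<rho> L(1,4)]
      by (simp add: right_diff_distrib mult.left_commute[of "\<rho> _"])
  qed
  then show ?thesis by (simp add: corr_def)
qed

text \<open>Needed because \<open>weak_deriv [] f\<close> is a function picked by
  \<open>SOME\<close>, not \<open>f\<close> itself. Adjointness for the empty list, applied with
  \<open>g\<close> and then with \<open>f\<close> as second function, identifies the norms.\<close>

lemma L2_norm_weak_deriv_Nil:
  assumes "f \<in> L2" "g \<in> L2" "has_weak_deriv [] f g"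
  shows "L2_norm g = L2_norm f"
proof -
  have self: "has_weak_deriv [] h h" for h :: "'a \<Rightarrow> complex" by (simp add: has_weak_deriv_def)
  have "ip g g = ip f g" using weak_deriv_adjoint[OF _ assms(1,2,2,2,3) self] by simp
  moreover have "ip g f = ip f f" using weak_deriv_adjoint[OF _ assms(1,2,1,1,3) self] by simp
  ultimately have "(L2_norm g)\<^sup>2 = (L2_norm f)\<^sup>2" by (simp add: L2_norm_sq ip_commute)
  then show ?thesis by (rule power2_eq_imp_eq) (rule L2_norm_nonneg)+
qed

text \<open>\<open>partial_deriv [b] \<phi>\<close> is again a test function for \<open>f1\<close>.
  This links the derivatives of order 1 and 2, whose representatives are chosen
  independently.\<close>

lemma has_weak_deriv_iterate:
  assumes "b \<in> Basis" and b: "has_weak_deriv [b] f f1" and bb: "has_weak_deriv [b, b] f f2"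
  shows "has_weak_deriv [b] f1 f2"
  unfolding has_weak_deriv_def
proof (intro allI impI)
  fix \<phi> :: "'a \<Rightarrow> real" assume \<phi>: "test_function \<phi>"
  have "test_function (partial_deriv [b] \<phi>)"
    using \<phi> assms(1) by (intro test_function_partial_deriv) auto
  then have "(\<integral>x. partial_deriv [b] (partial_deriv [b] \<phi>) x *\<^sub>R f x \<partial>lborel) =
      (-1) ^ length [b] * (\<integral>x. partial_deriv [b] \<phi> x *\<^sub>R f1 x \<partial>lborel)"
    using b unfolding has_weak_deriv_def by blast
  moreover have "(\<integral>x. partial_deriv [b, b] \<phi> x *\<^sub>R f x \<partial>lborel) =
      (-1) ^ length [b, b] * (\<integral>x. \<phi> x *\<^sub>R f2 x \<partial>lborel)"
    using bb \<phi> unfolding has_weak_deriv_def by blast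
  ultimately have "(\<integral>x. \<phi> x *\<^sub>R f2 x \<partial>lborel) = - (\<integral>x. partial_deriv [b] \<phi> x *\<^sub>R f1 x \<partial>lborel)"
    by simp
  then show "(\<integral>x. partial_deriv [b] \<phi> x *\<^sub>R f1 x \<partial>lborel) =
      (-1) ^ length [b] * (\<integral>x. \<phi> x *\<^sub>R f2 x \<partial>lborel)" by simp
qed

section \<open>The weak Laplacian on H2\<close>

lemma weak_deriv_H2:
  assumes "f \<in> H2" "set bs \<subseteq> Basis" "length bs \<le> 2"
  shows "weak_deriv bs f \<in> L2" "has_weak_deriv bs f (weak_deriv bs f)"
proof -
  have "\<exists>g. g \<in> L2 \<and> has_weak_deriv bs f g" using assms by (auto simp: H2_def)
  from someI_ex[OF this] show "weak_deriv bs f \<in> L2" "has_weak_deriv bs f (weak_deriv bs f)"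
    by (simp_all add: weak_deriv_def)
qed

lemma H2_L2: "f \<in> H2 \<Longrightarrow> f \<in> L2"
  by (simp add: H2_def)

lemma weak_laplacian_L2: "f \<in> H2 \<Longrightarrow> weak_laplacian f \<in> L2"
  unfolding weak_laplacian_def[abs_def] by (intro L2_sum weak_deriv_H2) auto

lemma weak_laplacian_symmetric:
  assumes "f \<in> H2" "g \<in> H2"
  shows "ip (weak_laplacian f) g = ip f (weak_laplacian g)"
proof -
  have "ip (weak_deriv [b, b] f) g = ip f (weak_deriv [b, b] g)" if "b \<in> Basis" for b
    using weak_deriv_adjoint[of "[b, b]" f "weak_deriv [b, b] f" g "weak_deriv [b, b] g"] that assms
    by (simp add: weak_deriv_H2 H2_L2)
  then have "(\<Sum>b\<in>Basis. ip (weak_deriv [b, b] f) g) = (\<Sum>b\<in>Basis. ip (weak_deriv [b, b] g) f)"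
    by (intro sum.cong) (auto simp: ip_commute)
  moreover have "ip (weak_laplacian h) k = (\<Sum>b\<in>Basis. ip (weak_deriv [b, b] h) k)"
    if "h \<in> H2" "k \<in> L2" for h k :: "'a \<Rightarrow> complex"
    unfolding weak_laplacian_def[abs_def] using that by (intro ip_sum_left weak_deriv_H2) auto
  ultimately show ?thesis using assms by (simp add: H2_L2 ip_commute[of f])
qed

text \<open>One integration by parts turns each summand into minus the squared norm of a first
  derivative.\<close>

lemma weak_laplacian_nonpos:
  assumes "f \<in> H2"
  shows "ip (weak_laplacian f) f \<le> 0"
proof -
  have "ip (weak_deriv [b, b] f) f \<le> 0" if b: "b \<in> Basis" for b
  proof -
    have "has_weak_deriv [b] (weak_deriv [b] f) (weak_deriv [b, b] f)"
      using b assms by (intro has_weak_deriv_iterate[OF b weak_deriv_H2(2) weak_deriv_H2(2)]) auto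
    then have "ip (weak_deriv [b, b] f) f = - ip (weak_deriv [b] f) (weak_deriv [b] f)"
      using weak_deriv_adjoint[of "[b]" "weak_deriv [b] f" "weak_deriv [b, b] f" f "weak_deriv [b] f"] b assms
      by (simp add: weak_deriv_H2 H2_L2)
    then show ?thesis using ip_nonneg[of "weak_deriv [b] f"] by simp
  qed
  then have "(\<Sum>b\<in>Basis. ip (weak_deriv [b, b] f) f) \<le> 0" by (intro sum_nonpos) auto
  moreover have "ip (weak_laplacian f) f = (\<Sum>b\<in>Basis. ip (weak_deriv [b, b] f) f)"
    unfolding weak_laplacian_def[abs_def] using assms H2_L2 by (intro ip_sum_left weak_deriv_H2) auto
  ultimately show ?thesis by simp
qed

lemma L2_norm_le_H2_norm:
  assumes "f \<in> H2"
  shows "L2_norm f \<le> H2_norm f"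
proof -
  let ?A = "{bs :: 'a list. set bs \<subseteq> Basis \<and> length bs \<le> 2}"
  have "finite ?A" by (intro finite_lists_length_le) auto
  then have "(L2_norm (weak_deriv [] f))\<^sup>2 \<le> (\<Sum>bs\<in>?A. (L2_norm (weak_deriv bs f))\<^sup>2)"
    by (intro member_le_sum) auto
  moreover have "L2_norm (weak_deriv [] f) = L2_norm f"
    using assms by (intro L2_norm_weak_deriv_Nil weak_deriv_H2 H2_L2) auto
  ultimately show ?thesis
    unfolding H2_norm_def by (intro real_le_rsqrt) simp
qed

section \<open>The wave equation as a cosine family\<close>

lemma has_L2_derivative_affine:
  assumes d: "has_L2_derivative w d (\<alpha> * r + \<beta>)" and \<alpha>: "\<alpha> \<noteq> 0"
  shows "has_L2_derivative (\<lambda>r. w (\<alpha> * r + \<beta>)) (\<lambda>x. \<alpha> *\<^sub>R d x) r"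
proof -
  have lim: "filterlim (\<lambda>s. \<alpha> * s) (at 0) (at 0)"
    using \<alpha> by (auto intro!: filterlim_atI tendsto_eq_intros simp: eventually_at_filter)
  have "((\<lambda>s. \<bar>\<alpha>\<bar> * L2_norm (\<lambda>x. (w (\<alpha> * r + \<beta> + \<alpha> * s) x - w (\<alpha> * r + \<beta>) x) /\<^sub>R (\<alpha> * s) - d x)) \<longlongrightarrow> 0) (at 0)"
    using filterlim_compose[OF d[unfolded has_L2_derivative_def] lim] by (rule tendsto_mult_right_zero)
  moreover have "\<bar>\<alpha>\<bar> * L2_norm (\<lambda>x. (w (\<alpha> * r + \<beta> + \<alpha> * s) x - w (\<alpha> * r + \<beta>) x) /\<^sub>R (\<alpha> * s) - d x) =
     L2_norm (\<lambda>x. (w (\<alpha> * (r + s) + \<beta>) x - w (\<alpha> * r + \<beta>) x) /\<^sub>R s - \<alpha> *\<^sub>R d x)" for s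
  proof -
    have "\<alpha> *\<^sub>R ((w (\<alpha> * r + \<beta> + \<alpha> * s) x - w (\<alpha> * r + \<beta>) x) /\<^sub>R (\<alpha> * s) - d x) =
      (w (\<alpha> * (r + s) + \<beta>) x - w (\<alpha> * r + \<beta>) x) /\<^sub>R s - \<alpha> *\<^sub>R d x" for x
    proof -
      have e: "\<alpha> * r + \<beta> + \<alpha> * s = \<alpha> * (r + s) + \<beta>" by (simp add: algebra_simps)
      have "\<alpha> * inverse (\<alpha> * s) = inverse s" using \<alpha> by simp
      then show ?thesis unfolding e scaleR_diff_right[of \<alpha>] scaleR_scaleR by (simp only:)
    qed
    then show ?thesis by (simp only: L2_norm_scaleR[symmetric])
  qed
  ultimately show ?thesis by (simp add: has_L2_derivative_def)
qed

lemma has_L2_derivative_scaleR: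
  assumes "has_L2_derivative w d t"
  shows "has_L2_derivative (\<lambda>t x. k *\<^sub>R w t x) (\<lambda>x. k *\<^sub>R d x) t"
proof -
  have "(k *\<^sub>R w (t + s) x - k *\<^sub>R w t x) /\<^sub>R s - k *\<^sub>R d x = k *\<^sub>R ((w (t + s) x - w t x) /\<^sub>R s - d x)" for s x
    by (simp only: scaleR_diff_right[symmetric] scaleR_left_commute[of "inverse s" k])
  then show ?thesis
    using tendsto_mult_right_zero[OF assms[unfolded has_L2_derivative_def], of "\<bar>k\<bar>"]
    by (simp only: has_L2_derivative_def L2_norm_scaleR)
qed

text \<open>The product rule in \<open>L2\<close>. \<open>D\<close> and \<open>E\<close> are the
  errors of the two difference quotients; \<open>?R\<close> collects the terms containing them and
  the quadratic term, which keeps a factor \<open>s\<close>.\<close>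

lemma ip_has_derivative:
  assumes w: "has_L2_derivative w a r" and v: "has_L2_derivative v b r"
    and L: "\<And>t. w t \<in> L2" "\<And>t. v t \<in> L2" "a \<in> L2" "b \<in> L2"
  shows "((\<lambda>r. ip (w r) (v r)) has_real_derivative (ip a (v r) + ip (w r) b)) (at r)"
proof -
  define D where "D s x = (w (r + s) x - w r x) /\<^sub>R s - a x" for s x
  define E where "E s x = (v (r + s) x - v r x) /\<^sub>R s - b x" for s x
  have DL: "D s \<in> L2" "E s \<in> L2" for s
    unfolding D_def[abs_def] E_def[abs_def] by (intro L2_diff L2_scaleR L)+
  have D0: "((\<lambda>s. L2_norm (D s)) \<longlongrightarrow> 0) (at 0)" and E0: "((\<lambda>s. L2_norm (E s)) \<longlongrightarrow> 0) (at 0)"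
    using w v by (simp_all add: has_L2_derivative_def D_def[abs_def] E_def[abs_def])
  let ?Q = "\<lambda>s. (ip (w (r + s)) (v (r + s)) - ip (w r) (v r)) / s"
  let ?R = "\<lambda>s. ip (D s) (v r) + ip (w r) (E s) + s * ip (\<lambda>x. a x + D s x) (\<lambda>x. b x + E s x)"
  have Q: "?Q s = ip a (v r) + ip (w r) b + ?R s" if "s \<noteq> 0" for s
  proof -
    have ws: "w (r + s) = (\<lambda>x. w r x + s *\<^sub>R (a x + D s x))"
      and vs: "v (r + s) = (\<lambda>x. v r x + s *\<^sub>R (b x + E s x))"
      using that by (auto simp: D_def E_def)
    have 1: "(\<lambda>x. a x + D s x) \<in> L2" "(\<lambda>x. b x + E s x) \<in> L2" by (intro L2_add L DL)+
    have "ip (w (r + s)) (v (r + s)) = ip (w r) (v r) + s * ip (w r) (\<lambda>x. b x + E s x)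
      + s * ip (\<lambda>x. a x + D s x) (v r) + s * (s * ip (\<lambda>x. a x + D s x) (\<lambda>x. b x + E s x))"
      unfolding ws vs using L(1)[of r] L(2)[of r] 1 L2_scaleR[OF 1(1), of s] L2_scaleR[OF 1(2), of s]
      by (simp add: ip_add_left ip_add_right L2_add ip_scaleR_left ip_scaleR_right distrib_left)
    moreover have "ip (w r) (\<lambda>x. b x + E s x) = ip (w r) b + ip (w r) (E s)"
      "ip (\<lambda>x. a x + D s x) (v r) = ip a (v r) + ip (D s) (v r)"
      by (simp_all add: ip_add_left ip_add_right L DL)
    ultimately show ?thesis using that by (simp add: field_simps)
  qed
  have "(?R \<longlongrightarrow> 0) (at 0)"
  proof (rule Lim_null_comparison)
    let ?B = "\<lambda>s. L2_norm (D s) * L2_norm (v r) + L2_norm (w r) * L2_norm (E s)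
      + \<bar>s\<bar> * ((L2_norm a + L2_norm (D s)) * (L2_norm b + L2_norm (E s)))"
    have "norm (?R s) \<le> ?B s" for s
    proof -
      have "\<bar>ip (\<lambda>x. a x + D s x) (\<lambda>x. b x + E s x)\<bar> \<le> L2_norm (\<lambda>x. a x + D s x) * L2_norm (\<lambda>x. b x + E s x)"
        by (intro ip_Cauchy_Schwarz L2_add L DL)
      also have "\<dots> \<le> (L2_norm a + L2_norm (D s)) * (L2_norm b + L2_norm (E s))"
        by (intro mult_mono L2_norm_triangle L DL add_nonneg_nonneg L2_norm_nonneg)
      finally have "\<bar>s * ip (\<lambda>x. a x + D s x) (\<lambda>x. b x + E s x)\<bar> \<le>
          \<bar>s\<bar> * ((L2_norm a + L2_norm (D s)) * (L2_norm b + L2_norm (E s)))"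
        by (simp only: abs_mult) (intro mult_left_mono abs_ge_zero)
      then show ?thesis
        using ip_Cauchy_Schwarz[OF DL(1)[of s] L(2)[of r]] ip_Cauchy_Schwarz[OF L(1)[of r] DL(2)[of s]]
        unfolding real_norm_def by linarith
    qed
    then show "\<forall>\<^sub>F s in at 0. norm (?R s) \<le> ?B s" by simp
    have "(?B \<longlongrightarrow> 0 * L2_norm (v r) + L2_norm (w r) * 0 + \<bar>0\<bar> * ((L2_norm a + 0) * (L2_norm b + 0))) (at 0)"
      by (intro tendsto_intros D0 E0)
    then show "(?B \<longlongrightarrow> 0) (at 0)" by simp
  qed
  then have "((\<lambda>s. ip a (v r) + ip (w r) b + ?R s) \<longlongrightarrow> ip a (v r) + ip (w r) b + 0) (at 0)"
    by (intro tendsto_add tendsto_const)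
  then have "(?Q \<longlongrightarrow> ip a (v r) + ip (w r) b) (at 0)"
    by (subst tendsto_cong[where g = "\<lambda>s. ip a (v r) + ip (w r) b + ?R s"])
      (auto simp: eventually_at_filter Q intro!: always_eventually)
  then show ?thesis by (simp add: DERIV_def)
qed

lemma has_L2_derivative_const: "has_L2_derivative (\<lambda>_. f) (\<lambda>_. 0) t"
  by (simp add: has_L2_derivative_def L2_norm_def)

text \<open>A solution normalised to speed 1; a solution of speed \<open>c\<close> enters as
  \<open>w (t / c)\<close>. The time derivatives are part of the data because
  \<open>has_L2_derivative\<close> determines them only up to null sets.\<close>

locale wave_family =
  fixes f :: "'a::euclidean_space \<Rightarrow> complex" and w w' w'' :: "real \<Rightarrow> 'a \<Rightarrow> complex"
  assumes f: "f \<in> L2" and w: "\<And>t. w t \<in> H2" and w': "\<And>t. w' t \<in> L2" and w'': "\<And>t. w'' t \<in> L2"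
    and dw: "\<And>t. has_L2_derivative w (w' t) t" and dw': "\<And>t. has_L2_derivative w' (w'' t) t"
    and eq: "\<And>t. AE x in lborel. w'' t x = weak_laplacian (w t) x"
    and w0: "AE x in lborel. w 0 x = f x" and w'0: "AE x in lborel. w' 0 x = 0"
begin

lemma wL2: "w t \<in> L2" by (rule H2_L2[OF w])

lemma ip_w'': "g \<in> L2 \<Longrightarrow> ip (w'' t) g = ip (weak_laplacian (w t)) g"
  by (rule ip_cong_AE) (auto intro: w'' weak_laplacian_L2 w eq)

lemma ip_w0: "g \<in> L2 \<Longrightarrow> ip (w 0) g = ip f g"
  by (rule ip_cong_AE) (auto intro: wL2 f w0)

lemma ip_w'0: "g \<in> L2 \<Longrightarrow> ip (w' 0) g = 0"
  using ip_cong_AE[of "w' 0" "\<lambda>_. 0" g g] w'0 by (simp add: w' L2_zero) (simp add: ip_def)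

text \<open>Formally the cosine transform of the spectral measure of \<open>f\<close>. All inner
  products between values of \<open>w\<close> will be expressed by it.\<close>

definition g :: "real \<Rightarrow> real" where "g t = ip (w t) f"
definition g' :: "real \<Rightarrow> real" where "g' t = ip (w' t) f"
definition g'' :: "real \<Rightarrow> real" where "g'' t = ip (w'' t) f"

lemma ip_w_deriv:
  "h \<in> L2 \<Longrightarrow> ((\<lambda>t. ip (w t) h) has_real_derivative ip (w' t) h) (at t)"
  using ip_has_derivative[OF dw has_L2_derivative_const[of h] wL2 _ w' L2_zero, of t]
  by (simp add: ip_def)

lemma ip_w'_deriv:
  "h \<in> L2 \<Longrightarrow> ((\<lambda>t. ip (w' t) h) has_real_derivative ip (w'' t) h) (at t)"
  using ip_has_derivative[OF dw' has_L2_derivative_const[of h] w' _ w'' L2_zero, of t]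
  by (simp add: ip_def)

lemma g_deriv: "(g has_real_derivative g' t) (at t)"
  unfolding g_def[abs_def] g'_def by (rule ip_w_deriv[OF f])

lemma g'_deriv: "(g' has_real_derivative g'' t) (at t)"
  unfolding g'_def[abs_def] g''_def by (rule ip_w'_deriv[OF f])

lemma g_chain: "((\<lambda>r. g (\<alpha> * r + \<beta>)) has_real_derivative \<alpha> * g' (\<alpha> * r + \<beta>)) (at r)"
  by (rule DERIV_cong[OF DERIV_chain2[OF g_deriv]]) (auto intro!: derivative_eq_intros)

lemma g'_chain: "((\<lambda>r. g' (\<alpha> * r + \<beta>)) has_real_derivative \<alpha> * g'' (\<alpha> * r + \<beta>)) (at r)"
  by (rule DERIV_cong[OF DERIV_chain2[OF g'_deriv]]) (auto intro!: derivative_eq_intros)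

end

text \<open>Two solutions with the same datum: one defines \<open>h\<close>, the other is the
  time-rescaled solution behind \<open>u\<close>. Their mutual inner products are computed directly,
  which takes the place of a uniqueness theorem.\<close>

locale wave_pair = W: wave_family f w w' w'' + V: wave_family f v v' v''
  for f :: "'a::euclidean_space \<Rightarrow> complex" and w w' w'' v v' v''
begin

lemma ip_symm: "ip (w'' t) (v s) = ip (w t) (v'' s)"
proof -
  have "ip (w'' t) (v s) = ip (weak_laplacian (w t)) (v s)" by (rule W.ip_w''[OF V.wL2])
  also have "\<dots> = ip (weak_laplacian (v s)) (w t)"
    using weak_laplacian_symmetric[OF W.w V.w] by (simp add: ip_commute)
  also have "\<dots> = ip (v'' s) (w t)" by (rule V.ip_w''[OF W.wL2, symmetric])
  finally show ?thesis by (simp add: ip_commute)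
qed

text \<open>By \<open>ip_symm\<close>, the function \<open>ip (w t) (v s)\<close> of (t, s) solves
  the wave equation in the plane. The directional derivative on the left is therefore constant along
  the line (t + r, s - \<epsilon> r), and r = \<epsilon> s reaches time 0 of \<open>v\<close>, where
  the data are \<open>f\<close> and 0.\<close>

lemma characteristic:
  assumes \<epsilon>: "\<epsilon> = 1 \<or> \<epsilon> = (-1::real)"
  shows "ip (w' t) (v s) + \<epsilon> * ip (w t) (v' s) = W.g' (t + \<epsilon> * s)"
proof -
  have \<epsilon>0: "\<epsilon> \<noteq> 0" "\<epsilon> * \<epsilon> = 1" using \<epsilon> by auto
  let ?D = "\<lambda>r. ip (w' (1 * r + t)) (v (- \<epsilon> * r + s)) + \<epsilon> * ip (w (1 * r + t)) (v' (- \<epsilon> * r + s))"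
  have "(?D has_real_derivative 0) (at r)" for r
  proof -
    note W1 = has_L2_derivative_affine[OF W.dw, where \<alpha> = 1 and r = r and \<beta> = t] has_L2_derivative_affine[OF W.dw', where \<alpha> = 1 and r = r and \<beta> = t]
    note V1 = has_L2_derivative_affine[OF V.dw, where \<alpha> = "- \<epsilon>" and r = r and \<beta> = s] has_L2_derivative_affine[OF V.dw', where \<alpha> = "- \<epsilon>" and r = r and \<beta> = s]
    have 1: "((\<lambda>r. ip (w' (1 * r + t)) (v (- \<epsilon> * r + s))) has_real_derivative
        ip (\<lambda>x. 1 *\<^sub>R w'' (1 * r + t) x) (v (- \<epsilon> * r + s)) +
        ip (w' (1 * r + t)) (\<lambda>x. - \<epsilon> *\<^sub>R v' (- \<epsilon> * r + s) x)) (at r)"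
      by (rule ip_has_derivative[OF W1(2) V1(1)]) (simp_all only: \<epsilon>0 W.w' W.w'' V.wL2 V.w' L2_scaleR neg_equal_0_iff_equal one_neq_zero simp_thms)
    have 2: "((\<lambda>r. ip (w (1 * r + t)) (v' (- \<epsilon> * r + s))) has_real_derivative
        ip (\<lambda>x. 1 *\<^sub>R w' (1 * r + t) x) (v' (- \<epsilon> * r + s)) +
        ip (w (1 * r + t)) (\<lambda>x. - \<epsilon> *\<^sub>R v'' (- \<epsilon> * r + s) x)) (at r)"
      by (rule ip_has_derivative[OF W1(1) V1(2)]) (simp_all only: \<epsilon>0 W.w' W.wL2 V.w' V.w'' L2_scaleR neg_equal_0_iff_equal one_neq_zero simp_thms)
    show ?thesis
      by (rule DERIV_cong[OF DERIV_add[OF 1 DERIV_cmult[OF 2]]])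
        (simp add: ip_scaleR_left ip_scaleR_right ip_symm \<epsilon>0(2) distrib_left right_diff_distrib mult.assoc[symmetric]
          del: scaleR_minus_left)
  qed
  then have "?D 0 = ?D (\<epsilon> * s)" by (intro DERIV_isconst_all) blast
  moreover have "?D (\<epsilon> * s) = W.g' (t + \<epsilon> * s)"
    using V.ip_w0[OF W.w'] V.ip_w'0[OF W.wL2]
    by (simp add: \<epsilon>0(2) W.g'_def add.commute mult.assoc[symmetric] ip_commute[of _ "v 0"] ip_commute[of _ "v' 0"] ip_commute[of f])
  ultimately show ?thesis by simp
qed

lemma ip_w'_v: "ip (w' t) (v s) = (W.g' (t + s) + W.g' (t - s)) / 2"
  using characteristic[of 1 t s] characteristic[of "-1" t s] by simp

lemma ip_w_v': "ip (w t) (v' s) = (W.g' (t + s) - W.g' (t - s)) / 2"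
  using characteristic[of 1 t s] characteristic[of "-1" t s] by simp

text \<open>The counterpart of the product formula for cosines. Both sides agree at
  \<open>s = 0\<close>, and \<open>ip_w_v'\<close> shows that they have the same derivative in
  \<open>s\<close>.\<close>

lemma dalembert: "ip (w t) (v s) = (W.g (t + s) + W.g (t - s)) / 2"
proof -
  let ?D = "\<lambda>s. ip (v s) (w t) - (W.g (1 * s + t) + W.g ((-1) * s + t)) / 2"
  have args: "1 * s + t = t + s" "(-1) * s + t = t - s" for s by simp_all
  have "(?D has_real_derivative 0) (at s)" for s
  proof (rule DERIV_cong[OF DERIV_diff[OF V.ip_w_deriv[OF W.wL2] DERIV_cdivide[OF DERIV_add[OF W.g_chain W.g_chain]]]])
    have "ip (v' s) (w t) = (W.g' (t + s) - W.g' (t - s)) / 2"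
      by (subst ip_commute) (rule ip_w_v')
    then show "ip (v' s) (w t) - (1 * W.g' (1 * s + t) + (-1) * W.g' ((-1) * s + t)) / 2 = 0"
      unfolding args by simp
  qed
  then have "?D s = ?D 0" by (intro DERIV_isconst_all) blast
  also have "?D 0 = 0" unfolding args V.ip_w0[OF W.wL2] by (simp add: W.g_def ip_commute[of f])
  finally have "ip (v s) (w t) = (W.g (t + s) + W.g (t - s)) / 2" unfolding args by simp
  then show ?thesis by (subst ip_commute)
qed

end

section \<open>Boundedness of \<open>g\<close> and of the norm of the solution\<close>

context wave_family
begin

sublocale self: wave_pair f w w' w'' w w' w'' ..

lemma g_even: "g (- t) = g t"
  using self.dalembert[of 0 t] ip_w0[OF wL2, of t] by (simp add: g_def ip_commute[of f])

lemma g_0: "g 0 = (L2_norm f)\<^sup>2"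
  by (simp add: g_def ip_w0[OF f] L2_norm_sq)

lemma norm_w_sq: "(L2_norm (w t))\<^sup>2 = (g (2 * t) + g 0) / 2"
  using self.dalembert[of t t] by (simp add: L2_norm_sq)

text \<open>Differentiating \<open>self.ip_w_v'\<close> and \<open>self.ip_w'_v\<close> gives
  \<open>ip (w' t) (w' t) = (g'' (2 * t) - g'' 0) / 2\<close> and
  \<open>ip (w'' t) (w t) = (g'' (2 * t) + g'' 0) / 2\<close>. The latter is nonpositive because the
  Laplacian is, and this bounds \<open>g'' (2 * t)\<close> from above.\<close>

lemma norm_w'_sq: "(L2_norm (w' t))\<^sup>2 \<le> - g'' 0"
proof -
  have "((\<lambda>r. ip (w r) (w' t)) has_real_derivative ip (w' t) (w' t)) (at t)"
    by (rule ip_w_deriv[OF w'])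
  moreover have "((\<lambda>r. (g' (1 * r + t) - g' (1 * r + - t)) / 2) has_real_derivative
      (1 * g'' (1 * t + t) - 1 * g'' (1 * t + - t)) / 2) (at t)"
    by (intro DERIV_cdivide DERIV_diff g'_chain)
  moreover have "(\<lambda>r. ip (w r) (w' t)) = (\<lambda>r. (g' (1 * r + t) - g' (1 * r + - t)) / 2)"
    by (simp add: self.ip_w_v')
  ultimately have "ip (w' t) (w' t) = (1 * g'' (1 * t + t) - 1 * g'' (1 * t + - t)) / 2"
    by (simp only:) (rule DERIV_unique)
  then have 1: "ip (w' t) (w' t) = (g'' (2 * t) - g'' 0) / 2" by simp
  have "((\<lambda>r. ip (w' r) (w t)) has_real_derivative ip (w'' t) (w t)) (at t)"
    by (rule ip_w'_deriv[OF wL2])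
  moreover have "((\<lambda>r. (g' (1 * r + t) + g' (1 * r + - t)) / 2) has_real_derivative
      (1 * g'' (1 * t + t) + 1 * g'' (1 * t + - t)) / 2) (at t)"
    by (intro DERIV_cdivide DERIV_add g'_chain)
  moreover have "(\<lambda>r. ip (w' r) (w t)) = (\<lambda>r. (g' (1 * r + t) + g' (1 * r + - t)) / 2)"
    by (simp add: self.ip_w'_v)
  ultimately have "ip (w'' t) (w t) = (1 * g'' (1 * t + t) + 1 * g'' (1 * t + - t)) / 2"
    by (simp only:) (rule DERIV_unique)
  then have "ip (w'' t) (w t) = (g'' (2 * t) + g'' 0) / 2" by simp
  moreover have "ip (w'' t) (w t) \<le> 0"
    using weak_laplacian_nonpos[OF w] by (simp add: ip_w''[OF wL2])
  ultimately show ?thesis using 1 by (simp add: L2_norm_sq)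
qed

text \<open>An a priori growth bound, from a uniform bound on \<open>g'\<close>; the doubling
  argument then improves it to boundedness.\<close>

lemma g_linear_bound:
  obtains L where "\<And>t. \<bar>g t\<bar> \<le> g 0 + L * \<bar>t\<bar>" "0 \<le> L"
proof -
  define L where "L = sqrt (- g'' 0) * L2_norm f"
  have b: "\<bar>g' t\<bar> \<le> L" for t
  proof -
    have "\<bar>g' t\<bar> \<le> L2_norm (w' t) * L2_norm f"
      unfolding g'_def by (rule ip_Cauchy_Schwarz[OF w' f])
    also have "\<dots> \<le> L"
      unfolding L_def by (intro mult_right_mono real_le_rsqrt norm_w'_sq L2_norm_nonneg)
    finally show ?thesis .
  qed
  have "\<bar>g t\<bar> \<le> g 0 + L * \<bar>t\<bar>" for t
  proof -
    have "norm (g t - g 0) \<le> L * norm (t - 0)"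
      by (rule field_differentiable_bound[of UNIV g g'])
        (use b g_deriv in \<open>auto simp: has_field_derivative_at_within\<close>)
    moreover have "0 \<le> g 0" by (simp add: g_0)
    ultimately show ?thesis unfolding real_norm_def diff_zero by linarith
  qed
  moreover have "0 \<le> L" using b[of 0] abs_ge_zero order_trans by blast
  ultimately show thesis by (rule that)
qed

text \<open>Under iteration the factor 4 beats the factor 2 that the linear bound allows, so no excess is possible.\<close>

lemma g_doubling:
  assumes "0 < \<bar>g t\<bar> - g 0"
  shows "4 * (\<bar>g t\<bar> - g 0) \<le> \<bar>g (2 * t)\<bar> - g 0"
proof -
  define h where "h = \<bar>g t\<bar> - g 0"
  have h: "0 < h" "\<bar>g t\<bar> = g 0 + h" using assms by (simp_all add: h_def)
  have "\<bar>g t\<bar>\<^sup>2 \<le> (L2_norm (w t) * L2_norm f)\<^sup>2"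
    unfolding g_def by (rule power_mono[OF ip_Cauchy_Schwarz[OF wL2 f]]) simp
  also have "\<dots> = (g (2 * t) + g 0) / 2 * g 0"
    by (simp add: power_mult_distrib norm_w_sq g_0)
  finally have *: "2 * (g 0 + h)\<^sup>2 \<le> (g (2 * t) + g 0) * g 0" by (simp add: h(2))
  have "g 0 \<noteq> 0" using * h(1) by auto
  then have g0: "0 < g 0" using g_0 by (metis less_eq_real_def zero_le_power2)
  have "(4 * h + g 0) * g 0 + g 0 * g 0 \<le> 2 * (g 0 + h)\<^sup>2"
    by (simp add: power2_eq_square algebra_simps)
  with * have "(4 * h + g 0) * g 0 \<le> g (2 * t) * g 0" by (simp add: algebra_simps)
  then have "4 * h + g 0 \<le> g (2 * t)" using g0 by (simp only: mult_le_cancel_right_pos)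
  then show ?thesis unfolding h_def by linarith
qed

lemma g_bound: "\<bar>g t\<bar> \<le> g 0"
proof (rule ccontr)
  assume "\<not> \<bar>g t\<bar> \<le> g 0"
  then have h: "0 < \<bar>g t\<bar> - g 0" by simp
  obtain L where L: "\<And>t. \<bar>g t\<bar> \<le> g 0 + L * \<bar>t\<bar>" "0 \<le> L" using g_linear_bound by blast
  have "0 < \<bar>g (2 ^ n * t)\<bar> - g 0 \<and> 4 ^ n * (\<bar>g t\<bar> - g 0) \<le> \<bar>g (2 ^ n * t)\<bar> - g 0" for n
  proof (induction n)
    case (Suc n)
    then show ?case using g_doubling[of "2 ^ n * t"] by (simp add: mult.assoc)
  qed (use h in simp)
  note iter = this
  have gr: "4 ^ n * (\<bar>g t\<bar> - g 0) \<le> L * \<bar>2 ^ n * t\<bar>" for n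
    using L(1)[of "2 ^ n * t"] conjunct2[OF iter[of n]] by linarith
  obtain n where n: "L * \<bar>t\<bar> / (\<bar>g t\<bar> - g 0) < 2 ^ n"
    using real_arch_pow[of 2 "L * \<bar>t\<bar> / (\<bar>g t\<bar> - g 0)"] by auto
  then have "L * \<bar>t\<bar> < 2 ^ n * (\<bar>g t\<bar> - g 0)" using h by (simp add: pos_divide_less_eq)
  then have "2 ^ n * (L * \<bar>t\<bar>) < 2 ^ n * (2 ^ n * (\<bar>g t\<bar> - g 0))" by simp
  also have "\<dots> = 4 ^ n * (\<bar>g t\<bar> - g 0)"
    by (simp add: mult.assoc[symmetric] flip: power_mult_distrib)
  finally show False using gr[of n] by (simp add: abs_mult mult.left_commute)
qed

lemma norm_w_le: "L2_norm (w t) \<le> L2_norm f"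
proof (rule power2_le_imp_le)
  show "(L2_norm (w t))\<^sup>2 \<le> (L2_norm f)\<^sup>2"
    using g_bound[of "2 * t"] by (simp add: norm_w_sq abs_le_iff flip: g_0)
qed (rule L2_norm_nonneg)

lemma g_continuous: "continuous_on UNIV g"
  using g_deriv by (auto intro!: continuous_at_imp_continuous_on DERIV_isCont)

end

text \<open>The only form in which uniqueness of the solution enters: both solutions have the same
  inner products with the datum.\<close>

lemma (in wave_pair) g_eq: "V.g = W.g"
proof
  fix s
  have "V.g s = ip (w 0) (v s)" unfolding V.g_def W.ip_w0[OF V.wL2] by (rule ip_commute)
  then show "V.g s = W.g s" using dalembert[of 0 s] W.g_even[of s] by simp
qed

lemma wave_solution_family:
  assumes f: "f0 \<in> H2" and w: "wave_solution c f0 w" and c: "0 < c"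
  obtains w' w'' where "wave_family f0 (\<lambda>t. w (t / c)) w' w''"
proof -
  from w obtain w' w'' where H: "\<And>t. w t \<in> H2" "\<And>t. w' t \<in> L2" "\<And>t. has_L2_derivative w (w' t) t"
    "\<And>t. w'' t \<in> L2" "\<And>t. has_L2_derivative w' (w'' t) t"
    "\<And>t. AE x in lborel. w'' t x = of_real (c\<^sup>2) * weak_laplacian (w t) x"
    "AE x in lborel. w 0 x = f0 x" "AE x in lborel. w' 0 x = 0"
    unfolding wave_solution_def by blast
  have "wave_family f0 (\<lambda>t. w (t / c)) (\<lambda>t x. (1 / c) *\<^sub>R w' (t / c) x)
     (\<lambda>t x. (1 / c) *\<^sub>R ((1 / c) *\<^sub>R w'' (t / c) x))"
  proof
    show "f0 \<in> L2" by (rule H2_L2[OF f])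
    fix t
    show "w (t / c) \<in> H2" by (rule H)
    show "(\<lambda>x. (1 / c) *\<^sub>R w' (t / c) x) \<in> L2" by (rule L2_scaleR[OF H(2)])
    show "(\<lambda>x. (1 / c) *\<^sub>R ((1 / c) *\<^sub>R w'' (t / c) x)) \<in> L2" by (intro L2_scaleR H)
    show "has_L2_derivative (\<lambda>t. w (t / c)) (\<lambda>x. (1 / c) *\<^sub>R w' (t / c) x) t"
      using has_L2_derivative_affine[of w "w' (t / c)" "1 / c" t 0] H(3)[of "t / c"] c by simp
    have "has_L2_derivative (\<lambda>t x. (1 / c) *\<^sub>R w' t x) (\<lambda>x. (1 / c) *\<^sub>R w'' s x) s" for s
      by (rule has_L2_derivative_scaleR[OF H(5)])
    from has_L2_derivative_affine[of _ _ "1 / c" t 0, OF this[of "1 / c * t + 0"]]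
    show "has_L2_derivative (\<lambda>t x. (1 / c) *\<^sub>R w' (t / c) x) (\<lambda>x. (1 / c) *\<^sub>R ((1 / c) *\<^sub>R w'' (t / c) x)) t"
      using c by simp
    show "AE x in lborel. (1 / c) *\<^sub>R ((1 / c) *\<^sub>R w'' (t / c) x) = weak_laplacian (w (t / c)) x"
      using H(6)[of "t / c"] by eventually_elim (use c in \<open>simp add: scaleR_conv_of_real power2_eq_square\<close>)
    show "AE x in lborel. w (0 / c) x = f0 x" using H(7) by simp
    show "AE x in lborel. (1 / c) *\<^sub>R w' (0 / c) x = 0" using H(8) by eventually_elim simp
  qed
  then show thesis by (rule that)
qed

section \<open>Gaussian averages\<close>

lemma prob_integral_swap:
  fixes f :: "'a \<Rightarrow> 'b \<Rightarrow> real"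
  assumes A: "prob_space A" and B: "prob_space B"
    and m: "(\<lambda>(x, y). f x y) \<in> borel_measurable (A \<Otimes>\<^sub>M B)" and b: "\<And>x y. \<bar>f x y\<bar> \<le> C"
  shows "(\<integral>x. (\<integral>y. f x y \<partial>B) \<partial>A) = (\<integral>y. (\<integral>x. f x y \<partial>A) \<partial>B)"
proof -
  interpret A: prob_space A by (rule A)
  interpret B: prob_space B by (rule B)
  interpret P: pair_prob_space A B ..
  have "integrable (A \<Otimes>\<^sub>M B) (\<lambda>(x, y). f x y)"
    by (rule P.integrable_const_bound[where B = C]) (use m b in auto)
  then show ?thesis by (rule P.Fubini_integral[symmetric])
qed

lemma (in prob_space) abs_expectation_le:
  assumes "\<And>x. \<bar>f x\<bar> \<le> (C::real)"
  shows "\<bar>\<integral>x. f x \<partial>M\<bar> \<le> C"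
proof (cases "integrable M f")
  case True
  have "\<bar>\<integral>x. f x \<partial>M\<bar> \<le> (\<integral>x. \<bar>f x\<bar> \<partial>M)" by (rule integral_abs_bound)
  also have "\<dots> \<le> (\<integral>x. C \<partial>M)" using True assms by (intro integral_mono) auto
  finally show ?thesis by (simp add: prob_space)
next
  \<comment> \<open>A non-integrable function has Bochner integral 0, so only the sign of
    \<open>C\<close> matters.\<close>
  case False
  have "0 \<le> C" using assms abs_ge_zero order_trans by blast
  then show ?thesis using False by (simp add: not_integrable_integral_eq)
qed

section \<open>Integrals against the standard normal distribution\<close>

abbreviation "\<nu> \<equiv> std_normal_distribution"

interpretation \<nu>: prob_space \<nu>
  by (rule prob_space_normal_density) simp

lemma measure_\<nu>_UNIV [simp]: "measure \<nu> UNIV = 1"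
  using \<nu>.prob_space by simp

lemma integral_\<nu>:
  fixes f :: "real \<Rightarrow> real"
  assumes "f \<in> borel_measurable borel"
  shows "(\<integral>x. f x \<partial>\<nu>) = (\<integral>x. std_normal_density x * f x \<partial>lborel)"
  using assms by (subst integral_density) (auto simp: normal_density_nonneg)

lemma integrable_\<nu>_bounded:
  fixes f :: "real \<Rightarrow> real"
  assumes "f \<in> borel_measurable borel" "\<And>x. \<bar>f x\<bar> \<le> C"
  shows "integrable \<nu> f" "integrable lborel (\<lambda>x. std_normal_density x * f x)"
proof -
  show "integrable \<nu> f" by (rule \<nu>.integrable_const_bound[where B = C]) (use assms in auto)
  then show "integrable lborel (\<lambda>x. std_normal_density x * f x)"
    using assms(1) by (subst (asm) integrable_density) (auto simp: normal_density_nonneg)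
qed

lemma integral_cos_\<nu>: "(\<integral>x. cos (t * x) \<partial>\<nu>) = exp (- t\<^sup>2 / 2)"
proof -
  have i: "complex_integrable \<nu> (\<lambda>x. iexp (t * x))"
    by (rule \<nu>.integrable_const_bound[where B = 1]) auto
  have "(\<integral>x. cos (t * x) \<partial>\<nu>) = (\<integral>x. Re (iexp (t * x)) \<partial>\<nu>)"
    by (simp add: Re_exp)
  also have "\<dots> = Re (\<integral>x. iexp (t * x) \<partial>\<nu>)" by (rule integral_Re[OF i])
  also have "\<dots> = Re (char \<nu> t)" by (simp add: char_def)
  finally show ?thesis by (simp add: char_std_normal_distribution)
qed

lemma integral_\<nu>_uminus:
  fixes f :: "real \<Rightarrow> real"
  assumes [measurable]: "f \<in> borel_measurable borel"
  shows "(\<integral>x. f (- x) \<partial>\<nu>) = (\<integral>x. f x \<partial>\<nu>)"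
proof -
  have "(\<integral>x. f (- x) \<partial>\<nu>) = (\<integral>x. std_normal_density (- x) * f (- x) \<partial>lborel)"
    by (subst integral_\<nu>) (auto simp: std_normal_density_def)
  also have "\<dots> = (\<integral>x. std_normal_density x * f x \<partial>lborel)"
    by (rule integral_lborel_uminus) measurable
  finally show ?thesis by (simp add: integral_\<nu>)
qed

lemma integral_cos_cos_\<nu>:
  "(\<integral>x. cos (a * x) * cos (b * x) \<partial>\<nu>) = (exp (- (a - b)\<^sup>2 / 2) + exp (- (a + b)\<^sup>2 / 2)) / 2"
proof -
  have "cos (a * x) * cos (b * x) = (cos ((a - b) * x) + cos ((a + b) * x)) / 2" for x
    by (simp add: cos_times_cos algebra_simps)
  then have "(\<integral>x. cos (a * x) * cos (b * x) \<partial>\<nu>) = (\<integral>x. (cos ((a - b) * x) + cos ((a + b) * x)) / 2 \<partial>\<nu>)"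
    by presburger
  also have "\<dots> = ((\<integral>x. cos ((a - b) * x) \<partial>\<nu>) + (\<integral>x. cos ((a + b) * x) \<partial>\<nu>)) / 2"
    using integrable_\<nu>_bounded(1)[of "\<lambda>x. cos (c * x)" 1 for c] by simp
  finally show ?thesis by (simp only: integral_cos_\<nu>)
qed

text \<open>Rotation invariance of the planar Gaussian: (x - y) / sqrt 2 and (x + y) / sqrt 2 are
  again independent standard normals. The rotation is carried out by one-dimensional substitutions,
  r = x - y and then q = y + r / 2.\<close>

lemma integral_\<nu>_rotate:
  fixes F H :: "real \<Rightarrow> real"
  assumes [measurable]: "F \<in> borel_measurable borel" "H \<in> borel_measurable borel"
    and b: "\<And>x. \<bar>F x\<bar> \<le> C" "\<And>x. \<bar>H x\<bar> \<le> D"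
  shows "(\<integral>y. (\<integral>x. F (x - y) * H (x + y) \<partial>\<nu>) \<partial>\<nu>) = (\<integral>x. F (sqrt 2 * x) \<partial>\<nu>) * (\<integral>x. H (sqrt 2 * x) \<partial>\<nu>)"
proof -
  let ?n = std_normal_density
  have C0: "0 \<le> C" and D0: "0 \<le> D" using b[of 0] abs_ge_zero order_trans by blast+
  have n0: "0 \<le> ?n x" for x by (simp add: normal_density_nonneg)
  have FH: "\<bar>F x * H y\<bar> \<le> C * D" for x y
    by (simp only: abs_mult) (intro mult_mono b abs_ge_zero C0)
  have inner: "(\<integral>x. F (x - y) * H (x + y) \<partial>\<nu>) = (\<integral>r. ?n (r + y) * (F r * H (r + 2 * y)) \<partial>lborel)" for y
  proof -
    have "(\<integral>x. F (x - y) * H (x + y) \<partial>\<nu>) = (\<integral>x. ?n x * (F (x - y) * H (x + y)) \<partial>lborel)"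
      by (rule integral_\<nu>) measurable
    also have "\<dots> = (\<integral>r. ?n (r + y) * (F ((r + y) - y) * H ((r + y) + y)) \<partial>lborel)"
      by (rule integral_lborel_shift[symmetric]) measurable
    also have "\<dots> = (\<integral>r. ?n (r + y) * (F r * H (r + 2 * y)) \<partial>lborel)"
      by (simp add: algebra_simps)
    finally show ?thesis .
  qed
  define G where "G y r = ?n y * (?n (r + y) * (F r * H (r + 2 * y)))" for y r
  have [measurable]: "(\<lambda>(y, r). G y r) \<in> borel_measurable (lborel \<Otimes>\<^sub>M lborel)"
    unfolding G_def by measurable
  have int: "integrable lborel (\<lambda>r. ?n (r + y))" "(\<integral>r. ?n (r + y) \<partial>lborel) = 1" for y :: real
    using integrable_lborel_shift[OF integrable_normal_density[of 1 0], of y]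
      integral_lborel_shift[of ?n y] by (auto simp: integral_normal_density)
  have Gle: "\<bar>G y r\<bar> \<le> ?n y * (C * D) * ?n (r + y)" for y r
  proof -
    have "\<bar>G y r\<bar> = ?n y * ?n (r + y) * \<bar>F r * H (r + 2 * y)\<bar>"
      by (simp add: G_def abs_mult n0)
    also have "\<dots> \<le> ?n y * ?n (r + y) * (C * D)" by (intro mult_left_mono FH mult_nonneg_nonneg n0)
    finally show ?thesis by (simp add: mult_ac)
  qed
  have Gint: "integrable lborel (G y)" for y
    by (rule Bochner_Integration.integrable_bound[OF integrable_mult_right[OF int(1), of "?n y * (C * D)"]])
      (use Gle n0 C0 D0 in \<open>auto simp: abs_mult\<close>)
  have GG: "integrable (lborel \<Otimes>\<^sub>M lborel) (\<lambda>(y, r). G y r)"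
  proof (rule lborel_pair.Fubini_integrable)
    show "AE y in lborel. integrable lborel (\<lambda>r. case (y, r) of (y, r) \<Rightarrow> G y r)" using Gint by simp
    have "(\<integral>r. \<bar>G y r\<bar> \<partial>lborel) \<le> ?n y * (C * D)" for y
    proof -
      have "(\<integral>r. \<bar>G y r\<bar> \<partial>lborel) \<le> (\<integral>r. ?n y * (C * D) * ?n (r + y) \<partial>lborel)"
        using Gint int(1) by (intro integral_mono Gle) auto
      then show ?thesis using int(2)[of y] by simp
    qed
    then have le: "\<bar>\<integral>r. \<bar>G y r\<bar> \<partial>lborel\<bar> \<le> ?n y * (C * D)" for y by simp
    have "integrable lborel (\<lambda>y. \<integral>r. \<bar>G y r\<bar> \<partial>lborel)"
    proof (rule Bochner_Integration.integrable_bound)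
      show "integrable lborel (\<lambda>y. ?n y * (C * D))"
        by (intro integrable_mult_left integrable_normal_density) simp
      show "AE y in lborel. norm (\<integral>r. \<bar>G y r\<bar> \<partial>lborel) \<le> norm (?n y * (C * D))"
        unfolding real_norm_def by (intro AE_I2 order_trans[OF le abs_ge_self])
    qed measurable
    then show "integrable lborel (\<lambda>y. \<integral>r. norm (case (y, r) of (y, r) \<Rightarrow> G y r) \<partial>lborel)"
      by simp
  qed measurable
  have "(\<integral>y. (\<integral>x. F (x - y) * H (x + y) \<partial>\<nu>) \<partial>\<nu>) = (\<integral>y. (\<integral>r. G y r \<partial>lborel) \<partial>lborel)"
    unfolding inner by (subst integral_\<nu>) (auto simp: G_def[abs_def])
  also have "\<dots> = (\<integral>r. (\<integral>y. G y r \<partial>lborel) \<partial>lborel)"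
    by (rule lborel_pair.Fubini_integral[symmetric]) (rule GG)
  also have "\<dots> = (\<integral>r. (?n (r / sqrt 2) * F r) * (\<integral>q. ?n (sqrt 2 * q) * H (2 * q) \<partial>lborel) \<partial>lborel)"
  proof (rule Bochner_Integration.integral_cong)
    fix r
    \<comment> \<open>From (q - r / 2)^2 + (q + r / 2)^2 = (r / sqrt 2)^2 + (sqrt 2 q)^2.\<close>
    have "?n (q + - (r / 2)) * ?n (r + (q + - (r / 2))) = ?n (r / sqrt 2) * ?n (sqrt 2 * q)" for q
      unfolding std_normal_density_def
      by (simp add: exp_add[symmetric] power_divide power_mult_distrib power2_eq_square field_simps)
    then have *: "?n (q + - (r / 2)) * (?n (r + (q + - (r / 2))) * (F r * H (r + 2 * (q + - (r / 2))))) =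
        (?n (r / sqrt 2) * F r) * (?n (sqrt 2 * q) * H (2 * q))" for q
      by (simp add: mult.assoc[symmetric])
    have "(\<integral>y. G y r \<partial>lborel) = (\<integral>q. G (q + - (r / 2)) r \<partial>lborel)"
      by (rule integral_lborel_shift[symmetric]) (simp add: G_def)
    then show "(\<integral>y. G y r \<partial>lborel) = (?n (r / sqrt 2) * F r) * (\<integral>q. ?n (sqrt 2 * q) * H (2 * q) \<partial>lborel)"
      by (simp only: G_def * integral_mult_right_zero)
  qed simp
  also have "\<dots> = (\<integral>r. ?n (r / sqrt 2) * F r \<partial>lborel) * (\<integral>q. ?n (sqrt 2 * q) * H (2 * q) \<partial>lborel)"
    by simp
  also have "(\<integral>r. ?n (r / sqrt 2) * F r \<partial>lborel) = sqrt 2 * (\<integral>x. F (sqrt 2 * x) \<partial>\<nu>)"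
    by (subst lborel_integral_real_affine[of "sqrt 2" _ 0]) (auto simp: integral_\<nu>)
  also have "(\<integral>q. ?n (sqrt 2 * q) * H (2 * q) \<partial>lborel) = (1 / sqrt 2) * (\<integral>x. H (sqrt 2 * x) \<partial>\<nu>)"
  proof -
    have s: "2 / sqrt 2 = sqrt (2::real)" by (simp add: real_div_sqrt)
    have "2 * (0 + 1 / sqrt 2 * x) = (2 / sqrt 2) * x" for x :: real by simp
    then have e: "2 * (0 + 1 / sqrt 2 * x) = sqrt 2 * x" "sqrt 2 * (0 + 1 / sqrt 2 * x) = x" for x :: real
      by (simp_all only: s) simp
    have "(\<integral>q. ?n (sqrt 2 * q) * H (2 * q) \<partial>lborel) = \<bar>1 / sqrt 2\<bar> *\<^sub>R (\<integral>x. ?n x * H (sqrt 2 * x) \<partial>lborel)"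
      using lborel_integral_real_affine[of "1 / sqrt 2" "\<lambda>q. ?n (sqrt 2 * q) * H (2 * q)" 0]
      unfolding e by simp
    then show ?thesis by (simp add: integral_\<nu>)
  qed
  finally show ?thesis by simp
qed

text \<open>A random element of \<open>L2\<close> of bounded norm. Its mean is formed pointwise in
  \<open>x\<close>, as \<open>u\<close> and \<open>h\<close> are. By Fubini the integrand is
  square-integrable in \<open>s\<close> for almost every \<open>x\<close>, so the default value 0 of
  the remaining integrals affects a null set only.\<close>

locale L2_family = prob_space M for M :: "'s measure" +
  fixes X :: "'s \<Rightarrow> 'a::euclidean_space \<Rightarrow> complex" and K :: real
  assumes meas: "(\<lambda>(s, x). X s x) \<in> borel_measurable (M \<Otimes>\<^sub>M lborel)"
    and XL2: "\<And>s. X s \<in> L2" and norm_X: "\<And>s. L2_norm (X s) \<le> K"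
begin

definition mean :: "'a \<Rightarrow> complex" where "mean x = (\<integral>s. X s x \<partial>M)"

sublocale P: pair_sigma_finite M "lborel :: 'a measure" ..

lemma square_integrable: "integrable (M \<Otimes>\<^sub>M lborel) (\<lambda>(s, x). (cmod (X s x))\<^sup>2)"
proof (rule P.Fubini_integrable)
  note [measurable] = meas
  show "(\<lambda>(s, x). (cmod (X s x))\<^sup>2) \<in> borel_measurable (M \<Otimes>\<^sub>M lborel)" by measurable
  show "AE s in M. integrable lborel (\<lambda>x. case (s, x) of (s, x) \<Rightarrow> (cmod (X s x))\<^sup>2)"
    using L2_integrable[OF XL2] by simp
  have "(\<lambda>s. \<integral>x. (cmod (X s x))\<^sup>2 \<partial>lborel) \<in> borel_measurable M" by measurable
  moreover have "(\<integral>x. (cmod (X s x))\<^sup>2 \<partial>lborel) \<le> K\<^sup>2" for s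
    using power_mono[OF norm_X[of s] L2_norm_nonneg, of 2] by (simp add: L2_norm_def)
  ultimately show "integrable M (\<lambda>s. \<integral>x. norm (case (s, x) of (s, x) \<Rightarrow> (cmod (X s x))\<^sup>2) \<partial>lborel)"
    by (intro integrable_const_bound[where B = "K\<^sup>2"]) auto
qed

lemma AE_square_integrable: "AE x in lborel. integrable M (\<lambda>s. (cmod (X s x))\<^sup>2)"
  using P.AE_integrable_snd[OF square_integrable] by simp

lemma integrable_square_mean: "integrable lborel (\<lambda>x. \<integral>s. (cmod (X s x))\<^sup>2 \<partial>M)"
  using P.integrable_snd[OF square_integrable] by simp

lemma X_measurable: "(\<lambda>s. X s x) \<in> borel_measurable M"
  using meas by measurable

lemma integrable_X:
  assumes "integrable M (\<lambda>s. (cmod (X s x))\<^sup>2)"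
  shows "integrable M (\<lambda>s. X s x)"
proof (rule Bochner_Integration.integrable_bound)
  show "integrable M (\<lambda>s. 1 + (cmod (X s x))\<^sup>2)" using assms by simp
  have "a \<le> 1 + a\<^sup>2" for a :: real
    using sum_squares_bound[of 1 a] zero_le_power2[of a] unfolding power_one mult_1_right by linarith
  then show "AE s in M. norm (X s x) \<le> norm (1 + (cmod (X s x))\<^sup>2)" by simp
qed (rule X_measurable)

lemma mean_L2: "mean \<in> L2"
proof (rule L2I)
  note [measurable] = meas
  show m: "mean \<in> borel_measurable lborel"
    unfolding mean_def[abs_def] by measurable
  show "integrable lborel (\<lambda>x. (cmod (mean x))\<^sup>2)"
  proof (rule Bochner_Integration.integrable_bound[OF integrable_square_mean])
    show "(\<lambda>x. (cmod (mean x))\<^sup>2) \<in> borel_measurable lborel" using m by measurable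
    show "AE x in lborel. norm ((cmod (mean x))\<^sup>2) \<le> norm (\<integral>s. (cmod (X s x))\<^sup>2 \<partial>M)"
      using AE_square_integrable
    proof eventually_elim
      case (elim x)
      have i: "integrable M (\<lambda>s. cmod (X s x))" using integrable_X[OF elim] by simp
      have "(cmod (mean x))\<^sup>2 \<le> (\<integral>s. cmod (X s x) \<partial>M)\<^sup>2"
        unfolding mean_def by (rule power_mono[OF integral_norm_bound]) simp
      \<comment> \<open>Jensen's inequality, in the form that a variance is nonnegative.\<close>
      also have "\<dots> \<le> (\<integral>s. (cmod (X s x))\<^sup>2 \<partial>M)"
        using variance_eq[OF i elim] variance_positive[of "\<lambda>s. cmod (X s x)"] by simp
      finally show ?case by simp
    qed
  qed
qed

lemma ip_mean:
  assumes G: "G \<in> L2"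
  shows "ip mean G = (\<integral>s. ip (X s) G \<partial>M)"
proof -
  note [measurable] = meas L2_measurable[OF G]
  have int: "integrable (M \<Otimes>\<^sub>M lborel) (\<lambda>(s, x). X s x \<bullet> G x)"
  proof (rule Bochner_Integration.integrable_bound)
    have "integrable (M \<Otimes>\<^sub>M lborel) (\<lambda>(s, x). (cmod (G x))\<^sup>2)"
      using P.Fubini_integrable[of "\<lambda>(s, x). (cmod (G x))\<^sup>2"] L2_integrable[OF G] by simp
    then show "integrable (M \<Otimes>\<^sub>M lborel) (\<lambda>p. (case p of (s, x) \<Rightarrow> (cmod (X s x))\<^sup>2) + (case p of (s, x) \<Rightarrow> (cmod (G x))\<^sup>2))"
      using square_integrable by (rule Bochner_Integration.integrable_add[rotated])
    have b: "\<bar>a \<bullet> b\<bar> \<le> (cmod a)\<^sup>2 + (cmod b)\<^sup>2" for a b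
      using Cauchy_Schwarz_ineq2[of a b] two_norms_le[of a b] mult_nonneg_nonneg[OF norm_ge_zero[of a] norm_ge_zero[of b]]
      by linarith
    show "AE p in M \<Otimes>\<^sub>M lborel. norm (case p of (s, x) \<Rightarrow> X s x \<bullet> G x) \<le>
        norm ((case p of (s, x) \<Rightarrow> (cmod (X s x))\<^sup>2) + (case p of (s, x) \<Rightarrow> (cmod (G x))\<^sup>2))"
      unfolding split_beta real_norm_def by (intro AE_I2 order_trans[OF b abs_ge_self])
  qed measurable
  have "(\<integral>s. ip (X s) G \<partial>M) = (\<integral>x. (\<integral>s. X s x \<bullet> G x \<partial>M) \<partial>lborel)"
    unfolding ip_def by (rule P.Fubini_integral[symmetric]) (rule int)
  also have "\<dots> = ip mean G"
    unfolding ip_def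
  proof (rule integral_cong_AE)
    show "AE x in lborel. (\<integral>s. X s x \<bullet> G x \<partial>M) = mean x \<bullet> G x"
      using AE_square_integrable by eventually_elim (simp add: mean_def integrable_X)
    show "(\<lambda>x. mean x \<bullet> G x) \<in> borel_measurable lborel"
      using L2_measurable[OF mean_L2] by measurable
  qed measurable
  finally show ?thesis by simp
qed

end

section \<open>A spectral inequality for positive definite functions\<close>

text \<open>\<open>pos\<close> is positive definiteness of the kernel
  \<open>(g (s + t) + g (s - t)) / 2\<close>, tested against a cosine of frequency \<open>l\<close>
  times a Gaussian of width 1 / \<delta>. For wave solutions the integral is the squared norm of an
  average of \<open>w\<close>.\<close>

locale gauss_pd =
  fixes g :: "real \<Rightarrow> real"
  assumes cont: "continuous_on UNIV g" and even: "\<And>t. g (- t) = g t" and bound: "\<And>t. \<bar>g t\<bar> \<le> g 0"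
    and pos: "\<And>l \<delta>. 0 < \<delta> \<Longrightarrow>
      0 \<le> (\<integral>y. (\<integral>x. cos (l * (x / \<delta>)) * cos (l * (y / \<delta>)) * ((g (x / \<delta> + y / \<delta>) + g (x / \<delta> - y / \<delta>)) / 2) \<partial>\<nu>) \<partial>\<nu>)"
begin

lemma g_measurable [measurable]: "g \<in> borel_measurable borel"
  by (rule borel_measurable_continuous_onI[OF cont])

lemma g0: "0 \<le> g 0"
  using bound[of 0] by simp

text \<open>Up to a factor, the Fourier transform of
  \<open>g r * exp (- (\<delta> * r)\<^sup>2 / 4)\<close> at \<open>l\<close>: formally the spectral
  measure of \<open>g\<close>, smoothed by a Gaussian of width of order \<delta>.\<close>

definition K :: "real \<Rightarrow> real \<Rightarrow> real" where
  "K \<delta> l = (\<integral>z. cos (l * (sqrt 2 * z / \<delta>)) * g (sqrt 2 * z / \<delta>) \<partial>\<nu>)"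

lemma cos_g_le: "\<bar>cos a * g b\<bar> \<le> g 0"
proof -
  have "\<bar>cos a\<bar> * \<bar>g b\<bar> \<le> 1 * g 0" by (intro mult_mono bound abs_cos_le_one) auto
  then show ?thesis by (simp add: abs_mult)
qed

lemma g_cos_le: "\<bar>g b * cos a\<bar> \<le> g 0"
  using cos_g_le[of a b] by (simp only: mult.commute)

lemma K_le: "\<bar>K \<delta> l\<bar> \<le> g 0"
  unfolding K_def by (rule \<nu>.abs_expectation_le) (rule cos_g_le)

lemma K_measurable [measurable]: "K \<delta> \<in> borel_measurable borel"
  unfolding K_def[abs_def] by measurable

text \<open>
  Averaging \<open>w\<close> against cosines sees only its even frequency content, so a spectral atom at 0 is
  counted twice. This is the source of the second summand, and of the factor 2 in the final bound.
\<close>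

lemma K_pos:
  assumes "0 < \<delta>"
  shows "0 \<le> K \<delta> l + exp (- (l / \<delta>)\<^sup>2) * K \<delta> 0"
proof -
  let ?c = "\<lambda>x y. cos (l * (x / \<delta>)) * cos (l * (y / \<delta>))"
  have cc: "?c x y = (cos (l * ((x - y) / \<delta>)) + cos (l * ((x + y) / \<delta>))) / 2" for x y
    by (simp add: cos_times_cos algebra_simps diff_divide_distrib add_divide_distrib)
  have c3: "\<bar>cos p * cos q * g r\<bar> \<le> g 0" for p q r
  proof -
    have "\<bar>cos p\<bar> * \<bar>cos q * g r\<bar> \<le> 1 * g 0" by (intro mult_mono cos_g_le abs_cos_le_one) auto
    then show ?thesis by (simp add: abs_mult mult.assoc)
  qed
  \<comment> \<open>Replacing x by -x, which preserves \<nu>, and evenness of \<open>g\<close> show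
    that both halves of the kernel contribute equally.\<close>
  have inner: "(\<integral>x. ?c x y * ((g (x / \<delta> + y / \<delta>) + g (x / \<delta> - y / \<delta>)) / 2) \<partial>\<nu>) =
    (\<integral>x. ?c x y * g ((x - y) / \<delta>) \<partial>\<nu>)" for y
  proof -
    have "(\<integral>x. ?c (- x) y * g ((- x + y) / \<delta>) \<partial>\<nu>) = (\<integral>x. ?c x y * g ((x + y) / \<delta>) \<partial>\<nu>)"
      by (rule integral_\<nu>_uminus) measurable
    moreover have "g ((- x + y) / \<delta>) = g ((x - y) / \<delta>)" for x
      using even[of "(x - y) / \<delta>"] by (simp add: minus_divide_left)
    ultimately have 1: "(\<integral>x. ?c x y * g ((x + y) / \<delta>) \<partial>\<nu>) = (\<integral>x. ?c x y * g ((x - y) / \<delta>) \<partial>\<nu>)"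
      by simp
    have i: "integrable \<nu> (\<lambda>x. ?c x y * g ((x + y) / \<delta>))" "integrable \<nu> (\<lambda>x. ?c x y * g ((x - y) / \<delta>))"
      by (rule integrable_\<nu>_bounded(1)[OF _ c3], measurable)+
    have "?c x y * ((g (x / \<delta> + y / \<delta>) + g (x / \<delta> - y / \<delta>)) / 2) =
        (?c x y * g ((x + y) / \<delta>) + ?c x y * g ((x - y) / \<delta>)) / 2" for x
      by (simp add: distrib_left add_divide_distrib diff_divide_distrib)
    then show ?thesis using i 1 by simp
  qed
  let ?F = "\<lambda>r. cos (l * (r / \<delta>)) * g (r / \<delta>)"
  have i1: "integrable \<nu> (\<lambda>x. ?F (x - y))" "integrable \<nu> (\<lambda>x. g ((x - y) / \<delta>) * cos (l * ((x + y) / \<delta>)))" for y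
    by (rule integrable_\<nu>_bounded(1)[OF _ cos_g_le], measurable)
      (rule integrable_\<nu>_bounded(1)[OF _ g_cos_le], measurable)
  \<comment> \<open>By the product formula for cosines the first term depends on x - y alone, and
    the second is a function of x - y times a function of x + y;
    \<open>integral_\<nu>_rotate\<close> evaluates both.\<close>
  have i2: "(\<integral>x. ?c x y * g ((x - y) / \<delta>) \<partial>\<nu>) =
      ((\<integral>x. ?F (x - y) * 1 \<partial>\<nu>) + (\<integral>x. g ((x - y) / \<delta>) * cos (l * ((x + y) / \<delta>)) \<partial>\<nu>)) / 2" for y
  proof -
    have "?c x y * g ((x - y) / \<delta>) = (?F (x - y) + g ((x - y) / \<delta>) * cos (l * ((x + y) / \<delta>))) / 2" for x
      unfolding cc by (simp add: algebra_simps)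
    then show ?thesis
      by (simp only: integral_divide_zero Bochner_Integration.integral_add[OF i1] mult_1_right)
  qed
  have j: "integrable \<nu> (\<lambda>y. \<integral>x. ?F (x - y) * 1 \<partial>\<nu>)"
    "integrable \<nu> (\<lambda>y. \<integral>x. g ((x - y) / \<delta>) * cos (l * ((x + y) / \<delta>)) \<partial>\<nu>)"
    unfolding mult_1_right
    by (rule integrable_\<nu>_bounded(1)[OF _ \<nu>.abs_expectation_le[OF cos_g_le]], measurable)
      (rule integrable_\<nu>_bounded(1)[OF _ \<nu>.abs_expectation_le[OF g_cos_le]], measurable)
  have "0 \<le> (\<integral>y. (\<integral>x. ?c x y * g ((x - y) / \<delta>) \<partial>\<nu>) \<partial>\<nu>)"
    using pos[OF assms, of l] by (simp only: inner)
  also have "\<dots> = ((\<integral>y. \<integral>x. ?F (x - y) * 1 \<partial>\<nu> \<partial>\<nu>) +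
      (\<integral>y. \<integral>x. g ((x - y) / \<delta>) * cos (l * ((x + y) / \<delta>)) \<partial>\<nu> \<partial>\<nu>)) / 2"
    unfolding i2 using j by simp
  also have "(\<integral>y. \<integral>x. ?F (x - y) * 1 \<partial>\<nu> \<partial>\<nu>) = (\<integral>x. ?F (sqrt 2 * x) \<partial>\<nu>) * (\<integral>x. 1 \<partial>\<nu>)"
    by (rule integral_\<nu>_rotate[where C = "g 0" and D = 1]) (measurable, auto intro: cos_g_le)
  also have "\<dots> = K \<delta> l" by (simp add: K_def)
  also have "(\<integral>y. \<integral>x. g ((x - y) / \<delta>) * cos (l * ((x + y) / \<delta>)) \<partial>\<nu> \<partial>\<nu>) =
      (\<integral>x. g (sqrt 2 * x / \<delta>) \<partial>\<nu>) * (\<integral>x. cos (l * (sqrt 2 * x / \<delta>)) \<partial>\<nu>)"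
    by (rule integral_\<nu>_rotate[where C = "g 0" and D = 1 and F = "\<lambda>r. g (r / \<delta>)" and H = "\<lambda>q. cos (l * (q / \<delta>))"])
      (measurable, auto intro: bound)
  also have "(\<integral>x. cos (l * (sqrt 2 * x / \<delta>)) \<partial>\<nu>) = exp (- (l / \<delta>)\<^sup>2)"
    using integral_cos_\<nu>[of "l * sqrt 2 / \<delta>"] by (simp add: power_divide power_mult_distrib mult.assoc)
  also have "(\<integral>x. g (sqrt 2 * x / \<delta>) \<partial>\<nu>) = K \<delta> 0" by (simp add: K_def)
  finally show ?thesis by (simp add: mult.commute)
qed

lemma K0: "0 < \<delta> \<Longrightarrow> 0 \<le> K \<delta> 0"
  using K_pos[of \<delta> 0] by simp

text \<open>The substitution \<open>sqrt 2 * z / \<delta> = a + \<delta> * y\<close> exchanges the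
  roles of the two Gaussians: the narrow one, centred at \<open>a\<close>, becomes the measure, and
  the wide one becomes a weight that tends to 1 as \<delta> tends to 0. The factor in front is the
  Jacobian.\<close>

lemma integral_\<nu>_tilt:
  assumes [measurable]: "h \<in> borel_measurable borel" and \<delta>: "0 < \<delta>"
  shows "(\<integral>z. h (sqrt 2 * z / \<delta>) * exp (- (sqrt 2 * z / \<delta> - a)\<^sup>2 / (2 * \<delta>\<^sup>2)) \<partial>\<nu>) =
    \<delta>\<^sup>2 / sqrt 2 * (\<integral>y. h (a + \<delta> * y) * exp (- ((a + \<delta> * y)\<^sup>2 * \<delta>\<^sup>2 / 4)) \<partial>\<nu>)"
proof -
  let ?c = "\<delta>\<^sup>2 / sqrt 2" and ?t = "a * \<delta> / sqrt 2"
  have z: "sqrt 2 * (?t + ?c * y) / \<delta> = a + \<delta> * y" for y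
    using \<delta> by (simp add: distrib_left add_divide_distrib power2_eq_square)
  have n: "std_normal_density (?t + ?c * y) = (1 / sqrt (2 * pi)) * exp (- ((a + \<delta> * y)\<^sup>2 * \<delta>\<^sup>2 / 4))" for y
  proof -
    have "?t + ?c * y = (a + \<delta> * y) * \<delta> / sqrt 2"
      by (simp add: power2_eq_square algebra_simps add_divide_distrib)
    then have "(?t + ?c * y)\<^sup>2 / 2 = (a + \<delta> * y)\<^sup>2 * \<delta>\<^sup>2 / 4"
      by (simp add: power_divide power_mult_distrib)
    then show ?thesis by (simp add: std_normal_density_def)
  qed
  have e: "exp (- ((a + \<delta> * y) - a)\<^sup>2 / (2 * \<delta>\<^sup>2)) = exp (- y\<^sup>2 / 2)" for y
    using \<delta> by (simp add: power_mult_distrib)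
  have "(\<integral>z. h (sqrt 2 * z / \<delta>) * exp (- (sqrt 2 * z / \<delta> - a)\<^sup>2 / (2 * \<delta>\<^sup>2)) \<partial>\<nu>) =
     (\<integral>z. std_normal_density z * (h (sqrt 2 * z / \<delta>) * exp (- (sqrt 2 * z / \<delta> - a)\<^sup>2 / (2 * \<delta>\<^sup>2))) \<partial>lborel)"
    by (rule integral_\<nu>) measurable
  also have "\<dots> = \<bar>?c\<bar> *\<^sub>R (\<integral>y. std_normal_density (?t + ?c * y) *
      (h (sqrt 2 * (?t + ?c * y) / \<delta>) * exp (- (sqrt 2 * (?t + ?c * y) / \<delta> - a)\<^sup>2 / (2 * \<delta>\<^sup>2))) \<partial>lborel)"
    by (rule lborel_integral_real_affine) (use \<delta> in simp)
  also have "\<dots> = ?c * (\<integral>y. std_normal_density y * (h (a + \<delta> * y) * exp (- ((a + \<delta> * y)\<^sup>2 * \<delta>\<^sup>2 / 4))) \<partial>lborel)"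
    unfolding z e n using \<delta> by (simp add: std_normal_density_def mult_ac)
  also have "(\<integral>y. std_normal_density y * (h (a + \<delta> * y) * exp (- ((a + \<delta> * y)\<^sup>2 * \<delta>\<^sup>2 / 4))) \<partial>lborel) =
      (\<integral>y. h (a + \<delta> * y) * exp (- ((a + \<delta> * y)\<^sup>2 * \<delta>\<^sup>2 / 4)) \<partial>\<nu>)"
    by (rule integral_\<nu>[symmetric]) measurable
  finally show ?thesis .
qed

text \<open>An approximation of \<open>g a\<close>: averaged at scale \<delta> around
  \<open>a\<close> and damped at scale 1 / \<delta>.\<close>

definition \<Theta> :: "real \<Rightarrow> real \<Rightarrow> real" where
  "\<Theta> \<delta> a = (\<integral>y. g (a + \<delta> * y) * exp (- ((a + \<delta> * y)\<^sup>2 * \<delta>\<^sup>2 / 4)) \<partial>\<nu>)"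

lemma g_exp_le: "0 \<le> b \<Longrightarrow> \<bar>g a * exp (- b)\<bar> \<le> g 0"
  using mult_mono[OF bound[of a], of "exp (- b)" 1] g0 by (simp add: abs_mult)

lemma \<Theta>_le: "\<bar>\<Theta> \<delta> a\<bar> \<le> g 0"
  unfolding \<Theta>_def by (rule \<nu>.abs_expectation_le) (rule g_exp_le, simp)

lemma \<Theta>_measurable [measurable]: "\<Theta> \<delta> \<in> borel_measurable borel"
  unfolding \<Theta>_def[abs_def] by measurable

text \<open>Fourier inversion with Gaussian damping in the frequency \<open>z / \<delta>\<close>:
  the smoothed spectral density gives back \<open>g\<close> up to regularisation.\<close>

lemma integral_cos_K:
  assumes \<delta>: "0 < \<delta>"
  shows "(\<integral>z. cos (a * (z / \<delta>)) * K \<delta> (z / \<delta>) \<partial>\<nu>) = \<delta>\<^sup>2 / sqrt 2 * \<Theta> \<delta> a"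
proof -
  let ?r = "\<lambda>y. sqrt 2 * y / \<delta>"
  have "(\<integral>z. cos (a * (z / \<delta>)) * K \<delta> (z / \<delta>) \<partial>\<nu>) =
      (\<integral>z. (\<integral>y. cos (a * (z / \<delta>)) * (cos (z / \<delta> * ?r y) * g (?r y)) \<partial>\<nu>) \<partial>\<nu>)"
    by (simp add: K_def)
  also have "\<dots> = (\<integral>y. (\<integral>z. cos (a * (z / \<delta>)) * (cos (z / \<delta> * ?r y) * g (?r y)) \<partial>\<nu>) \<partial>\<nu>)"
  proof (rule prob_integral_swap[OF \<nu>.prob_space_axioms \<nu>.prob_space_axioms, where C = "g 0"])
    fix y z
    have "\<bar>cos (a * (z / \<delta>))\<bar> * \<bar>cos (z / \<delta> * ?r y) * g (?r y)\<bar> \<le> 1 * g 0"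
      by (intro mult_mono cos_g_le abs_cos_le_one) auto
    then show "\<bar>cos (a * (z / \<delta>)) * (cos (z / \<delta> * ?r y) * g (?r y))\<bar> \<le> g 0" by (simp add: abs_mult)
  qed measurable
  also have "\<dots> = (\<integral>y. g (?r y) * ((exp (- (a / \<delta> - ?r y / \<delta>)\<^sup>2 / 2) + exp (- (a / \<delta> + ?r y / \<delta>)\<^sup>2 / 2)) / 2) \<partial>\<nu>)"
  proof (rule Bochner_Integration.integral_cong)
    fix y
    have "(\<integral>z. cos (a * (z / \<delta>)) * (cos (z / \<delta> * ?r y) * g (?r y)) \<partial>\<nu>) =
        (\<integral>z. g (?r y) * (cos (a / \<delta> * z) * cos (?r y / \<delta> * z)) \<partial>\<nu>)"
      by (simp add: mult_ac)
    then show "(\<integral>z. cos (a * (z / \<delta>)) * (cos (z / \<delta> * ?r y) * g (?r y)) \<partial>\<nu>) =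
        g (?r y) * ((exp (- (a / \<delta> - ?r y / \<delta>)\<^sup>2 / 2) + exp (- (a / \<delta> + ?r y / \<delta>)\<^sup>2 / 2)) / 2)"
      by (simp only: integral_mult_right_zero integral_cos_cos_\<nu>)
  qed simp
  also have "\<dots> = ((\<integral>y. g (?r y) * exp (- (a / \<delta> - ?r y / \<delta>)\<^sup>2 / 2) \<partial>\<nu>) +
      (\<integral>y. g (?r y) * exp (- (a / \<delta> + ?r y / \<delta>)\<^sup>2 / 2) \<partial>\<nu>)) / 2"
  proof -
    have "integrable \<nu> (\<lambda>y. g (?r y) * exp (- (a / \<delta> + s * ?r y / \<delta>)\<^sup>2 / 2))" for s
    proof (rule integrable_\<nu>_bounded(1)[where C = "g 0"])
      show "\<bar>g (?r y) * exp (- (a / \<delta> + s * ?r y / \<delta>)\<^sup>2 / 2)\<bar> \<le> g 0" for y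
        using g_exp_le[of "(a / \<delta> + s * ?r y / \<delta>)\<^sup>2 / 2" "?r y"] by simp
    qed measurable
    from this[of 1] this[of "-1"] show ?thesis by (simp add: distrib_left)
  qed
  also have "(\<integral>y. g (?r y) * exp (- (a / \<delta> + ?r y / \<delta>)\<^sup>2 / 2) \<partial>\<nu>) =
      (\<integral>y. g (?r (- y)) * exp (- (a / \<delta> + ?r (- y) / \<delta>)\<^sup>2 / 2) \<partial>\<nu>)"
    by (rule integral_\<nu>_uminus[symmetric]) measurable
  also have "\<dots> = (\<integral>y. g (?r y) * exp (- (a / \<delta> - ?r y / \<delta>)\<^sup>2 / 2) \<partial>\<nu>)"
    using even by simp
  finally have "(\<integral>z. cos (a * (z / \<delta>)) * K \<delta> (z / \<delta>) \<partial>\<nu>) =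
      (\<integral>y. g (?r y) * exp (- (a / \<delta> - ?r y / \<delta>)\<^sup>2 / 2) \<partial>\<nu>)" by simp
  also have "\<dots> = (\<integral>y. g (?r y) * exp (- (?r y - a)\<^sup>2 / (2 * \<delta>\<^sup>2)) \<partial>\<nu>)"
  proof -
    have "- (a / \<delta> - r / \<delta>)\<^sup>2 / 2 = - (r - a)\<^sup>2 / (2 * \<delta>\<^sup>2)" for r
      by (simp add: power2_commute[of r a] power_divide flip: diff_divide_distrib)
    then show ?thesis by (simp only:)
  qed
  also have "\<dots> = \<delta>\<^sup>2 / sqrt 2 * \<Theta> \<delta> a"
    unfolding \<Theta>_def by (rule integral_\<nu>_tilt[OF g_measurable \<delta>])
  finally show ?thesis .
qed

text \<open>Controls the correction term of \<open>K_pos\<close>. It carries the same factor as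
  \<open>integral_cos_K\<close>, and this factor cancels in \<open>I_bound\<close>.\<close>

lemma integral_exp_le:
  assumes \<delta>: "0 < \<delta>"
  shows "(\<integral>z. exp (- (z / \<delta> / \<delta>)\<^sup>2) \<partial>\<nu>) \<le> \<delta>\<^sup>2 / sqrt 2"
proof -
  have "(\<integral>z. exp (- (z / \<delta> / \<delta>)\<^sup>2) \<partial>\<nu>) = (\<integral>z. 1 * exp (- (sqrt 2 * z / \<delta> - 0)\<^sup>2 / (2 * \<delta>\<^sup>2)) \<partial>\<nu>)"
    by (simp add: power_divide power_mult_distrib)
  also have "\<dots> = \<delta>\<^sup>2 / sqrt 2 * (\<integral>y. 1 * exp (- ((0 + \<delta> * y)\<^sup>2 * \<delta>\<^sup>2 / 4)) \<partial>\<nu>)"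
    by (rule integral_\<nu>_tilt[OF _ \<delta>]) simp
  also have "\<dots> \<le> \<delta>\<^sup>2 / sqrt 2 * 1"
    by (intro mult_left_mono order_trans[OF abs_ge_self \<nu>.abs_expectation_le]) auto
  finally show ?thesis by simp
qed

text \<open>For \<open>h = g\<close>, d'Alembert's formula makes this the inner product of the
  averages of wave solutions over \<alpha> and \<beta>.\<close>

definition I :: "real measure \<Rightarrow> real measure \<Rightarrow> (real \<Rightarrow> real) \<Rightarrow> real" where
  "I \<alpha> \<beta> h = (\<integral>t. (\<integral>t'. (h (t + t') + h (t - t')) / 2 \<partial>\<beta>) \<partial>\<alpha>)"

definition m :: "real measure \<Rightarrow> real \<Rightarrow> real" where
  "m \<alpha> l = (\<integral>t. cos (l * t) \<partial>\<alpha>)"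

lemma m_le: "prob_space \<alpha> \<Longrightarrow> \<bar>m \<alpha> l\<bar> \<le> 1"
  unfolding m_def by (rule prob_space.abs_expectation_le) auto

lemma m_measurable:
  assumes "prob_space \<alpha>" and [measurable_cong]: "sets \<alpha> = sets borel"
  shows "m \<alpha> \<in> borel_measurable borel"
proof -
  interpret prob_space \<alpha> by fact
  show ?thesis unfolding m_def[abs_def] by measurable
qed

text \<open>A Parseval identity: the two cosine transforms are unfolded into a double integral of
  products of cosines, and \<open>integral_cos_K\<close> is applied at t + t' and t - t'.\<close>

lemma integral_m_m_K:
  assumes \<delta>: "0 < \<delta>" and \<alpha>: "prob_space \<alpha>" and \<beta>: "prob_space \<beta>"
    and [measurable_cong]: "sets \<alpha> = sets borel" "sets \<beta> = sets borel"
  shows "(\<integral>z. m \<alpha> (z / \<delta>) * m \<beta> (z / \<delta>) * K \<delta> (z / \<delta>) \<partial>\<nu>) = \<delta>\<^sup>2 / sqrt 2 * I \<alpha> \<beta> (\<Theta> \<delta>)"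
proof -
  note [measurable] = m_measurable[OF \<beta> assms(5)]
  have cK: "\<bar>cos p * (cos q * K \<delta> l)\<bar> \<le> g 0" for p q l
  proof -
    have "\<bar>cos p\<bar> * (\<bar>cos q\<bar> * \<bar>K \<delta> l\<bar>) \<le> 1 * (1 * g 0)"
      by (intro mult_mono K_le abs_cos_le_one) (auto simp: g0)
    then show ?thesis by (simp add: abs_mult)
  qed
  have "(\<integral>z. m \<alpha> (z / \<delta>) * m \<beta> (z / \<delta>) * K \<delta> (z / \<delta>) \<partial>\<nu>) =
      (\<integral>z. (\<integral>t. cos (z / \<delta> * t) * (m \<beta> (z / \<delta>) * K \<delta> (z / \<delta>)) \<partial>\<alpha>) \<partial>\<nu>)"
    by (simp add: m_def[of \<alpha>] mult.assoc)
  also have "\<dots> = (\<integral>t. (\<integral>z. cos (z / \<delta> * t) * (m \<beta> (z / \<delta>) * K \<delta> (z / \<delta>)) \<partial>\<nu>) \<partial>\<alpha>)"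
  proof (rule prob_integral_swap[OF \<nu>.prob_space_axioms \<alpha>, where C = "g 0"])
    fix z t
    have "\<bar>cos (z / \<delta> * t)\<bar> * (\<bar>m \<beta> (z / \<delta>)\<bar> * \<bar>K \<delta> (z / \<delta>)\<bar>) \<le> 1 * (1 * g 0)"
      by (intro mult_mono K_le abs_cos_le_one m_le \<beta>) (auto simp: g0)
    then show "\<bar>cos (z / \<delta> * t) * (m \<beta> (z / \<delta>) * K \<delta> (z / \<delta>))\<bar> \<le> g 0" by (simp add: abs_mult)
  qed measurable
  also have "\<dots> = (\<integral>t. (\<integral>t'. \<delta>\<^sup>2 / sqrt 2 * ((\<Theta> \<delta> (t + t') + \<Theta> \<delta> (t - t')) / 2) \<partial>\<beta>) \<partial>\<alpha>)"
  proof (rule Bochner_Integration.integral_cong)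
    fix t
    have "(\<integral>z. cos (z / \<delta> * t) * (m \<beta> (z / \<delta>) * K \<delta> (z / \<delta>)) \<partial>\<nu>) =
        (\<integral>z. (\<integral>t'. cos (z / \<delta> * t) * (cos (z / \<delta> * t') * K \<delta> (z / \<delta>)) \<partial>\<beta>) \<partial>\<nu>)"
      by (simp add: m_def)
    also have "\<dots> = (\<integral>t'. (\<integral>z. cos (z / \<delta> * t) * (cos (z / \<delta> * t') * K \<delta> (z / \<delta>)) \<partial>\<nu>) \<partial>\<beta>)"
      by (rule prob_integral_swap[OF \<nu>.prob_space_axioms \<beta> _ cK]) measurable
    also have "\<dots> = (\<integral>t'. \<delta>\<^sup>2 / sqrt 2 * ((\<Theta> \<delta> (t + t') + \<Theta> \<delta> (t - t')) / 2) \<partial>\<beta>)"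
    proof (rule Bochner_Integration.integral_cong)
      fix t'
      have i: "integrable \<nu> (\<lambda>z. cos (a * (z / \<delta>)) * K \<delta> (z / \<delta>))" for a
      proof (rule integrable_\<nu>_bounded(1)[where C = "g 0"])
        show "\<bar>cos (a * (z / \<delta>)) * K \<delta> (z / \<delta>)\<bar> \<le> g 0" for z
          using cK[of 0 "a * (z / \<delta>)" "z / \<delta>"] by simp
      qed measurable
      have "cos (z / \<delta> * t) * (cos (z / \<delta> * t') * K \<delta> (z / \<delta>)) =
          (cos ((t + t') * (z / \<delta>)) * K \<delta> (z / \<delta>) + cos ((t - t') * (z / \<delta>)) * K \<delta> (z / \<delta>)) / 2" for z
      proof -
        have "cos (z / \<delta> * t) * cos (z / \<delta> * t') = (cos ((t + t') * (z / \<delta>)) + cos ((t - t') * (z / \<delta>))) / 2"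
          unfolding cos_times_cos left_diff_distrib distrib_right by (simp add: mult.commute)
        then show ?thesis by (simp only: mult.assoc[symmetric] distrib_right times_divide_eq_left)
      qed
      then have "(\<integral>z. cos (z / \<delta> * t) * (cos (z / \<delta> * t') * K \<delta> (z / \<delta>)) \<partial>\<nu>) =
          ((\<integral>z. cos ((t + t') * (z / \<delta>)) * K \<delta> (z / \<delta>) \<partial>\<nu>) + (\<integral>z. cos ((t - t') * (z / \<delta>)) * K \<delta> (z / \<delta>) \<partial>\<nu>)) / 2"
        by (simp only: integral_divide_zero Bochner_Integration.integral_add[OF i i])
      then show "(\<integral>z. cos (z / \<delta> * t) * (cos (z / \<delta> * t') * K \<delta> (z / \<delta>)) \<partial>\<nu>) =
          \<delta>\<^sup>2 / sqrt 2 * ((\<Theta> \<delta> (t + t') + \<Theta> \<delta> (t - t')) / 2)"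
        unfolding integral_cos_K[OF \<delta>] by (simp add: distrib_left)
    qed simp
    finally show "(\<integral>z. cos (z / \<delta> * t) * (m \<beta> (z / \<delta>) * K \<delta> (z / \<delta>)) \<partial>\<nu>) =
        (\<integral>t'. \<delta>\<^sup>2 / sqrt 2 * ((\<Theta> \<delta> (t + t') + \<Theta> \<delta> (t - t')) / 2) \<partial>\<beta>)" .
  qed simp
  also have "\<dots> = \<delta>\<^sup>2 / sqrt 2 * I \<alpha> \<beta> (\<Theta> \<delta>)"
    unfolding I_def by (simp only: integral_mult_right_zero)
  finally show ?thesis .
qed

lemma \<Theta>_tendsto:
  assumes "d \<longlonglongrightarrow> 0"
  shows "(\<lambda>n. \<Theta> (d n) a) \<longlonglongrightarrow> g a"
proof -
  have "(\<lambda>n. \<integral>y. g (a + d n * y) * exp (- ((a + d n * y)\<^sup>2 * (d n)\<^sup>2 / 4)) \<partial>\<nu>) \<longlonglongrightarrow> (\<integral>y. g a \<partial>\<nu>)"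
  proof (rule integral_dominated_convergence[where w = "\<lambda>_. g 0"])
    show "AE y in \<nu>. (\<lambda>n. g (a + d n * y) * exp (- ((a + d n * y)\<^sup>2 * (d n)\<^sup>2 / 4))) \<longlonglongrightarrow> g a"
    proof (intro AE_I2)
      fix y
      have 1: "(\<lambda>n. a + d n * y) \<longlonglongrightarrow> a + 0 * y" by (intro tendsto_intros assms)
      have "isCont g (a + 0 * y)" using cont by (simp add: continuous_on_eq_continuous_at)
      then have "(\<lambda>n. g (a + d n * y)) \<longlonglongrightarrow> g (a + 0 * y)" using 1 by (rule isCont_tendsto_compose)
      then have "(\<lambda>n. g (a + d n * y) * exp (- ((a + d n * y)\<^sup>2 * (d n)\<^sup>2 / 4))) \<longlonglongrightarrow>
          g (a + 0 * y) * exp (- ((a + 0 * y)\<^sup>2 * 0\<^sup>2 / 4))"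
        by (intro tendsto_mult tendsto_exp tendsto_minus tendsto_divide tendsto_power 1 assms tendsto_const) auto
      then show "(\<lambda>n. g (a + d n * y) * exp (- ((a + d n * y)\<^sup>2 * (d n)\<^sup>2 / 4))) \<longlonglongrightarrow> g a" by simp
    qed
    show "AE y in \<nu>. norm (g (a + d n * y) * exp (- ((a + d n * y)\<^sup>2 * (d n)\<^sup>2 / 4))) \<le> g 0" for n
      unfolding real_norm_def by (intro AE_I2 g_exp_le) simp
    show "integrable \<nu> (\<lambda>_. g 0)" by simp
  qed measurable
  then show ?thesis by (simp add: \<Theta>_def)
qed

lemma I_tendsto:
  assumes d: "d \<longlonglongrightarrow> 0" and \<alpha>: "prob_space \<alpha>" and \<beta>: "prob_space \<beta>"
    and [measurable_cong]: "sets \<alpha> = sets borel" "sets \<beta> = sets borel"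
  shows "(\<lambda>n. I \<alpha> \<beta> (\<Theta> (d n))) \<longlonglongrightarrow> I \<alpha> \<beta> g"
proof -
  interpret A: prob_space \<alpha> by (rule \<alpha>)
  interpret B: prob_space \<beta> by (rule \<beta>)
  have b: "\<bar>(\<Theta> \<delta> p + \<Theta> \<delta> q) / 2\<bar> \<le> g 0" for \<delta> p q
    using \<Theta>_le[of \<delta> p] \<Theta>_le[of \<delta> q] by (simp add: abs_le_iff)
  show ?thesis
    unfolding I_def
  proof (rule integral_dominated_convergence[where w = "\<lambda>_. g 0"])
    show "AE t in \<alpha>. norm (\<integral>t'. (\<Theta> (d n) (t + t') + \<Theta> (d n) (t - t')) / 2 \<partial>\<beta>) \<le> g 0" for n
      unfolding real_norm_def by (intro AE_I2 B.abs_expectation_le b)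
    show "AE t in \<alpha>. (\<lambda>n. \<integral>t'. (\<Theta> (d n) (t + t') + \<Theta> (d n) (t - t')) / 2 \<partial>\<beta>) \<longlonglongrightarrow>
        (\<integral>t'. (g (t + t') + g (t - t')) / 2 \<partial>\<beta>)"
    proof (intro AE_I2 integral_dominated_convergence[where w = "\<lambda>_. g 0"])
      fix t t' n
      show "norm ((\<Theta> (d n) (t + t') + \<Theta> (d n) (t - t')) / 2) \<le> g 0"
        unfolding real_norm_def by (rule b)
      show "(\<lambda>n. (\<Theta> (d n) (t + t') + \<Theta> (d n) (t - t')) / 2) \<longlonglongrightarrow> (g (t + t') + g (t - t')) / 2"
        by (intro tendsto_intros \<Theta>_tendsto d) auto
      show "(\<lambda>t'. (g (t + t') + g (t - t')) / 2) \<in> borel_measurable \<beta>" by measurable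
      show "(\<lambda>t'. (\<Theta> (d n) (t + t') + \<Theta> (d n) (t - t')) / 2) \<in> borel_measurable \<beta>" by measurable
      show "integrable \<beta> (\<lambda>_. g 0)" by simp
    qed
    show "(\<lambda>t. \<integral>t'. (g (t + t') + g (t - t')) / 2 \<partial>\<beta>) \<in> borel_measurable \<alpha>" by measurable
    show "(\<lambda>t. \<integral>t'. (\<Theta> (d n) (t + t') + \<Theta> (d n) (t - t')) / 2 \<partial>\<beta>) \<in> borel_measurable \<alpha>" for n by measurable
    show "integrable \<alpha> (\<lambda>_. g 0)" by simp
  qed
qed

text \<open>By \<open>integral_m_m_K\<close> the quadratic form is an integral of
  \<open>(m \<alpha> - m \<beta>)\<^sup>2\<close> against \<open>K\<close>. Replacing the square by
  its bound calls for a nonnegative weight, so the correction term of \<open>K_pos\<close> is added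
  first. In the limit of small \<delta>, \<open>K\<close> and the correction contribute at most
  \<open>g 0\<close> each.\<close>

lemma I_bound:
  assumes \<alpha>: "prob_space \<alpha>" and \<beta>: "prob_space \<beta>" and s: "sets \<alpha> = sets borel" "sets \<beta> = sets borel"
    and M: "\<And>l. \<bar>m \<alpha> l - m \<beta> l\<bar> \<le> M"
  shows "I \<alpha> \<alpha> g - 2 * I \<alpha> \<beta> g + I \<beta> \<beta> g \<le> 2 * M\<^sup>2 * g 0"
proof -
  note [measurable] = m_measurable[OF \<alpha> s(1)] m_measurable[OF \<beta> s(2)]
  have step: "I \<alpha> \<alpha> (\<Theta> \<delta>) - 2 * I \<alpha> \<beta> (\<Theta> \<delta>) + I \<beta> \<beta> (\<Theta> \<delta>) \<le> M\<^sup>2 * (\<Theta> \<delta> 0 + g 0)"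
    if \<delta>: "0 < \<delta>" for \<delta>
  proof -
    let ?e = "\<lambda>z. exp (- (z / \<delta> / \<delta>)\<^sup>2) * K \<delta> 0"
    let ?k = "\<lambda>z. K \<delta> (z / \<delta>) + ?e z"
    have mK: "\<bar>m \<gamma> (z / \<delta>) * m \<gamma>' (z / \<delta>) * K \<delta> (z / \<delta>)\<bar> \<le> 1 * 1 * g 0"
      if "prob_space \<gamma>" "prob_space \<gamma>'" for \<gamma> \<gamma>' z
      unfolding abs_mult by (intro mult_mono m_le that K_le) (auto simp: g0)
    have i: "integrable \<nu> (\<lambda>z. m \<alpha> (z / \<delta>) * m \<alpha> (z / \<delta>) * K \<delta> (z / \<delta>))"
      "integrable \<nu> (\<lambda>z. m \<alpha> (z / \<delta>) * m \<beta> (z / \<delta>) * K \<delta> (z / \<delta>))"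
      "integrable \<nu> (\<lambda>z. m \<beta> (z / \<delta>) * m \<beta> (z / \<delta>) * K \<delta> (z / \<delta>))"
      using mK[OF \<alpha> \<alpha>] mK[OF \<alpha> \<beta>] mK[OF \<beta> \<beta>]
      by (auto intro!: integrable_\<nu>_bounded(1)[where C = "1 * 1 * g 0"])
    have iK: "integrable \<nu> (\<lambda>z. K \<delta> (z / \<delta>))"
      by (rule integrable_\<nu>_bounded(1)[OF _ K_le]) measurable
    have ie: "integrable \<nu> (\<lambda>z. exp (- (z / \<delta> / \<delta>)\<^sup>2))"
      by (rule integrable_\<nu>_bounded(1)[where C = 1]) auto
    have "\<delta>\<^sup>2 / sqrt 2 * (I \<alpha> \<alpha> (\<Theta> \<delta>) - 2 * I \<alpha> \<beta> (\<Theta> \<delta>) + I \<beta> \<beta> (\<Theta> \<delta>)) =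
        (\<integral>z. m \<alpha> (z / \<delta>) * m \<alpha> (z / \<delta>) * K \<delta> (z / \<delta>) \<partial>\<nu>)
        - 2 * (\<integral>z. m \<alpha> (z / \<delta>) * m \<beta> (z / \<delta>) * K \<delta> (z / \<delta>) \<partial>\<nu>)
        + (\<integral>z. m \<beta> (z / \<delta>) * m \<beta> (z / \<delta>) * K \<delta> (z / \<delta>) \<partial>\<nu>)"
      unfolding integral_m_m_K[OF \<delta> \<alpha> \<alpha> s(1) s(1)] integral_m_m_K[OF \<delta> \<alpha> \<beta> s] integral_m_m_K[OF \<delta> \<beta> \<beta> s(2) s(2)]
      by (simp only: distrib_left right_diff_distrib mult.left_commute)
    also have "\<dots> = (\<integral>z. m \<alpha> (z / \<delta>) * m \<alpha> (z / \<delta>) * K \<delta> (z / \<delta>)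
        - 2 * (m \<alpha> (z / \<delta>) * m \<beta> (z / \<delta>) * K \<delta> (z / \<delta>))
        + m \<beta> (z / \<delta>) * m \<beta> (z / \<delta>) * K \<delta> (z / \<delta>) \<partial>\<nu>)"
      using i by simp
    also have "\<dots> \<le> (\<integral>z. M\<^sup>2 * ?k z \<partial>\<nu>)"
    proof (rule integral_mono)
      fix z
      have e0: "0 \<le> ?e z" using K0[OF \<delta>] by simp
      have k0: "0 \<le> ?k z" by (rule K_pos[OF \<delta>])
      let ?d = "m \<alpha> (z / \<delta>) - m \<beta> (z / \<delta>)"
      have "?d\<^sup>2 \<le> M\<^sup>2" using power_mono[OF M[of "z / \<delta>"] abs_ge_zero, of 2] by simp
      then have "?d\<^sup>2 * ?k z \<le> M\<^sup>2 * ?k z" using k0 by (rule mult_right_mono)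
      moreover have "?d\<^sup>2 * K \<delta> (z / \<delta>) \<le> ?d\<^sup>2 * ?k z" using e0 by (intro mult_left_mono) auto
      moreover have "m \<alpha> (z / \<delta>) * m \<alpha> (z / \<delta>) * K \<delta> (z / \<delta>)
        - 2 * (m \<alpha> (z / \<delta>) * m \<beta> (z / \<delta>) * K \<delta> (z / \<delta>))
        + m \<beta> (z / \<delta>) * m \<beta> (z / \<delta>) * K \<delta> (z / \<delta>) = ?d\<^sup>2 * K \<delta> (z / \<delta>)"
        by (simp add: power2_eq_square algebra_simps)
      ultimately show "m \<alpha> (z / \<delta>) * m \<alpha> (z / \<delta>) * K \<delta> (z / \<delta>)
        - 2 * (m \<alpha> (z / \<delta>) * m \<beta> (z / \<delta>) * K \<delta> (z / \<delta>))
        + m \<beta> (z / \<delta>) * m \<beta> (z / \<delta>) * K \<delta> (z / \<delta>) \<le> M\<^sup>2 * ?k z" by (simp only:)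
    qed (use i iK ie in auto)
    also have "\<dots> = M\<^sup>2 * ((\<integral>z. cos (0 * (z / \<delta>)) * K \<delta> (z / \<delta>) \<partial>\<nu>) + (\<integral>z. exp (- (z / \<delta> / \<delta>)\<^sup>2) \<partial>\<nu>) * K \<delta> 0)"
      using iK ie by simp
    also have "\<dots> \<le> M\<^sup>2 * (\<delta>\<^sup>2 / sqrt 2 * \<Theta> \<delta> 0 + \<delta>\<^sup>2 / sqrt 2 * g 0)"
      unfolding integral_cos_K[OF \<delta>]
      using K0[OF \<delta>] K_le[of \<delta> 0] by (intro mult_left_mono add_left_mono mult_mono integral_exp_le \<delta>) auto
    also have "\<dots> = \<delta>\<^sup>2 / sqrt 2 * (M\<^sup>2 * (\<Theta> \<delta> 0 + g 0))"
      by (simp only: distrib_left mult.left_commute)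
    finally show ?thesis using \<delta> by (simp only: mult_le_cancel_left_pos divide_pos_pos zero_less_power real_sqrt_gt_0_iff zero_less_numeral)
  qed
  let ?d = "\<lambda>n. 1 / real (Suc n)"
  have d: "?d \<longlonglongrightarrow> 0" by (rule LIMSEQ_Suc[OF lim_1_over_n])
  have "(\<lambda>n. I \<alpha> \<alpha> (\<Theta> (?d n)) - 2 * I \<alpha> \<beta> (\<Theta> (?d n)) + I \<beta> \<beta> (\<Theta> (?d n))) \<longlonglongrightarrow>
      I \<alpha> \<alpha> g - 2 * I \<alpha> \<beta> g + I \<beta> \<beta> g"
    by (intro tendsto_intros I_tendsto d \<alpha> \<beta> s)
  moreover have "(\<lambda>n. M\<^sup>2 * (\<Theta> (?d n) 0 + g 0)) \<longlonglongrightarrow> M\<^sup>2 * (g 0 + g 0)"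
    by (intro tendsto_intros \<Theta>_tendsto d)
  ultimately have "I \<alpha> \<alpha> g - 2 * I \<alpha> \<beta> g + I \<beta> \<beta> g \<le> M\<^sup>2 * (g 0 + g 0)"
    by (rule LIMSEQ_le) (auto intro!: exI[of _ 0] step)
  then show ?thesis by (simp add: algebra_simps)
qed

end

section \<open>The telegraph equation\<close>

lemma nonincreasing_on_atLeast_0:
  fixes f :: "real \<Rightarrow> real"
  assumes "0 \<le> T"
    and d: "\<And>t. 0 \<le> t \<Longrightarrow> (f has_real_derivative f' t) (at t within {0..})"
    and n: "\<And>t. 0 \<le> t \<Longrightarrow> f' t \<le> 0"
  shows "f T \<le> f 0"
proof -
  have c: "continuous_on {0..T} f"
    by (rule continuous_on_subset[of "{0..}"])
      (use d in \<open>auto simp: continuous_on_eq_continuous_within intro: DERIV_continuous\<close>)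
  have "\<exists>y. DERIV f x :> y \<and> y \<le> 0" if "0 < x" for x
    using d[of x] n[of x] that at_within_interior[of x "{0..}"] by auto
  then show ?thesis
    using DERIV_nonpos_imp_decreasing_open[OF \<open>0 \<le> T\<close> _ c] by blast
qed

lemma mult_exp_neg_le: "x * exp (- (x::real)) \<le> 1"
proof -
  have "x \<le> exp x" using exp_ge_add_one_self[of x] by linarith
  then show ?thesis by (simp add: exp_minus divide_simps)
qed

lemma square_mult_exp_neg_le: "0 \<le> x \<Longrightarrow> x\<^sup>2 * exp (- (x::real)) \<le> 2"
proof -
  assume "0 \<le> x"
  then have "x\<^sup>2 \<le> 2 * exp x" using exp_lower_Taylor_quadratic[of x] by simp
  then show ?thesis by (simp add: exp_minus divide_simps)
qed

text \<open>The damped oscillator C'' + 2 C' + k^2 C = 0 with C 0 = 1 and C' 0 = 0, in units of time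
  in which the Poisson rate is 1. For small \<open>k\<close> it relaxes to C' = - k^2 C / 2, whose
  solution is the Gaussian transform.\<close>

locale telegraph =
  fixes C S :: "real \<Rightarrow> real" and k :: real
  assumes k: "0 \<le> k"
    and C': "\<And>t. 0 \<le> t \<Longrightarrow> (C has_real_derivative - k * S t) (at t within {0..})"
    and S': "\<And>t. 0 \<le> t \<Longrightarrow> (S has_real_derivative k * C t - 2 * S t) (at t within {0..})"
    and C0: "C 0 = 1" and S0: "S 0 = 0"
begin

text \<open>
  The Lyapunov function is \<open>C\<^sup>2 + S\<^sup>2 - b C S\<close>, used with \<open>b = 1 / k\<close> for \<open>k \<ge> 1\<close> and with \<open>b = k\<close> for \<open>k \<le> 1\<close>.
\<close>

lemma energy_bound:
  assumes "0 \<le> T" "\<bar>b\<bar> \<le> 1"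
    and neg: "\<And>t. 0 \<le> t \<Longrightarrow>
      (r - b * k) * (C t)\<^sup>2 + (r - 4 + b * k) * (S t)\<^sup>2 + (2 * b - r * b) * (C t * S t) \<le> 0"
  shows "\<bar>C T\<bar> \<le> 3 / 2 * exp (- r * T / 2)" "\<bar>S T\<bar> \<le> 3 / 2 * exp (- r * T / 2)"
proof -
  define E where "E t = (C t)\<^sup>2 + (S t)\<^sup>2 - b * (C t * S t)" for t
  \<comment> \<open>The hypothesis \<open>neg\<close> says that E' + r E is nonpositive.\<close>
  have "exp (r * T) * E T \<le> exp (r * 0) * E 0"
  proof (rule nonincreasing_on_atLeast_0[OF \<open>0 \<le> T\<close>])
    fix t :: real assume t: "0 \<le> t"
    show "((\<lambda>t. exp (r * t) * E t) has_real_derivative exp (r * t) *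
       ((r - b * k) * (C t)\<^sup>2 + (r - 4 + b * k) * (S t)\<^sup>2 + (2 * b - r * b) * (C t * S t)))
       (at t within {0..})"
      unfolding E_def
      by (rule derivative_eq_intros C'[OF t] S'[OF t] refl | simp)+
        (simp add: algebra_simps power2_eq_square)
    show "exp (r * t) *
       ((r - b * k) * (C t)\<^sup>2 + (r - 4 + b * k) * (S t)\<^sup>2 + (2 * b - r * b) * (C t * S t)) \<le> 0"
      using neg[OF t] by (simp add: mult_le_0_iff)
  qed
  then have "E T \<le> exp (- r * T)"
    by (simp add: E_def C0 S0 exp_minus divide_simps mult.commute)
  moreover have "\<bar>b * (C T * S T)\<bar> \<le> \<bar>C T * S T\<bar>"
    using assms(2) by (simp add: abs_mult mult_left_le_one_le)
  moreover have "2 * \<bar>C T * S T\<bar> \<le> (C T)\<^sup>2 + (S T)\<^sup>2"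
    using sum_squares_bound[of "\<bar>C T\<bar>" "\<bar>S T\<bar>"] by (simp add: abs_mult)
  ultimately have "(C T)\<^sup>2 + (S T)\<^sup>2 \<le> 2 * exp (- r * T)"
    unfolding E_def by (simp add: abs_if split: if_splits)
  \<comment> \<open>3 / 2 is an upper bound for sqrt 2.\<close>
  also have "\<dots> \<le> (3 / 2 * exp (- r * T / 2))\<^sup>2"
    by (simp add: power2_eq_square mult.commute flip: exp_add)
  finally have *: "(C T)\<^sup>2 + (S T)\<^sup>2 \<le> (3 / 2 * exp (- r * T / 2))\<^sup>2" .
  have "0 \<le> (C T)\<^sup>2" "0 \<le> (S T)\<^sup>2" by simp_all
  with * have "\<bar>C T\<bar>\<^sup>2 \<le> (3 / 2 * exp (- r * T / 2))\<^sup>2" "\<bar>S T\<bar>\<^sup>2 \<le> (3 / 2 * exp (- r * T / 2))\<^sup>2"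
    unfolding power2_abs by linarith+
  then show "\<bar>C T\<bar> \<le> 3 / 2 * exp (- r * T / 2)" "\<bar>S T\<bar> \<le> 3 / 2 * exp (- r * T / 2)"
    using power2_le_imp_le[of _ "3 / 2 * exp (- r * T / 2)"] by simp_all
qed

lemma C_decay_large:
  assumes "1 \<le> k" "0 \<le> T"
  shows "\<bar>C T\<bar> \<le> 3 / 2 * exp (- T / 6)"
proof -
  \<comment> \<open>The rate 1 / 3 leaves the diagonal coefficients -2/3 and -8/3; they dominate a
    cross term of coefficient at most 5/3 because 4 |C S| <= C^2 + 4 S^2.\<close>
  have "\<bar>C T\<bar> \<le> 3 / 2 * exp (- (1 / 3) * T / 2)"
  proof (rule energy_bound(1)[OF assms(2), of "1 / k"])
    fix t
    let ?b = "1 / k"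
    have b: "0 \<le> ?b" "?b \<le> 1" "?b * k = 1" using assms(1) by auto
    have "(5 / 3 * ?b) * (C t * S t) \<le> \<bar>(5 / 3 * ?b) * (C t * S t)\<bar>" by (rule abs_ge_self)
    also have "\<dots> = 5 / 3 * (?b * \<bar>C t * S t\<bar>)" using b(1) by (simp add: abs_mult)
    also have "\<dots> \<le> 5 / 3 * \<bar>C t * S t\<bar>"
      by (intro mult_left_mono mult_left_le_one_le) (use b in auto)
    also have "\<dots> \<le> 2 / 3 * (C t)\<^sup>2 + 8 / 3 * (S t)\<^sup>2"
    proof -
      have "0 \<le> (\<bar>C t\<bar> - 2 * \<bar>S t\<bar>)\<^sup>2" by simp
      then have "4 * \<bar>C t * S t\<bar> \<le> (C t)\<^sup>2 + 4 * (S t)\<^sup>2"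
        by (simp add: power2_diff power_mult_distrib abs_mult)
      then show ?thesis using abs_ge_zero[of "C t * S t"] by linarith
    qed
    finally show "(1 / 3 - 1 / k * k) * (C t)\<^sup>2 + (1 / 3 - 4 + 1 / k * k) * (S t)\<^sup>2 +
         (2 * (1 / k) - 1 / 3 * (1 / k)) * (C t * S t) \<le> 0"
      using b(3) by (simp add: algebra_simps)
  qed (use assms in auto)
  then show ?thesis by simp
qed

lemma small_decay:
  assumes "k \<le> 1" "0 \<le> T"
  shows "\<bar>C T\<bar> \<le> 3 / 2 * exp (- (k\<^sup>2 / 6) * T)" "\<bar>S T\<bar> \<le> 3 / 2 * exp (- (k\<^sup>2 / 6) * T)"
proof -
  \<comment> \<open>Here b = k and the rate is k^2 / 3. The inequality between cross term and
    squares is applied to k C and S, and the remaining multiple of k^2 S^2 is absorbed using k <=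
    1.\<close>
  have "(k\<^sup>2 / 3 - k * k) * (C t)\<^sup>2 + (k\<^sup>2 / 3 - 4 + k * k) * (S t)\<^sup>2 +
         (2 * k - k\<^sup>2 / 3 * k) * (C t * S t) \<le> 0" for t
  proof -
    have k2: "k\<^sup>2 \<le> 1" using k assms(1) by (simp add: power_le_one)
    have "(2 - k\<^sup>2 / 3) * (k * C t * S t) \<le> \<bar>(2 - k\<^sup>2 / 3) * (k * C t * S t)\<bar>" by (rule abs_ge_self)
    also have "\<dots> = \<bar>2 - k\<^sup>2 / 3\<bar> * \<bar>k * C t * S t\<bar>" by (simp add: abs_mult)
    also have "\<dots> \<le> 2 * \<bar>k * C t * S t\<bar>"
      by (intro mult_right_mono) (use k2 in \<open>auto simp: abs_if\<close>)
    also have "\<dots> \<le> 2 / 3 * (k * C t)\<^sup>2 + 8 / 3 * (S t)\<^sup>2"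
    proof -
      have "0 \<le> (\<bar>k * C t\<bar> - 2 * \<bar>S t\<bar>)\<^sup>2" by simp
      then have "4 * \<bar>k * C t * S t\<bar> \<le> (k * C t)\<^sup>2 + 4 * (S t)\<^sup>2"
        by (simp add: power2_diff power_mult_distrib abs_mult)
      then show ?thesis using abs_ge_zero[of "k * C t * S t"] by linarith
    qed
    finally have 1: "(2 - k\<^sup>2 / 3) * (k * C t * S t) \<le> 2 / 3 * (k * C t)\<^sup>2 + 8 / 3 * (S t)\<^sup>2" .
    have "4 / 3 * k\<^sup>2 * (S t)\<^sup>2 \<le> 4 / 3 * (S t)\<^sup>2"
      using k2 by (simp add: mult_left_le_one_le)
    with 1 show ?thesis by (simp add: algebra_simps power2_eq_square)
  qed
  then show "\<bar>C T\<bar> \<le> 3 / 2 * exp (- (k\<^sup>2 / 6) * T)" "\<bar>S T\<bar> \<le> 3 / 2 * exp (- (k\<^sup>2 / 6) * T)"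
    using energy_bound[OF assms(2), of k "k\<^sup>2 / 3"] k assms(1) by (auto simp: algebra_simps)
qed

text \<open>Gains a factor \<open>k\<close> over \<open>small_decay\<close>. The function
  \<open>k * exp (- (k\<^sup>2 / 6) * t)\<close> is a supersolution of S' = k C - 2 S, because the
  constant 3 / 2 in the bound for \<open>C\<close> is below 2 - k^2 / 6. The sign \<epsilon> covers
  both \<open>S\<close> and its negative.\<close>

lemma S_decay:
  assumes "k \<le> 1" "0 \<le> T" and \<epsilon>: "\<epsilon> = 1 \<or> \<epsilon> = -1"
  shows "\<epsilon> * S T \<le> k * exp (- (k\<^sup>2 / 6) * T)"
proof -
  have k2: "k\<^sup>2 \<le> 1" using k assms(1) by (simp add: power_le_one)
  have "exp (2 * T) * (\<epsilon> * S T - k * exp (- (k\<^sup>2 / 6) * T)) \<le>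
    exp (2 * 0) * (\<epsilon> * S 0 - k * exp (- (k\<^sup>2 / 6) * 0))"
  proof (rule nonincreasing_on_atLeast_0[OF \<open>0 \<le> T\<close>])
    fix t :: real assume t: "0 \<le> t"
    let ?e = "exp (- (k\<^sup>2 / 6) * t)"
    show "((\<lambda>t. exp (2 * t) * (\<epsilon> * S t - k * exp (- (k\<^sup>2 / 6) * t))) has_real_derivative
      exp (2 * t) * (k * (\<epsilon> * C t - (2 - k\<^sup>2 / 6) * ?e))) (at t within {0..})"
      by (rule derivative_eq_intros S'[OF t] refl | simp)+
        (simp add: algebra_simps power2_eq_square)
    have "\<epsilon> * C t \<le> 3 / 2 * ?e"
      using small_decay(1)[OF assms(1) t] \<epsilon> by auto
    also have "\<dots> \<le> (2 - k\<^sup>2 / 6) * ?e"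
      by (rule mult_right_mono) (use k2 in auto)
    finally show "exp (2 * t) * (k * (\<epsilon> * C t - (2 - k\<^sup>2 / 6) * ?e)) \<le> 0"
      using k by (simp add: mult_le_0_iff zero_le_mult_iff)
  qed
  also have "\<dots> \<le> 0" using k S0 by simp
  finally show ?thesis by (simp add: mult_le_0_iff)
qed

text \<open>\<open>S - k C / 2\<close> is the deviation from the slow manifold on which \<open>C\<close> would solve the heat equation.\<close>

lemma Z_decay:
  assumes "k \<le> 1" "0 \<le> T" and \<epsilon>: "\<epsilon> = 1 \<or> \<epsilon> = -1"
  shows "\<epsilon> * (S T - k * C T / 2) \<le> k / 2 * exp (- 2 * T) + k ^ 3 / 2 * exp (- (k\<^sup>2 / 6) * T)"
proof -
  have k2: "k\<^sup>2 \<le> 1" using k assms(1) by (simp add: power_le_one)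
  \<comment> \<open>Z = S - k C / 2 satisfies Z' = - 2 Z + k^2 S / 2, with forcing of order k^3 by
    \<open>S_decay\<close>; the initial value - k / 2 produces the fast term exp (- 2 T).\<close>
  have "exp (2 * T) * (\<epsilon> * (S T - k * C T / 2) - k ^ 3 / 2 * exp (- (k\<^sup>2 / 6) * T)) \<le>
    exp (2 * 0) * (\<epsilon> * (S 0 - k * C 0 / 2) - k ^ 3 / 2 * exp (- (k\<^sup>2 / 6) * 0))"
  proof (rule nonincreasing_on_atLeast_0[OF \<open>0 \<le> T\<close>])
    fix t :: real assume t: "0 \<le> t"
    let ?e = "exp (- (k\<^sup>2 / 6) * t)"
    show "((\<lambda>t. exp (2 * t) * (\<epsilon> * (S t - k * C t / 2) - k ^ 3 / 2 * exp (- (k\<^sup>2 / 6) * t)))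
      has_real_derivative
      exp (2 * t) * (k\<^sup>2 / 2 * (\<epsilon> * S t - (2 * k - k ^ 3 / 6) * ?e))) (at t within {0..})"
      by (rule derivative_eq_intros S'[OF t] C'[OF t] refl | simp)+
        (simp add: algebra_simps power2_eq_square power3_eq_cube)
    have "k ^ 3 \<le> k"
      using k k2 by (simp add: power3_eq_cube power2_eq_square mult_left_le_one_le)
    then have "k * ?e \<le> (2 * k - k ^ 3 / 6) * ?e"
      using k by (intro mult_right_mono) auto
    then have "\<epsilon> * S t - (2 * k - k ^ 3 / 6) * ?e \<le> 0"
      using S_decay[OF assms(1) t \<epsilon>] by linarith
    then show "exp (2 * t) * (k\<^sup>2 / 2 * (\<epsilon> * S t - (2 * k - k ^ 3 / 6) * ?e)) \<le> 0"
      by (simp add: mult_le_0_iff)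
  qed
  also have "\<dots> \<le> k / 2"
  proof -
    have "0 \<le> k ^ 3" using k by simp
    then have "- (k ^ 3) \<le> 2 * k" using k by linarith
    then show ?thesis using k S0 C0 \<epsilon> by auto
  qed
  finally have "exp (- 2 * T) * (exp (2 * T) *
      (\<epsilon> * (S T - k * C T / 2) - k ^ 3 / 2 * exp (- (k\<^sup>2 / 6) * T))) \<le> exp (- 2 * T) * (k / 2)"
    by (intro mult_left_mono) auto
  then have "\<epsilon> * (S T - k * C T / 2) - k ^ 3 / 2 * exp (- (k\<^sup>2 / 6) * T) \<le> k / 2 * exp (- 2 * T)"
    by (simp add: mult.assoc[symmetric] mult.commute flip: exp_add)
  then show ?thesis by linarith
qed

text \<open>With Z = S - k C / 2 the equation for \<open>C\<close> reads C' = - k^2 C / 2 - k Z, so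
  the derivative of exp (k^2 t / 2) C is - k exp (k^2 t / 2) Z. Integrating \<open>Z_decay\<close>,
  the fast part contributes at most k^2 / 3 and the slow part at most k^4 / 2 times T exp (k^2 T /
  3).\<close>

lemma D_decay:
  assumes "k \<le> 1" "0 \<le> T" and \<epsilon>: "\<epsilon> = 1 \<or> \<epsilon> = -1"
  shows "\<epsilon> * (C T - exp (- (k\<^sup>2 / 2) * T)) \<le>
    k\<^sup>2 / 3 * exp (- (k\<^sup>2 / 2) * T) + k ^ 4 / 2 * T * exp (- (k\<^sup>2 / 6) * T)"
proof -
  have k2: "k\<^sup>2 \<le> 1" using k assms(1) by (simp add: power_le_one)
  let ?f = "\<lambda>t. \<epsilon> * (exp (k\<^sup>2 / 2 * t) * C t - 1) - k ^ 4 / 2 * t * exp (k\<^sup>2 / 3 * t)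
    + k\<^sup>2 / 3 * exp (- (3 / 2) * t)"
  have "?f T \<le> ?f 0"
  proof (rule nonincreasing_on_atLeast_0[OF \<open>0 \<le> T\<close>])
    fix t :: real assume t: "0 \<le> t"
    let ?d = "exp (k\<^sup>2 / 2 * t) * (k * (- \<epsilon> * (S t - k * C t / 2))) - k ^ 4 / 2 * exp (k\<^sup>2 / 3 * t)
      - k ^ 4 / 2 * t * (k\<^sup>2 / 3) * exp (k\<^sup>2 / 3 * t) - k\<^sup>2 / 2 * exp (- (3 / 2) * t)"
    show "(?f has_real_derivative ?d) (at t within {0..})"
      by (rule derivative_eq_intros C'[OF t] refl | simp)+
        (simp add: algebra_simps power2_eq_square)
    have "- \<epsilon> = 1 \<or> - \<epsilon> = -1" using \<epsilon> by auto
    then have "k * (- \<epsilon> * (S t - k * C t / 2)) \<le>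
        k * (k / 2 * exp (- 2 * t) + k ^ 3 / 2 * exp (- (k\<^sup>2 / 6) * t))"
      by (intro mult_left_mono Z_decay[OF assms(1) t] k)
    then have "exp (k\<^sup>2 / 2 * t) * (k * (- \<epsilon> * (S t - k * C t / 2))) \<le>
       exp (k\<^sup>2 / 2 * t) * (k * (k / 2 * exp (- 2 * t) + k ^ 3 / 2 * exp (- (k\<^sup>2 / 6) * t)))"
      by (rule mult_left_mono) (rule exp_ge_zero)
    also have "\<dots> = k\<^sup>2 / 2 * exp (k\<^sup>2 / 2 * t + - 2 * t)
       + k ^ 4 / 2 * exp (k\<^sup>2 / 2 * t + - (k\<^sup>2 / 6) * t)"
      unfolding exp_add by (simp add: algebra_simps power2_eq_square power3_eq_cube power4_eq_xxxx)
    also have "k\<^sup>2 / 2 * t + - (k\<^sup>2 / 6) * t = k\<^sup>2 / 3 * t" by (simp add: field_simps)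
    also have "k\<^sup>2 / 2 * exp (k\<^sup>2 / 2 * t + - 2 * t) \<le> k\<^sup>2 / 2 * exp (- (3 / 2) * t)"
    proof -
      have "k\<^sup>2 * t \<le> t" using k2 t by (simp add: mult_left_le_one_le)
      then show ?thesis by (intro mult_left_mono) auto
    qed
    finally have "exp (k\<^sup>2 / 2 * t) * (k * (- \<epsilon> * (S t - k * C t / 2))) \<le>
      k\<^sup>2 / 2 * exp (- (3 / 2) * t) + k ^ 4 / 2 * exp (k\<^sup>2 / 3 * t)" by simp
    moreover have "0 \<le> k ^ 4 / 2 * t * (k\<^sup>2 / 3) * exp (k\<^sup>2 / 3 * t)" using t by simp
    ultimately show "?d \<le> 0" by linarith
  qed
  also have "?f 0 = k\<^sup>2 / 3" by (simp add: C0)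
  finally have "?f T \<le> k\<^sup>2 / 3" .
  moreover have "0 \<le> k\<^sup>2 / 3 * exp (- (3 / 2) * T)" by simp
  ultimately have "\<epsilon> * (exp (k\<^sup>2 / 2 * T) * C T - 1) \<le> k\<^sup>2 / 3 + k ^ 4 / 2 * T * exp (k\<^sup>2 / 3 * T)"
    by linarith
  then have "exp (- (k\<^sup>2 / 2) * T) * (\<epsilon> * (exp (k\<^sup>2 / 2 * T) * C T - 1)) \<le>
     exp (- (k\<^sup>2 / 2) * T) * (k\<^sup>2 / 3 + k ^ 4 / 2 * T * exp (k\<^sup>2 / 3 * T))"
    by (intro mult_left_mono) auto
  also have "exp (- (k\<^sup>2 / 2) * T) * (\<epsilon> * (exp (k\<^sup>2 / 2 * T) * C T - 1)) =
    \<epsilon> * (C T - exp (- (k\<^sup>2 / 2) * T))"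
  proof -
    have "X * (\<epsilon> * (Y * c - 1)) = \<epsilon> * (c - X)" if "X * Y = 1" for X Y c :: real
    proof -
      have "X * (\<epsilon> * (Y * c - 1)) = \<epsilon> * ((X * Y) * c - X)" by (simp add: right_diff_distrib)
      then show ?thesis using that by simp
    qed
    then show ?thesis by (simp flip: exp_add)
  qed
  also have "exp (- (k\<^sup>2 / 2) * T) * (k\<^sup>2 / 3 + k ^ 4 / 2 * T * exp (k\<^sup>2 / 3 * T)) =
     k\<^sup>2 / 3 * exp (- (k\<^sup>2 / 2) * T) + k ^ 4 / 2 * T * exp (- (k\<^sup>2 / 6) * T)"
  proof -
    have "X * (p + q * Y) = p * X + q * Z" if "X * Y = Z" for X Y Z p q :: real
    proof -
      have "X * (p + q * Y) = p * X + q * (X * Y)" by (simp add: distrib_left)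
      then show ?thesis using that by simp
    qed
    moreover have "exp (- (k\<^sup>2 / 2) * T) * exp (k\<^sup>2 / 3 * T) = exp (- (k\<^sup>2 / 6) * T)"
      by (simp flip: exp_add)
    ultimately show ?thesis by blast
  qed
  finally show ?thesis .
qed

lemma estimate:
  assumes "0 < T"
  shows "\<bar>C T - exp (- (k\<^sup>2 / 2) * T)\<bar> \<le> 37 / T"
proof -
  have fin: "\<bar>x\<bar> \<le> 37 / T" if "x \<le> B" "- x \<le> B" "T * B \<le> 37" for x B :: real
  proof -
    have "B * T \<le> 37" using that(3) by (simp only: mult.commute)
    then have "B \<le> 37 / T" by (simp only: pos_le_divide_eq[OF assms])
    then show ?thesis using that(1,2) by (simp only: abs_le_iff) linarith
  qed
  show ?thesis
  proof (cases "k \<le> 1")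
    case True
    define y where "y = k\<^sup>2 * T"
    have y: "0 \<le> y" using assms by (simp add: y_def)
    have "k\<^sup>2 / 2 * T = y / 2" "k\<^sup>2 / 6 * T = y / 6" by (simp_all add: y_def)
    then have "T * (k\<^sup>2 / 3 * exp (- (k\<^sup>2 / 2) * T) + k ^ 4 / 2 * T * exp (- (k\<^sup>2 / 6) * T)) =
      T * (k\<^sup>2 / 3 * exp (- (y / 2)) + k ^ 4 / 2 * T * exp (- (y / 6)))"
      by (simp only: mult_minus_left)
    \<comment> \<open>In y = k^2 T the bound no longer depends on k; its summands are at most 2/3
      and 36, whence 37.\<close>
    also have "\<dots> = 2 / 3 * ((y / 2) * exp (- (y / 2))) + 18 * ((y / 6)\<^sup>2 * exp (- (y / 6)))"
      unfolding y_def by (simp add: power2_eq_square power4_eq_xxxx algebra_simps)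
    also have "\<dots> \<le> 2 / 3 * 1 + 18 * 2"
      using y by (intro add_mono mult_left_mono mult_exp_neg_le square_mult_exp_neg_le) auto
    finally have "T * (k\<^sup>2 / 3 * exp (- (k\<^sup>2 / 2) * T) + k ^ 4 / 2 * T * exp (- (k\<^sup>2 / 6) * T)) \<le> 37"
      by (rule order_trans) simp
    then show ?thesis
      by (rule fin[OF D_decay[OF True less_imp_le[OF assms] disjI1[OF refl], unfolded mult_1]
          D_decay[OF True less_imp_le[OF assms] disjI2[OF refl], unfolded mult_minus1]])
  next
    \<comment> \<open>For k >= 1 both quantities decay exponentially in T and are bounded
      separately; the constant is 11 here.\<close>
    case False
    then have k1: "1 \<le> k" by simp
    have "1 \<le> k\<^sup>2" using k1 by (rule one_le_power)
    then have "T \<le> k\<^sup>2 * T"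
      using assms mult_right_mono[of 1 "k\<^sup>2" T] by (simp only: mult_1 less_imp_le)
    moreover have "- (k\<^sup>2 / 2) * T = - (k\<^sup>2 * T) / 2" by simp
    ultimately have e: "exp (- (k\<^sup>2 / 2) * T) \<le> exp (- (T / 2))"
      by (simp only: exp_le_cancel_iff)
    have c: "\<bar>C T\<bar> \<le> 3 / 2 * exp (- (T / 6))"
      using C_decay_large[OF k1, of T] assms by simp
    have 1: "x - z \<le> B1 + B2" "- (x - z) \<le> B1 + B2"
      if "\<bar>x\<bar> \<le> B1" "z \<le> B2" "0 \<le> z" for x z B1 B2 :: real using that by linarith+
    have "T * (3 / 2 * exp (- (T / 6)) + exp (- (T / 2))) =
      9 * ((T / 6) * exp (- (T / 6))) + 2 * ((T / 2) * exp (- (T / 2)))"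
      by (simp add: distrib_left)
    also have "\<dots> \<le> 9 * 1 + 2 * 1"
      by (intro add_mono mult_left_mono mult_exp_neg_le) auto
    finally have "T * (3 / 2 * exp (- (T / 6)) + exp (- (T / 2))) \<le> 37"
      by (rule order_trans) simp
    then show ?thesis
      by (rule fin[OF 1(1)[OF c e exp_ge_zero] 1(2)[OF c e exp_ge_zero]])
  qed
qed

end

section \<open>The Poisson process\<close>

locale poisson =
  fixes P :: "'p measure" and a :: real and N :: "real \<Rightarrow> 'p \<Rightarrow> nat"
  assumes pp: "poisson_process P a N" and a: "0 < a"
begin

sublocale prob_space P
  using pp by (simp add: poisson_process_def)

lemma N_measurable: "0 \<le> t \<Longrightarrow> N t \<in> P \<rightarrow>\<^sub>M count_space UNIV"
  using pp by (simp add: poisson_process_def)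

lemma N_0: "\<omega> \<in> space P \<Longrightarrow> N 0 \<omega> = 0"
  using pp by (simp add: poisson_process_def)

lemma N_mono: "\<omega> \<in> space P \<Longrightarrow> 0 \<le> s \<Longrightarrow> s \<le> t \<Longrightarrow> N s \<omega> \<le> N t \<omega>"
  using pp by (auto simp: poisson_process_def mono_on_def)

lemma N_right_constant:
  assumes "\<omega> \<in> space P" "0 \<le> s"
  obtains d where "0 < d" "\<And>r. s \<le> r \<Longrightarrow> r < s + d \<Longrightarrow> N r \<omega> = N s \<omega>"
proof -
  have "continuous (at_right s) (\<lambda>s. N s \<omega>)" using pp assms by (simp add: poisson_process_def)
  then have "\<forall>\<^sub>F r in at_right s. N r \<omega> = N s \<omega>"
    by (simp add: continuous_within tendsto_discrete)
  then obtain b where b: "s < b" "\<And>r. s < r \<Longrightarrow> r < b \<Longrightarrow> N r \<omega> = N s \<omega>"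
    by (auto simp: eventually_at_right_field)
  have "N r \<omega> = N s \<omega>" if "s \<le> r" "r < s + (b - s)" for r
    using that by (cases "r = s") (simp, intro b(2), auto)
  moreover have "0 < b - s" using b(1) by simp
  ultimately show thesis using that by blast
qed

text \<open>The sign of the velocity. Clamping time at 0 makes it a function on the whole real line,
  whereas the process is specified at nonnegative times.\<close>

definition E :: "real \<Rightarrow> 'p \<Rightarrow> real" where "E s \<omega> = (-1) ^ N (max 0 s) \<omega>"

lemma abs_E [simp]: "\<bar>E s \<omega>\<bar> = 1"
  by (simp add: E_def power_abs)

text \<open>Writes the parity as a function of a real number, the form needed for sums of
  real-valued increments in \<open>indep_R\<close>.\<close>

lemma E_cos: "E s \<omega> = cos (pi * real (N (max 0 s) \<omega>))"
  by (simp add: E_def mult.commute[of pi])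

lemma E_measurable1 [measurable]: "E s \<in> borel_measurable P"
proof -
  have "N (max 0 s) \<in> P \<rightarrow>\<^sub>M count_space UNIV" by (rule N_measurable) simp
  then show ?thesis unfolding E_def[abs_def] by (rule measurable_compose) simp
qed

lemma E_right_approx:
  assumes \<omega>: "\<omega> \<in> space P" and q: "\<And>n. max 0 s \<le> q n" "q \<longlonglongrightarrow> max 0 s"
  shows "(\<lambda>n. E (q n) \<omega>) \<longlonglongrightarrow> E s \<omega>"
proof -
  obtain d where d: "0 < d" "\<And>r. max 0 s \<le> r \<Longrightarrow> r < max 0 s + d \<Longrightarrow> N r \<omega> = N (max 0 s) \<omega>"
    using N_right_constant[OF \<omega> max.cobounded1[of 0 s]] by blast
  have "\<forall>\<^sub>F n in sequentially. q n < max 0 s + d"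
    using d(1) by (intro order_tendstoD(2)[OF q(2)]) simp
  then have "\<forall>\<^sub>F n in sequentially. E (q n) \<omega> = E s \<omega>"
  proof eventually_elim
    case (elim n)
    have "max 0 (q n) = q n" using q(1)[of n] by simp
    then show ?case using d(2)[OF q(1) elim] by (simp add: E_def)
  qed
  then show ?thesis by (rule tendsto_eventually)
qed

lemma E_measurable [measurable]: "(\<lambda>(s, \<omega>). E s \<omega>) \<in> borel_measurable (borel \<Otimes>\<^sub>M P)"
proof -
  \<comment> \<open>Rounding up to the grid of mesh 1 / (n + 1). The approximation is from the
    right, where the paths are locally constant, and takes countably many values, so joint
    measurability follows from measurability at fixed times.\<close>
  define q where "q n s = real_of_int \<lceil>real (Suc n) * max 0 s\<rceil> / real (Suc n)" for n and s :: real
  have q_ge: "max 0 s \<le> q n s" for n s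
    unfolding q_def by (subst pos_le_divide_eq) (simp_all add: mult.commute del: of_nat_Suc)
  have q_le: "q n s \<le> max 0 s + 1 / real (Suc n)" for n s
  proof -
    have "real_of_int \<lceil>real (Suc n) * max 0 s\<rceil> \<le> real (Suc n) * max 0 s + 1" by linarith
    then have "q n s \<le> (real (Suc n) * max 0 s + 1) / real (Suc n)"
      unfolding q_def by (intro divide_right_mono) auto
    then show ?thesis by (simp add: add_divide_distrib del: of_nat_Suc)
  qed
  have q_lim: "(\<lambda>n. q n s) \<longlonglongrightarrow> max 0 s" for s
  proof (rule tendsto_sandwich[OF _ _ tendsto_const])
    have "(\<lambda>n. max 0 s + 1 / real (Suc n)) \<longlonglongrightarrow> max 0 s + 0"
      by (intro tendsto_add tendsto_const LIMSEQ_Suc[OF lim_1_over_n])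
    then show "(\<lambda>n. max 0 s + 1 / real (Suc n)) \<longlonglongrightarrow> max 0 s" by simp
  qed (use q_ge q_le in auto)
  show ?thesis
  proof (rule borel_measurable_LIMSEQ_real)
    fix p :: "real \<times> 'p" assume "p \<in> space (borel \<Otimes>\<^sub>M P)"
    then obtain s \<omega> where p: "p = (s, \<omega>)" "\<omega> \<in> space P" by (auto simp: space_pair_measure)
    show "(\<lambda>n. case p of (s, \<omega>) \<Rightarrow> E (q n s) \<omega>) \<longlonglongrightarrow> (case p of (s, \<omega>) \<Rightarrow> E s \<omega>)"
      using E_right_approx[OF p(2) q_ge q_lim] by (simp add: p)
  next
    fix n
    have "(\<lambda>p. E (real_of_int i / real (Suc n)) (snd p)) \<in> borel_measurable (borel \<Otimes>\<^sub>M P)" for i :: int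
      by measurable
    moreover have "(\<lambda>p. \<lceil>real (Suc n) * max 0 (fst p)\<rceil>) \<in> borel \<Otimes>\<^sub>M P \<rightarrow>\<^sub>M count_space UNIV"
      by measurable
    ultimately have "(\<lambda>p. E (real_of_int \<lceil>real (Suc n) * max 0 (fst p)\<rceil> / real (Suc n)) (snd p)) \<in> borel_measurable (borel \<Otimes>\<^sub>M P)"
      by (rule measurable_compose_countable)
    then show "(\<lambda>p. case p of (s, \<omega>) \<Rightarrow> E (q n s) \<omega>) \<in> borel_measurable (borel \<Otimes>\<^sub>M P)"
      by (simp add: q_def split_beta)
  qed
qed

lemma E_measurable2: "\<omega> \<in> space P \<Longrightarrow> (\<lambda>s. E s \<omega>) \<in> borel_measurable borel"
  by measurable

section \<open>The random time and its chain rule\<close>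

abbreviation \<tau> :: "real \<Rightarrow> 'p \<Rightarrow> real" where "\<tau> \<equiv> random_time N"

lemma \<tau>_eq: "\<tau> t \<omega> = (\<integral>s. indicator {0..t} s * E s \<omega> \<partial>lborel)"
  unfolding random_time_def set_lebesgue_integral_def
  by (rule Bochner_Integration.integral_cong) (auto simp: E_def indicator_def max_def)

lemma \<tau>_0: "\<tau> 0 \<omega> = 0"
proof -
  have "indicator {0..0} s * E s \<omega> = indicator {0} s * E 0 \<omega>" for s :: real
    by (auto simp: indicator_def)
  then show ?thesis by (simp only: \<tau>_eq) simp
qed

lemma \<tau>_measurable2 [measurable]: "(\<lambda>(t, \<omega>). \<tau> t \<omega>) \<in> borel_measurable (borel \<Otimes>\<^sub>M P)"
proof -
  have "(\<lambda>x. (if 0 \<le> snd x \<and> snd x \<le> fst (fst x) then 1 else 0) * E (snd x) (snd (fst x)))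
      \<in> borel_measurable ((borel \<Otimes>\<^sub>M P) \<Otimes>\<^sub>M lborel)"
    by measurable
  then have "(\<lambda>p. \<integral>s. (if 0 \<le> s \<and> s \<le> fst p then 1 else 0) * E s (snd p) \<partial>lborel) \<in> borel_measurable (borel \<Otimes>\<^sub>M P)"
    by measurable
  moreover have "(\<lambda>(t, \<omega>). \<tau> t \<omega>) = (\<lambda>p. \<integral>s. (if 0 \<le> s \<and> s \<le> fst p then 1 else 0) * E s (snd p) \<partial>lborel)"
    by (rule ext) (simp only: split_beta \<tau>_eq indicator_def of_bool_def atLeastAtMost_iff)
  ultimately show ?thesis by (simp only:)
qed

lemma \<tau>_measurable [measurable]: "\<tau> t \<in> borel_measurable P"
proof -
  have "(\<lambda>\<omega>. (t, \<omega>)) \<in> P \<rightarrow>\<^sub>M borel \<Otimes>\<^sub>M P" by measurable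
  from measurable_compose[OF this \<tau>_measurable2] show ?thesis by simp
qed

lemma E_integrable: "\<omega> \<in> space P \<Longrightarrow> integrable lborel (\<lambda>s. indicator {x..y} s * E s \<omega>)"
proof (rule Bochner_Integration.integrable_bound[of _ "\<lambda>s. indicator {x..y} s :: real"])
  assume "\<omega> \<in> space P"
  note [measurable] = E_measurable2[OF this]
  show "(\<lambda>s. indicator {x..y} s * E s \<omega>) \<in> borel_measurable lborel" by measurable
  show "integrable lborel (indicator {x..y} :: real \<Rightarrow> real)"
    by (rule integrable_real_indicator) (auto simp: emeasure_lborel_Icc_eq)
qed (simp add: abs_mult)

text \<open>A discontinuity \<open>x\<close> is the first time at which the path reaches the value
  \<open>N x \<omega>\<close>, so it is determined by an integer between 0 and
  \<open>N t \<omega>\<close>.\<close>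

lemma finite_jumps:
  assumes \<omega>: "\<omega> \<in> space P"
  shows "finite {x. 0 < x \<and> x < t \<and> \<not> isCont (\<lambda>s. E s \<omega>) x}"
proof (rule finite_subset)
  let ?J = "\<lambda>k. Inf {r. 0 \<le> r \<and> k \<le> N r \<omega>}"
  show "finite (?J ` {..N t \<omega>})" by simp
  show "{x. 0 < x \<and> x < t \<and> \<not> isCont (\<lambda>s. E s \<omega>) x} \<subseteq> ?J ` {..N t \<omega>}"
  proof
    fix x assume "x \<in> {x. 0 < x \<and> x < t \<and> \<not> isCont (\<lambda>s. E s \<omega>) x}"
    then have x: "0 < x" "x < t" "\<not> isCont (\<lambda>s. E s \<omega>) x" by auto
    let ?A = "{r. 0 \<le> r \<and> N x \<omega> \<le> N r \<omega>}"
    have xA: "x \<in> ?A" using x by simp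
    have bdd: "bdd_below ?A" by (rule bdd_belowI[of _ 0]) simp
    have "Inf ?A = x"
    proof (rule ccontr)
      assume "Inf ?A \<noteq> x"
      then have "Inf ?A < x" using cInf_lower[OF xA bdd] by simp
      then obtain r where r: "r \<in> ?A" "r < x" using cInf_lessD[of ?A x] xA by auto
      obtain d where d: "0 < d" "\<And>r. x \<le> r \<Longrightarrow> r < x + d \<Longrightarrow> N r \<omega> = N x \<omega>"
        using N_right_constant[OF \<omega> less_imp_le[OF x(1)]] by blast
      have const: "E y \<omega> = E x \<omega>" if y: "y \<in> {r<..<x + d}" for y
      proof -
        have y0: "0 \<le> y" using r y by simp
        have "N y \<omega> = N x \<omega>"
        proof (cases "x \<le> y")
          case False
          have "N r \<omega> \<le> N y \<omega>" "N y \<omega> \<le> N x \<omega>"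
            using r y False y0 by (auto intro!: N_mono[OF \<omega>])
          then show ?thesis using r by simp
        next
          case True
          then show ?thesis by (rule d(2)) (use y in simp)
        qed
        then show ?thesis using y0 x(1) by (simp add: E_def max_def)
      qed
      have "isCont (\<lambda>_. E x \<omega>) x" by simp
      moreover have "\<forall>\<^sub>F y in nhds x. E y \<omega> = E x \<omega>"
      proof (rule eventually_mono)
        show "\<forall>\<^sub>F y in nhds x. y \<in> {r<..<x + d}"
          by (rule eventually_nhds_in_open) (use r d(1) in simp_all)
      qed (rule const)
      ultimately have "isCont (\<lambda>s. E s \<omega>) x" by (subst isCont_cong)
      then show False using x(3) by simp
    qed
    moreover have "N x \<omega> \<le> N t \<omega>" using x by (intro N_mono[OF \<omega>]) auto
    ultimately show "x \<in> ?J ` {..N t \<omega>}" by (intro image_eqI[of _ _ "N x \<omega>"]) auto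
  qed
qed

lemma \<tau>_HK:
  assumes \<omega>: "\<omega> \<in> space P" and "x \<le> y"
  shows "(\<lambda>s. E s \<omega>) integrable_on {x..y}" "0 \<le> t \<Longrightarrow> \<tau> t \<omega> = integral {0..t} (\<lambda>s. E s \<omega>)"
proof -
  have i: "set_integrable lborel {x..y} (\<lambda>s. E s \<omega>)" for x y
    using E_integrable[OF \<omega>, of x y] by (simp add: set_integrable_def)
  show "(\<lambda>s. E s \<omega>) integrable_on {x..y}" by (rule set_borel_integral_eq_integral(1)[OF i])
  show "\<tau> t \<omega> = integral {0..t} (\<lambda>s. E s \<omega>)"
    using set_borel_integral_eq_integral(2)[OF i, of 0 t] by (simp add: \<tau>_eq set_lebesgue_integral_def)
qed

text \<open>The random time is continuous in \<open>t\<close>, and differentiable with derivative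
  \<open>E\<close> except at finitely many jumps, which the fundamental theorem of calculus admits
  as exceptional points.\<close>

lemma \<tau>_chain:
  fixes F F' :: "real \<Rightarrow> real"
  assumes \<omega>: "\<omega> \<in> space P" and t: "0 \<le> t" and F: "\<And>x. (F has_real_derivative F' x) (at x)"
    and F': "F' \<in> borel_measurable borel" "\<And>x. \<bar>F' x\<bar> \<le> C"
  shows "F (\<tau> t \<omega>) - F 0 = (\<integral>r. indicator {0..t} r * (F' (\<tau> r \<omega>) * E r \<omega>) \<partial>lborel)"
proof -
  note [measurable] = E_measurable2[OF \<omega>] F'(1)
  have [measurable]: "(\<lambda>r. \<tau> r \<omega>) \<in> borel_measurable borel"
  proof -
    have "(\<lambda>r. (r, \<omega>)) \<in> borel \<rightarrow>\<^sub>M borel \<Otimes>\<^sub>M P" using \<omega> by measurable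
    from measurable_compose[OF this \<tau>_measurable2] show ?thesis by simp
  qed
  let ?T = "\<lambda>u. integral {0..u} (\<lambda>s. E s \<omega>)"
  let ?S = "{x. 0 < x \<and> x < t \<and> \<not> isCont (\<lambda>s. E s \<omega>) x}"
  have i0: "(\<lambda>s. E s \<omega>) integrable_on {0..t}" by (rule \<tau>_HK(1)[OF \<omega> t])
  have contT: "continuous_on {0..t} ?T" by (rule indefinite_integral_continuous_1[OF i0])
  have contF: "continuous_on UNIV F" using F by (auto intro!: continuous_at_imp_continuous_on DERIV_isCont)
  have "((\<lambda>r. F' (?T r) * E r \<omega>) has_integral F (?T t) - F (?T 0)) {0..t}"
  proof (rule fundamental_theorem_of_calculus_interior_strong[OF finite_jumps[OF \<omega>, of t] t])
    show "continuous_on {0..t} (\<lambda>u. F (?T u))"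
      by (rule continuous_on_compose2[OF contF contT]) auto
    fix x assume x: "x \<in> {0<..<t} - ?S"
    then have c: "isCont (\<lambda>s. E s \<omega>) x" by auto
    have "(?T has_vector_derivative E x \<omega>) (at x within {0..t} - {})"
      by (rule integral_has_vector_derivative_continuous_at[OF i0])
        (use x c in \<open>auto intro: continuous_at_imp_continuous_within\<close>)
    then have "(?T has_real_derivative E x \<omega>) (at x)"
      using x at_within_interior[of x "{0..t}"] by (auto simp: has_real_derivative_iff_has_vector_derivative)
    from DERIV_chain2[OF F this]
    show "((\<lambda>u. F (?T u)) has_vector_derivative F' (?T x) * E x \<omega>) (at x)"
      by (simp add: has_real_derivative_iff_has_vector_derivative)
  qed
  then have "((\<lambda>r. F' (\<tau> r \<omega>) * E r \<omega>) has_integral F (?T t) - F (?T 0)) {0..t}"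
    by (rule has_integral_eq[rotated]) (use \<tau>_HK(2)[OF \<omega> t] in auto)
  then have "((\<lambda>r. F' (\<tau> r \<omega>) * E r \<omega>) has_integral F (\<tau> t \<omega>) - F 0) {0..t}"
    by (simp add: \<tau>_HK(2)[OF \<omega> t t])
  moreover have si: "set_integrable lborel {0..t} (\<lambda>r. F' (\<tau> r \<omega>) * E r \<omega>)"
    unfolding set_integrable_def
  proof (rule Bochner_Integration.integrable_bound[of _ "\<lambda>s. C * indicator {0..t} s :: real"])
    show "AE r in lborel. norm (indicator {0..t} r *\<^sub>R (F' (\<tau> r \<omega>) * E r \<omega>)) \<le> norm (C * indicator {0..t} r :: real)"
      using order_trans[OF F'(2) abs_ge_self] by (auto simp: abs_mult indicator_def)
    show "integrable lborel (\<lambda>s. C * indicator {0..t} s :: real)"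
      by (intro integrable_mult_right integrable_real_indicator) (auto simp: emeasure_lborel_Icc_eq)
    show "(\<lambda>r. indicator {0..t} r *\<^sub>R (F' (\<tau> r \<omega>) * E r \<omega>)) \<in> borel_measurable lborel" by measurable
  qed
  ultimately show ?thesis
    using set_borel_integral_eq_integral[OF si] by (simp add: set_lebesgue_integral_def integral_unique)
qed

text \<open>Right-endpoint Riemann sums for \<open>\<tau> s\<close>. Each depends on the process at
  finitely many times up to \<open>s\<close>, hence on finitely many increments, to which
  \<open>independent_increments\<close> applies.\<close>

definition R :: "nat \<Rightarrow> real \<Rightarrow> 'p \<Rightarrow> real" where
  "R n s \<omega> = (\<Sum>k<Suc n. s / real (Suc n) * E (real (Suc k) * (s / real (Suc n))) \<omega>)"

lemma R_eq_integral:
  assumes s: "0 < s"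
  defines "h n \<equiv> s / real (Suc n)"
  shows "R n s \<omega> = (\<integral>r. indicator {0..s} r * E (h n * real_of_int \<lceil>r / h n\<rceil>) \<omega> \<partial>lborel)"
proof -
  let ?h = "h n" and ?m = "Suc n"
  have h: "0 < ?h" using s by (simp add: h_def)
  have mh: "real ?m * ?h = s" by (simp add: h_def)
  \<comment> \<open>The cells are open on the left, so the ceiling identifies the cell of r. The
    point 0 belongs to \<open>{0..s}\<close> but to no cell and is excluded.\<close>
  have pt: "indicator {0..s} r * E (?h * real_of_int \<lceil>r / ?h\<rceil>) \<omega> =
      (\<Sum>k<?m. indicator {real k * ?h<..real (Suc k) * ?h} r * E (real (Suc k) * ?h) \<omega>)" if r0: "r \<noteq> 0" for r
  proof -
    have cell: "r \<in> {real k * ?h<..real (Suc k) * ?h} \<longleftrightarrow> \<lceil>r / ?h\<rceil> = int (Suc k)" for k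
      using h by (simp add: ceiling_eq_iff pos_less_divide_eq pos_divide_le_eq)
    show ?thesis
    proof (cases "0 < r \<and> r \<le> s")
      case True
      define k where "k = nat (\<lceil>r / ?h\<rceil> - 1)"
      have "0 < r / ?h" using True h by simp
      then have "0 < \<lceil>r / ?h\<rceil>" by simp
      then have k: "\<lceil>r / ?h\<rceil> = int (Suc k)" by (simp add: k_def)
      have "r / ?h \<le> real ?m" using True h by (simp add: pos_divide_le_eq mh del: of_nat_Suc)
      then have "\<lceil>r / ?h\<rceil> \<le> int ?m" by (simp add: ceiling_le_iff)
      then have km: "k < ?m" using k by simp
      have "(\<Sum>j<?m. indicator {real j * ?h<..real (Suc j) * ?h} r * E (real (Suc j) * ?h) \<omega>) =
          (\<Sum>j<?m. if j = k then E (real (Suc k) * ?h) \<omega> else 0)"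
        by (rule sum.cong) (auto simp only: indicator_def cell k of_bool_def, auto)
      also have "\<dots> = E (real (Suc k) * ?h) \<omega>" using km by (simp del: of_nat_Suc)
      also have "\<dots> = indicator {0..s} r * E (?h * real_of_int \<lceil>r / ?h\<rceil>) \<omega>"
        unfolding k using True by (simp add: mult.commute)
      finally show ?thesis by simp
    next
      case False
      have "r \<notin> {real k * ?h<..real (Suc k) * ?h}" if "k < ?m" for k
      proof
        assume r: "r \<in> {real k * ?h<..real (Suc k) * ?h}"
        have "real (Suc k) * ?h \<le> real ?m * ?h" using that h by (intro mult_right_mono) auto
        moreover have "0 \<le> real k * ?h" using h by simp
        ultimately show False using r False unfolding mh by auto
      qed
      then have "(\<Sum>k<?m. indicator {real k * ?h<..real (Suc k) * ?h} r * E (real (Suc k) * ?h) \<omega>) = 0"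
        by (intro sum.neutral) (auto simp del: of_nat_Suc)
      then show ?thesis using False r0 by (auto simp: indicator_def)
    qed
  qed
  have ind: "integrable lborel (indicator {real k * ?h<..real (Suc k) * ?h} :: real \<Rightarrow> real)" for k
    by (rule integrable_real_indicator) (auto simp: emeasure_lborel_Ioc h less_imp_le)
  have "R n s \<omega> = (\<Sum>k<?m. \<integral>r. indicator {real k * ?h<..real (Suc k) * ?h} r * E (real (Suc k) * ?h) \<omega> \<partial>lborel)"
  proof -
    have "(\<integral>r. indicator {real k * ?h<..real (Suc k) * ?h} r \<partial>lborel) = ?h" for k
      using h by (simp add: algebra_simps)
    then show ?thesis by (simp only: R_def integral_mult_left_zero h_def)
  qed
  also have "\<dots> = (\<integral>r. (\<Sum>k<?m. indicator {real k * ?h<..real (Suc k) * ?h} r * E (real (Suc k) * ?h) \<omega>) \<partial>lborel)"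
    by (rule Bochner_Integration.integral_sum[symmetric]) (intro integrable_mult_left ind)
  also have "\<dots> = (\<integral>r. indicator {0..s} r * E (?h * real_of_int \<lceil>r / ?h\<rceil>) \<omega> \<partial>lborel)"
  proof -
    define f where "f r = (\<Sum>k<?m. indicator {real k * ?h<..real (Suc k) * ?h} r * E (real (Suc k) * ?h) \<omega>)" for r
    define f' where "f' r = indicator {0..s} r * E (?h * real_of_int \<lceil>r / ?h\<rceil>) \<omega>" for r
    have fm: "f \<in> borel_measurable borel" unfolding f_def[abs_def] by measurable
    have "f' = (\<lambda>r. if r = 0 then f' 0 else f r)" using pt by (auto simp: f_def f'_def)
    moreover have "(\<lambda>r. if r = 0 then f' 0 else f r) \<in> borel_measurable borel" using fm by measurable
    ultimately have f'm: "f' \<in> borel_measurable borel" by (simp only:)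
    have "AE r in lborel. f r = f' r"
      using AE_lborel_singleton[of "0::real"] by eventually_elim (use pt in \<open>simp add: f_def f'_def\<close>)
    then have "integral\<^sup>L lborel f = integral\<^sup>L lborel f'"
      using fm f'm by (intro Bochner_Integration.integral_cong_AE) auto
    then show ?thesis by (simp only: f_def[abs_def] f'_def[abs_def])
  qed
  finally show ?thesis .
qed

text \<open>The sampling times are r rounded up to the grid; they approach r from the right, where
  \<open>E\<close> is continuous.\<close>

lemma R_tendsto:
  assumes \<omega>: "\<omega> \<in> space P" and s: "0 \<le> s"
  shows "(\<lambda>n. R n s \<omega>) \<longlonglongrightarrow> \<tau> s \<omega>"
proof (cases "s = 0")
  case False
  with s have s: "0 < s" by simp
  note [measurable] = E_measurable2[OF \<omega>]
  define h where "h n = s / real (Suc n)" for n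
  have h: "0 < h n" for n using s by (simp add: h_def)
  have h0: "h \<longlonglongrightarrow> 0" unfolding h_def[abs_def] by (rule LIMSEQ_Suc[OF lim_const_over_n])
  let ?q = "\<lambda>n r. h n * real_of_int \<lceil>r / h n\<rceil>"
  have q1: "r \<le> ?q n r" for n r
  proof -
    have "h n * (r / h n) \<le> ?q n r" using h[of n] by (intro mult_left_mono le_of_int_ceiling) auto
    then show ?thesis using h[of n] by simp
  qed
  have q2: "?q n r \<le> r + h n" for n r
  proof -
    have "real_of_int \<lceil>r / h n\<rceil> \<le> r / h n + 1" by linarith
    then have "?q n r \<le> h n * (r / h n + 1)" using h[of n] by (intro mult_left_mono) auto
    also have "\<dots> = r + h n" using h[of n] by (simp add: distrib_left del: of_nat_Suc)
    finally show ?thesis .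
  qed
  have "(\<lambda>n. \<integral>r. indicator {0..s} r * E (?q n r) \<omega> \<partial>lborel) \<longlonglongrightarrow> (\<integral>r. indicator {0..s} r * E r \<omega> \<partial>lborel)"
  proof (rule integral_dominated_convergence[where w = "indicator {0..s}"])
    show "integrable lborel (indicator {0..s} :: real \<Rightarrow> real)"
      by (rule integrable_real_indicator) (auto simp: emeasure_lborel_Icc_eq)
    show "AE r in lborel. (\<lambda>n. indicator {0..s} r * E (?q n r) \<omega>) \<longlonglongrightarrow> indicator {0..s} r * E r \<omega>"
    proof (intro AE_I2)
      fix r
      show "(\<lambda>n. indicator {0..s} r * E (?q n r) \<omega>) \<longlonglongrightarrow> indicator {0..s} r * E r \<omega>"
      proof (cases "r \<in> {0..s}")
        case True
        have "(\<lambda>n. ?q n r) \<longlonglongrightarrow> r"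
        proof (rule tendsto_sandwich[OF _ _ tendsto_const])
          show "(\<lambda>n. r + h n) \<longlonglongrightarrow> r" using tendsto_add[OF tendsto_const h0, of r] by simp
        qed (use q1 q2 in auto)
        then have "(\<lambda>n. E (?q n r) \<omega>) \<longlonglongrightarrow> E r \<omega>"
          using True q1[of r] by (intro E_right_approx[OF \<omega>]) (simp_all add: max_absorb2)
        then show ?thesis by (intro tendsto_intros)
      qed simp
    qed
    show "AE r in lborel. norm (indicator {0..s} r * E (?q n r) \<omega>) \<le> indicator {0..s} r" for n
      by (simp add: abs_mult)
    show "(\<lambda>r. indicator {0..s} r * E r \<omega>) \<in> borel_measurable lborel" by measurable
    show "(\<lambda>r. indicator {0..s} r * E (?q n r) \<omega>) \<in> borel_measurable lborel" for n by measurable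
  qed
  then show ?thesis by (simp only: R_eq_integral[OF s] \<tau>_eq h_def)
qed (simp add: R_def \<tau>_0)

section \<open>Correlation of parities and independence of the past\<close>

lemma E_mult_E:
  assumes "\<omega> \<in> space P" "0 \<le> s" "s \<le> t"
  shows "E s \<omega> * E t \<omega> = (-1) ^ (N t \<omega> - N s \<omega>)"
proof -
  have le: "N s \<omega> \<le> N t \<omega>" by (rule N_mono[OF assms])
  then have "(-1::real) ^ N t \<omega> = (-1) ^ N s \<omega> * (-1) ^ (N t \<omega> - N s \<omega>)"
    by (simp flip: power_add)
  moreover have "max 0 s = s" "max 0 t = t"
    using assms(2) order_trans[OF assms(2,3)] by (simp_all only: max_absorb2)
  ultimately show ?thesis
    by (simp add: E_def mult.assoc[symmetric] flip: power_mult_distrib)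
qed

text \<open>The product is -1 to the power of a Poisson variable of mean \<mu> = a (t - s); its
  generating function exp (\<mu> (z - 1)) is evaluated at z = -1.\<close>

lemma expectation_E_mult_E:
  assumes "0 \<le> s" "s \<le> t"
  shows "expectation (\<lambda>\<omega>. E s \<omega> * E t \<omega>) = exp (- 2 * a * (t - s))"
proof (cases "s = t")
  case True
  have "E t \<omega> * E t \<omega> = 1" for \<omega> by (simp add: E_def flip: power_mult_distrib)
  then show ?thesis using True by (simp add: prob_space)
next
  case False
  then have st: "s < t" using assms by simp
  let ?\<mu> = "a * (t - s)"
  have \<mu>: "0 < ?\<mu>" using a st by simp
  have m: "(\<lambda>\<omega>. N t \<omega> - N s \<omega>) \<in> P \<rightarrow>\<^sub>M count_space UNIV"
    using N_measurable[OF assms(1)] N_measurable[OF order_trans[OF assms]] by measurable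
  have d: "distr P (count_space UNIV) (\<lambda>\<omega>. N t \<omega> - N s \<omega>) = measure_pmf (poisson_pmf ?\<mu>)"
    using pp assms st by (simp add: poisson_process_def)
  have "expectation (\<lambda>\<omega>. E s \<omega> * E t \<omega>) = expectation (\<lambda>\<omega>. (-1) ^ (N t \<omega> - N s \<omega>))"
    by (rule Bochner_Integration.integral_cong) (use E_mult_E assms in auto)
  also have "\<dots> = (\<integral>k. (-1) ^ k \<partial>measure_pmf (poisson_pmf ?\<mu>))"
    unfolding d[symmetric] by (rule integral_distr[OF m, symmetric]) simp
  also have "\<dots> = (\<integral>k. pmf (poisson_pmf ?\<mu>) k * (-1) ^ k \<partial>count_space UNIV)"
    unfolding measure_pmf_eq_density by (subst integral_density) auto
  also have "\<dots> = (\<Sum>k. pmf (poisson_pmf ?\<mu>) k * (-1) ^ k)"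
  proof (rule integral_count_space_nat)
    have "integrable (count_space UNIV) (\<lambda>k. pmf (poisson_pmf ?\<mu>) k)" by (rule integrable_pmf)
    then show "integrable (count_space UNIV) (\<lambda>k. pmf (poisson_pmf ?\<mu>) k * (-1) ^ k)"
      by (rule Bochner_Integration.integrable_bound) (auto simp: abs_mult power_abs)
  qed
  also have "\<dots> = exp (- ?\<mu>) * exp (- ?\<mu>)"
  proof -
    have "pmf (poisson_pmf ?\<mu>) k * (-1) ^ k = exp (- ?\<mu>) * ((- ?\<mu>) ^ k /\<^sub>R fact k)" for k
      using \<mu> by (simp add: power_minus[of ?\<mu>] divide_inverse mult_ac)
    then have "(\<lambda>k. pmf (poisson_pmf ?\<mu>) k * (-1) ^ k) sums (exp (- ?\<mu>) * exp (- ?\<mu>))"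
      using sums_mult[OF exp_converges[of "- ?\<mu>"], of "exp (- ?\<mu>)"] by simp
    then show ?thesis by (rule sums_unique[symmetric])
  qed
  finally show ?thesis by (simp flip: exp_add)
qed

text \<open>\<open>E s \<omega> * E t \<omega>\<close> depends only on the increment of
  \<open>N\<close> between \<open>s\<close> and \<open>t\<close>, and \<open>R n s\<close> only on
  earlier increments.\<close>

lemma indep_R:
  assumes s: "0 \<le> s" and st: "s \<le> t"
  shows "expectation (\<lambda>\<omega>. cos (l * R n s \<omega>) * (E s \<omega> * E t \<omega>)) =
    expectation (\<lambda>\<omega>. cos (l * R n s \<omega>)) * expectation (\<lambda>\<omega>. E s \<omega> * E t \<omega>)"
proof -
  let ?m = "Suc n"
  define h where "h = s / real ?m"
  have h: "0 \<le> h" using s by (simp add: h_def)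
  have mh: "real ?m * h = s" by (simp add: h_def)
  \<comment> \<open>Grid points 0, h, ..., s and then constantly t: the increment of index
    \<open>?m\<close> is the one from s to t, and all later ones are 0.\<close>
  define T where "T i = (if i \<le> ?m then real i * h else t)" for i
  define X where "X i \<omega> = real (N (T (Suc i)) \<omega>) - real (N (T i) \<omega>)" for i \<omega>
  have T0: "T 0 = 0" by (simp add: T_def)
  have "mono T"
  proof (rule incseq_SucI)
    fix i
    have "real i * h \<le> real (Suc i) * h" using h by (intro mult_right_mono) auto
    moreover have "real i * h \<le> s" if "i \<le> ?m"
      using that h unfolding mh[symmetric] by (intro mult_right_mono) auto
    ultimately show "T i \<le> T (Suc i)" using st by (force simp: T_def)
  qed
  have iv: "indep_vars (\<lambda>_. borel) X UNIV"
  proof -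
    have "independent_increments P (\<lambda>t \<omega>. real (N t \<omega>))" using pp by (simp add: poisson_process_def)
    then show ?thesis using \<open>mono T\<close> T0 unfolding independent_increments_def X_def[abs_def] by simp
  qed
  have T_nonneg: "0 \<le> T i" for i using monoD[OF \<open>mono T\<close>, of 0 i] T0 by simp
  have telescope: "(\<Sum>i<k. X i \<omega>) = real (N (T k) \<omega>)" if "\<omega> \<in> space P" for k \<omega>
    unfolding X_def using sum_lessThan_telescope[of "\<lambda>i. real (N (T i) \<omega>)" k] N_0[OF that] T0 by simp
  define G where "G x = cos (l * (\<Sum>k<?m. h * cos (pi * (\<Sum>i<Suc k. x i))))" for x :: "nat \<Rightarrow> real"
  define H where "H x = cos (pi * x ?m)" for x :: "nat \<Rightarrow> real"
  have Gm: "G \<in> borel_measurable (PiM {..<?m} (\<lambda>_. borel))"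
  proof -
    have "(\<lambda>x. h * cos (pi * (\<Sum>i<Suc k. x i))) \<in> borel_measurable (PiM {..<?m} (\<lambda>_. borel))" if "k < ?m" for k
    proof -
      have "(\<lambda>x. \<Sum>i<Suc k. x i) \<in> borel_measurable (PiM {..<?m} (\<lambda>_. borel :: real measure))"
        using that by (intro borel_measurable_sum measurable_component_singleton) simp
      then show ?thesis by measurable
    qed
    then have "(\<lambda>x. \<Sum>k<?m. h * cos (pi * (\<Sum>i<Suc k. x i))) \<in> borel_measurable (PiM {..<?m} (\<lambda>_. borel))"
      by (intro borel_measurable_sum) (simp only: lessThan_iff)
    then show ?thesis unfolding G_def[abs_def] by measurable
  qed
  have Hm: "H \<in> borel_measurable (PiM {?m} (\<lambda>_. borel))"
    unfolding H_def[abs_def] by measurable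
  have "indep_var (PiM {..<?m} (\<lambda>_. borel)) (\<lambda>\<omega>. restrict (\<lambda>i. X i \<omega>) {..<?m}) (PiM {?m} (\<lambda>_. borel)) (\<lambda>\<omega>. restrict (\<lambda>i. X i \<omega>) {?m})"
    by (rule indep_var_restrict[OF iv]) auto
  from indep_var_compose[OF this Gm Hm]
  have iv2: "indep_var borel (G \<circ> (\<lambda>\<omega>. restrict (\<lambda>i. X i \<omega>) {..<?m})) borel (H \<circ> (\<lambda>\<omega>. restrict (\<lambda>i. X i \<omega>) {?m}))" .
  let ?A = "\<lambda>\<omega>. G (restrict (\<lambda>i. X i \<omega>) {..<?m})" and ?B = "\<lambda>\<omega>. H (restrict (\<lambda>i. X i \<omega>) {?m})"
  have m: "?A \<in> borel_measurable P" "?B \<in> borel_measurable P"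
    using indep_var_rv1[OF iv2] indep_var_rv2[OF iv2] by (simp_all add: comp_def)
  have A: "?A \<omega> = cos (l * R n s \<omega>)" if \<omega>: "\<omega> \<in> space P" for \<omega>
  proof -
    have "E (real (Suc k) * h) \<omega> = cos (pi * (\<Sum>i<Suc k. restrict (\<lambda>i. X i \<omega>) {..<?m} i))" if k: "k < ?m" for k
    proof -
      have "(\<Sum>i<Suc k. restrict (\<lambda>i. X i \<omega>) {..<?m} i) = (\<Sum>i<Suc k. X i \<omega>)"
        using k by (intro sum.cong) auto
      also have "\<dots> = real (N (T (Suc k)) \<omega>)" by (rule telescope[OF \<omega>])
      also have "T (Suc k) = max 0 (real (Suc k) * h)" using k h by (simp add: T_def)
      finally show ?thesis by (simp only: E_cos)
    qed
    then have "(\<Sum>k<?m. h * cos (pi * (\<Sum>i<Suc k. restrict (\<lambda>i. X i \<omega>) {..<?m} i))) = R n s \<omega>"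
      unfolding R_def h_def[symmetric] by (intro sum.cong refl) (simp only: lessThan_iff)
    then show ?thesis by (simp only: G_def)
  qed
  have B: "?B \<omega> = E s \<omega> * E t \<omega>" if \<omega>: "\<omega> \<in> space P" for \<omega>
  proof -
    have "T ?m = s" "T (Suc ?m) = t" using mh by (simp_all add: T_def del: of_nat_Suc)
    then have "?B \<omega> = cos (pi * real (N t \<omega>) - pi * real (N s \<omega>))"
      by (simp add: H_def X_def right_diff_distrib)
    also have "\<dots> = cos (pi * real (N t \<omega>)) * cos (pi * real (N s \<omega>))"
      by (simp add: cos_diff mult.commute[of pi])
    finally show ?thesis using s st by (simp add: E_cos max_absorb2)
  qed
  have "expectation (\<lambda>\<omega>. ?A \<omega> * ?B \<omega>) = expectation ?A * expectation ?B"
    by (rule indep_var_lebesgue_integral[of ?A ?B])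
      (use iv2 m in \<open>auto simp: comp_def G_def H_def intro!: integrable_const_bound[where B = 1]\<close>)
  moreover have "expectation (\<lambda>\<omega>. ?A \<omega> * ?B \<omega>) = expectation (\<lambda>\<omega>. cos (l * R n s \<omega>) * (E s \<omega> * E t \<omega>))"
    "expectation ?A = expectation (\<lambda>\<omega>. cos (l * R n s \<omega>))" "expectation ?B = expectation (\<lambda>\<omega>. E s \<omega> * E t \<omega>)"
    by (rule Bochner_Integration.integral_cong; simp add: A B)+
  ultimately show ?thesis by (simp only:)
qed

lemma indep_\<tau>:
  assumes s: "0 \<le> s" and st: "s \<le> t"
  shows "expectation (\<lambda>\<omega>. cos (l * \<tau> s \<omega>) * (E s \<omega> * E t \<omega>)) =
    expectation (\<lambda>\<omega>. cos (l * \<tau> s \<omega>)) * exp (- 2 * a * (t - s))"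
proof -
  have [measurable]: "R n s \<in> borel_measurable P" for n unfolding R_def[abs_def] by measurable
  have lim: "AE \<omega> in P. (\<lambda>n. cos (l * R n s \<omega>)) \<longlonglongrightarrow> cos (l * \<tau> s \<omega>)"
    by (intro AE_I2 tendsto_intros R_tendsto s)
  have 1: "(\<lambda>n. expectation (\<lambda>\<omega>. cos (l * R n s \<omega>))) \<longlonglongrightarrow> expectation (\<lambda>\<omega>. cos (l * \<tau> s \<omega>))"
    by (rule integral_dominated_convergence[where w = "\<lambda>_. 1", OF _ _ _ lim]) auto
  have 2: "(\<lambda>n. expectation (\<lambda>\<omega>. cos (l * R n s \<omega>) * (E s \<omega> * E t \<omega>))) \<longlonglongrightarrow>
      expectation (\<lambda>\<omega>. cos (l * \<tau> s \<omega>) * (E s \<omega> * E t \<omega>))"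
  proof (rule integral_dominated_convergence[where w = "\<lambda>_. 1"])
    show "AE \<omega> in P. (\<lambda>n. cos (l * R n s \<omega>) * (E s \<omega> * E t \<omega>)) \<longlonglongrightarrow> cos (l * \<tau> s \<omega>) * (E s \<omega> * E t \<omega>)"
      using lim by eventually_elim (rule tendsto_mult_right)
    show "AE \<omega> in P. norm (cos (l * R n s \<omega>) * (E s \<omega> * E t \<omega>)) \<le> 1" for n
      by (simp add: abs_mult)
    show "(\<lambda>\<omega>. cos (l * \<tau> s \<omega>) * (E s \<omega> * E t \<omega>)) \<in> borel_measurable P" by measurable
    show "(\<lambda>\<omega>. cos (l * R n s \<omega>) * (E s \<omega> * E t \<omega>)) \<in> borel_measurable P" for n by measurable
  qed simp
  have "(\<lambda>n. expectation (\<lambda>\<omega>. cos (l * R n s \<omega>)) * exp (- 2 * a * (t - s))) \<longlonglongrightarrow>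
      expectation (\<lambda>\<omega>. cos (l * \<tau> s \<omega>)) * exp (- 2 * a * (t - s))"
    by (rule tendsto_mult_right[OF 1])
  then show ?thesis
    using 2 unfolding indep_R[OF s st] expectation_E_mult_E[OF s st] by (rule LIMSEQ_unique[rotated])
qed

text \<open>\<open>c\<close> is the real part of the characteristic function of the random time.
  \<open>S\<close> is the companion that closes the system: the random time has velocity
  \<open>E\<close>, so differentiating the cosine produces \<open>E\<close> times the sine.\<close>

definition c :: "real \<Rightarrow> real \<Rightarrow> real" where "c l t = expectation (\<lambda>\<omega>. cos (l * \<tau> t \<omega>))"
definition S :: "real \<Rightarrow> real \<Rightarrow> real" where "S l t = expectation (\<lambda>\<omega>. E t \<omega> * sin (l * \<tau> t \<omega>))"

lemma abs_c: "\<bar>c l t\<bar> \<le> 1" unfolding c_def by (rule abs_expectation_le) simp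
lemma abs_S: "\<bar>S l t\<bar> \<le> 1" unfolding S_def by (rule abs_expectation_le) (simp add: abs_mult)

lemma c_measurable [measurable]: "c l \<in> borel_measurable borel"
  unfolding c_def[abs_def] by measurable

lemma S_measurable [measurable]: "S l \<in> borel_measurable borel"
  unfolding S_def[abs_def] by measurable

lemma expectation_integral_swap:
  fixes f :: "real \<Rightarrow> 'p \<Rightarrow> real"
  assumes f: "(\<lambda>(r, \<omega>). f r \<omega>) \<in> borel_measurable (borel \<Otimes>\<^sub>M P)" and b: "\<And>r \<omega>. \<bar>f r \<omega>\<bar> \<le> C"
  shows "expectation (\<lambda>\<omega>. \<integral>r. indicator {0..t} r * f r \<omega> \<partial>lborel) =
    (\<integral>r. indicator {0..t} r * expectation (f r) \<partial>lborel)"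
proof -
  note [measurable] = f
  interpret Q: pair_sigma_finite lborel P ..
  have C: "0 \<le> C" using b abs_ge_zero order_trans by blast
  have "integrable (lborel \<Otimes>\<^sub>M P) (\<lambda>(r, \<omega>). indicator {0..t} r * f r \<omega>)"
  proof (rule Q.Fubini_integrable)
    show "(\<lambda>(r, \<omega>). indicator {0..t} r * f r \<omega>) \<in> borel_measurable (lborel \<Otimes>\<^sub>M P)" by measurable
    have fr: "integrable P (f r)" for r
    proof (rule integrable_const_bound[where B = C])
      have "(\<lambda>\<omega>. (r, \<omega>)) \<in> P \<rightarrow>\<^sub>M borel \<Otimes>\<^sub>M P" by measurable
      from measurable_compose[OF this f] show "f r \<in> borel_measurable P" by simp
    qed (use b in simp)
    then show "AE r in lborel. integrable P (\<lambda>\<omega>. case (r, \<omega>) of (r, \<omega>) \<Rightarrow> indicator {0..t} r * f r \<omega>)" by simp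
    show "integrable lborel (\<lambda>r. expectation (\<lambda>\<omega>. norm (case (r, \<omega>) of (r, \<omega>) \<Rightarrow> indicator {0..t} r * f r \<omega>)))"
    proof (rule Bochner_Integration.integrable_bound)
      show "integrable lborel (\<lambda>r. C * indicator {0..t} r :: real)"
        by (intro integrable_mult_right integrable_real_indicator) (auto simp: emeasure_lborel_Icc_eq)
      have "\<bar>expectation (\<lambda>\<omega>. \<bar>indicator {0..t} r * f r \<omega>\<bar>)\<bar> \<le> C * indicator {0..t} r" for r :: real
        by (rule abs_expectation_le) (use b in \<open>auto simp: abs_mult indicator_def\<close>)
      then show "AE r in lborel. norm (expectation (\<lambda>\<omega>. norm (case (r, \<omega>) of (r, \<omega>) \<Rightarrow> indicator {0..t} r * f r \<omega>)))
          \<le> norm (C * indicator {0..t} r :: real)"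
        unfolding real_norm_def prod.case by (intro AE_I2 order_trans[OF _ abs_ge_self])
      show "(\<lambda>r. expectation (\<lambda>\<omega>. norm (case (r, \<omega>) of (r, \<omega>) \<Rightarrow> indicator {0..t} r * f r \<omega>))) \<in> borel_measurable lborel"
        by measurable
    qed
  qed
  from Q.Fubini_integral[OF this] show ?thesis by (simp only: integral_mult_right_zero)
qed

lemma c_eq: "0 \<le> t \<Longrightarrow> c l t = 1 - l * (\<integral>r. indicator {0..t} r * S l r \<partial>lborel)"
proof -
  assume t: "0 \<le> t"
  have 1: "cos (l * \<tau> t \<omega>) = 1 - l * (\<integral>r. indicator {0..t} r * (E r \<omega> * sin (l * \<tau> r \<omega>)) \<partial>lborel)"
    if \<omega>: "\<omega> \<in> space P" for \<omega>
  proof -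
    have "\<bar>- (sin (l * x) * l)\<bar> \<le> \<bar>l\<bar>" for x
      by (simp add: abs_mult mult_left_le_one_le)
    then have "cos (l * \<tau> t \<omega>) - cos (l * 0) = (\<integral>r. indicator {0..t} r * (- (sin (l * \<tau> r \<omega>) * l) * E r \<omega>) \<partial>lborel)"
      by (intro \<tau>_chain[OF \<omega> t, where C = "\<bar>l\<bar>" and F = "\<lambda>x. cos (l * x)" and F' = "\<lambda>x. - (sin (l * x) * l)"])
        (auto intro!: derivative_eq_intros)
    also have "\<dots> = (\<integral>r. - l * (indicator {0..t} r * (E r \<omega> * sin (l * \<tau> r \<omega>))) \<partial>lborel)"
      by (simp add: mult_ac)
    finally show ?thesis by (simp only: integral_mult_right_zero) simp
  qed
  have m: "(\<lambda>\<omega>. \<integral>r. indicator {0..t} r * (E r \<omega> * sin (l * \<tau> r \<omega>)) \<partial>lborel) \<in> borel_measurable P"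
    by measurable
  have "c l t = expectation (\<lambda>\<omega>. 1 - l * (\<integral>r. indicator {0..t} r * (E r \<omega> * sin (l * \<tau> r \<omega>)) \<partial>lborel))"
    unfolding c_def by (rule Bochner_Integration.integral_cong[OF refl 1])
  also have "\<dots> = 1 - l * expectation (\<lambda>\<omega>. \<integral>r. indicator {0..t} r * (E r \<omega> * sin (l * \<tau> r \<omega>)) \<partial>lborel)"
  proof (cases "l = 0")
    case False
    \<comment> \<open>By the pathwise identity \<open>1\<close> this product equals 1 - cos (l
      \<tau>), which lies between 0 and 2.\<close>
    have "integrable P (\<lambda>\<omega>. l * (\<integral>r. indicator {0..t} r * (E r \<omega> * sin (l * \<tau> r \<omega>)) \<partial>lborel))"
    proof (rule integrable_const_bound[where B = 2])
      show "AE \<omega> in P. norm (l * (\<integral>r. indicator {0..t} r * (E r \<omega> * sin (l * \<tau> r \<omega>)) \<partial>lborel)) \<le> 2"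
      proof (intro AE_I2)
        fix \<omega> assume "\<omega> \<in> space P"
        from 1[OF this] show "norm (l * (\<integral>r. indicator {0..t} r * (E r \<omega> * sin (l * \<tau> r \<omega>)) \<partial>lborel)) \<le> 2"
          using abs_cos_le_one[of "l * \<tau> t \<omega>"] unfolding real_norm_def abs_le_iff by linarith
      qed
    qed (use m in measurable)
    then show ?thesis by (simp add: prob_space)
  qed (simp add: prob_space)
  also have "\<dots> = 1 - l * (\<integral>r. indicator {0..t} r * S l r \<partial>lborel)"
    unfolding S_def
    by (subst expectation_integral_swap[where C = 1 and f = "\<lambda>r \<omega>. E r \<omega> * sin (l * \<tau> r \<omega>)"]) (measurable, auto simp: abs_mult)
  finally show ?thesis .
qed

text \<open>Variation of constants for S' = l c - 2 a S. The factor \<open>E t\<close> is moved into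
  the integral of the chain rule and meets \<open>E r\<close>; the parity of the increment from r to
  t is independent of the past and has mean exp (- 2 a (t - r)).\<close>

lemma S_eq: "0 \<le> t \<Longrightarrow> S l t = l * exp (- 2 * a * t) * (\<integral>r. indicator {0..t} r * (exp (2 * a * r) * c l r) \<partial>lborel)"
proof -
  assume t: "0 \<le> t"
  have 1: "E t \<omega> * sin (l * \<tau> t \<omega>) = (\<integral>r. indicator {0..t} r * (l * (cos (l * \<tau> r \<omega>) * (E r \<omega> * E t \<omega>))) \<partial>lborel)"
    if \<omega>: "\<omega> \<in> space P" for \<omega>
  proof -
    have "\<bar>cos (l * x) * l\<bar> \<le> \<bar>l\<bar>" for x
      by (simp add: abs_mult mult_left_le_one_le)
    then have "sin (l * \<tau> t \<omega>) - sin (l * 0) = (\<integral>r. indicator {0..t} r * ((cos (l * \<tau> r \<omega>) * l) * E r \<omega>) \<partial>lborel)"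
      by (intro \<tau>_chain[OF \<omega> t, where C = "\<bar>l\<bar>" and F = "\<lambda>x. sin (l * x)" and F' = "\<lambda>x. cos (l * x) * l"])
        (auto intro!: derivative_eq_intros)
    then have "E t \<omega> * sin (l * \<tau> t \<omega>) = (\<integral>r. E t \<omega> * (indicator {0..t} r * ((cos (l * \<tau> r \<omega>) * l) * E r \<omega>)) \<partial>lborel)"
      by simp
    then show ?thesis by (simp add: mult_ac)
  qed
  have "S l t = expectation (\<lambda>\<omega>. \<integral>r. indicator {0..t} r * (l * (cos (l * \<tau> r \<omega>) * (E r \<omega> * E t \<omega>))) \<partial>lborel)"
    unfolding S_def by (rule Bochner_Integration.integral_cong[OF refl 1])
  also have "\<dots> = (\<integral>r. indicator {0..t} r * expectation (\<lambda>\<omega>. l * (cos (l * \<tau> r \<omega>) * (E r \<omega> * E t \<omega>))) \<partial>lborel)"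
  proof (rule expectation_integral_swap[where C = "\<bar>l\<bar>"])
    show "(\<lambda>(r, \<omega>). l * (cos (l * \<tau> r \<omega>) * (E r \<omega> * E t \<omega>))) \<in> borel_measurable (borel \<Otimes>\<^sub>M P)" by measurable
    show "\<bar>l * (cos (l * \<tau> r \<omega>) * (E r \<omega> * E t \<omega>))\<bar> \<le> \<bar>l\<bar>" for r \<omega>
      by (simp add: abs_mult mult_left_le)
  qed
  also have "\<dots> = (\<integral>r. l * exp (- 2 * a * t) * (indicator {0..t} r * (exp (2 * a * r) * c l r)) \<partial>lborel)"
  proof (rule Bochner_Integration.integral_cong[OF refl])
    fix r
    show "indicator {0..t} r * expectation (\<lambda>\<omega>. l * (cos (l * \<tau> r \<omega>) * (E r \<omega> * E t \<omega>))) =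
      l * exp (- 2 * a * t) * (indicator {0..t} r * (exp (2 * a * r) * c l r))"
    proof (cases "r \<in> {0..t}")
      case True
      have "exp (- 2 * a * (t - r)) = exp (- 2 * a * t) * exp (2 * a * r)"
        by (simp add: right_diff_distrib flip: exp_add)
      then show ?thesis using True
        by (simp only: integral_mult_right_zero indep_\<tau> atLeastAtMost_iff) (simp add: c_def)
    qed simp
  qed
  finally show ?thesis by (simp only: integral_mult_right_zero)
qed

section \<open>From integral equations to the telegraph system\<close>

lemma indicator_integral_HK:
  fixes f :: "real \<Rightarrow> real"
  assumes [measurable]: "f \<in> borel_measurable borel" and b: "\<And>r. r \<in> {0..t} \<Longrightarrow> \<bar>f r\<bar> \<le> C"
  shows "f integrable_on {0..t}" "(\<integral>r. indicator {0..t} r * f r \<partial>lborel) = integral {0..t} f"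
proof -
  have si: "set_integrable lborel {0..t} f"
    unfolding set_integrable_def
  proof (rule Bochner_Integration.integrable_bound[of _ "\<lambda>s. C * indicator {0..t} s :: real"])
    show "AE r in lborel. norm (indicator {0..t} r *\<^sub>R f r) \<le> norm (C * indicator {0..t} r :: real)"
      using order_trans[OF b abs_ge_self] by (auto simp: indicator_def)
    show "integrable lborel (\<lambda>s. C * indicator {0..t} s :: real)"
      by (intro integrable_mult_right integrable_real_indicator) (auto simp: emeasure_lborel_Icc_eq)
    show "(\<lambda>r. indicator {0..t} r *\<^sub>R f r) \<in> borel_measurable lborel" by measurable
  qed
  show "f integrable_on {0..t}" "(\<integral>r. indicator {0..t} r * f r \<partial>lborel) = integral {0..t} f"
    using set_borel_integral_eq_integral[OF si] by (simp_all add: set_lebesgue_integral_def)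
qed

lemma abs_exp_c_le: "r \<in> {0..t} \<Longrightarrow> \<bar>exp (2 * a * r) * c l r\<bar> \<le> exp (2 * a * t)"
  using mult_mono[of "exp (2 * a * r)" "exp (2 * a * t)" "\<bar>c l r\<bar>" 1] abs_c[of l r] a
  by (simp add: abs_mult)

lemma c_HK: "0 \<le> t \<Longrightarrow> c l t = 1 - l * integral {0..t} (S l)"
  using c_eq[of t l] indicator_integral_HK(2)[OF S_measurable abs_S, of t l] by (simp only:)

lemma S_HK: "0 \<le> t \<Longrightarrow> S l t = l * exp (- 2 * a * t) * integral {0..t} (\<lambda>r. exp (2 * a * r) * c l r)"
  using S_eq[of t l] indicator_integral_HK(2)[where f = "\<lambda>r. exp (2 * a * r) * c l r" and t = t, OF _ abs_exp_c_le[where t = t]]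
  by simp

lemma continuous_on_atLeast_0:
  fixes f :: "real \<Rightarrow> real"
  assumes "\<And>b. 0 \<le> b \<Longrightarrow> continuous_on {0..b} f"
  shows "continuous_on {0..} f"
  unfolding continuous_on_eq_continuous_within
proof
  fix x :: real assume x: "x \<in> {0..}"
  have "continuous (at x within {0..x + 1}) f"
    using assms[of "x + 1"] x by (simp add: continuous_on_eq_continuous_within)
  moreover have "at x within {0..x + 1} = at x within {0..}"
    by (rule at_within_nhd[of x "{..<x + 1}"]) auto
  ultimately show "continuous (at x within {0..}) f" by simp
qed

lemma S_continuous: "continuous_on {0..} (S l)"
proof (rule continuous_on_atLeast_0)
  fix b :: real
  have "continuous_on {0..b} (\<lambda>t. l * exp (- 2 * a * t) * integral {0..t} (\<lambda>r. exp (2 * a * r) * c l r))"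
    by (intro continuous_intros indefinite_integral_continuous_1 indicator_integral_HK(1)[OF _ abs_exp_c_le]) simp
  then show "continuous_on {0..b} (S l)"
    by (rule continuous_on_eq) (simp add: S_HK)
qed

lemma c_continuous: "continuous_on {0..} (c l)"
proof (rule continuous_on_atLeast_0)
  fix b :: real
  have "continuous_on {0..b} (\<lambda>t. 1 - l * integral {0..t} (S l))"
    by (intro continuous_intros indefinite_integral_continuous_1 indicator_integral_HK(1)[OF S_measurable abs_S])
  then show "continuous_on {0..b} (c l)"
    by (rule continuous_on_eq) (simp add: c_HK)
qed

lemma integral_deriv_atLeast_0:
  fixes f :: "real \<Rightarrow> real"
  assumes "continuous_on {0..} f" "0 \<le> t"
  shows "((\<lambda>x. integral {0..x} f) has_real_derivative f t) (at t within {0..})"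
proof -
  have "continuous_on {0..t + 1} f" by (rule continuous_on_subset[OF assms(1)]) auto
  then have "((\<lambda>x. integral {0..x} f) has_real_derivative f t) (at t within {0..t + 1})"
    by (rule integral_has_real_derivative) (use assms in auto)
  moreover have "at t within {0..t + 1} = at t within {0..}"
    by (rule at_within_nhd[of t "{..<t + 1}"]) auto
  ultimately show ?thesis by simp
qed

lemma c_deriv:
  assumes t: "0 \<le> t"
  shows "(c l has_real_derivative - l * S l t) (at t within {0..})"
proof -
  have "((\<lambda>t. 1 - l * integral {0..t} (S l)) has_real_derivative - l * S l t) (at t within {0..})"
    by (rule derivative_eq_intros integral_deriv_atLeast_0 S_continuous t refl | simp)+
  then show ?thesis
    by (rule has_field_derivative_transform_within[where d = 1]) (use t in \<open>simp_all add: c_HK\<close>)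
qed

lemma S_deriv:
  assumes t: "0 \<le> t"
  shows "(S l has_real_derivative l * c l t - 2 * a * S l t) (at t within {0..})"
proof -
  have "continuous_on {0..} (\<lambda>r. exp (2 * a * r) * c l r)" by (intro continuous_intros c_continuous)
  note d = integral_deriv_atLeast_0[OF this t]
  have "((\<lambda>t. l * exp (- 2 * a * t) * integral {0..t} (\<lambda>r. exp (2 * a * r) * c l r)) has_real_derivative
      l * (exp (- 2 * a * t) * exp (2 * a * t)) * c l t - 2 * a * S l t) (at t within {0..})"
    by (rule derivative_eq_intros d refl | simp)+ (simp add: S_HK[OF t] algebra_simps)
  then have "((\<lambda>t. l * exp (- 2 * a * t) * integral {0..t} (\<lambda>r. exp (2 * a * r) * c l r)) has_real_derivative
      l * c l t - 2 * a * S l t) (at t within {0..})"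
    by (simp flip: exp_add)
  then show ?thesis
    by (rule has_field_derivative_transform_within[where d = 1]) (use t in \<open>simp_all add: S_HK\<close>)
qed

lemma rescale_deriv:
  assumes "(f has_real_derivative D) (at (T / a) within {0..})" "0 \<le> T"
  shows "((\<lambda>T. f (T / a)) has_real_derivative D * (1 / a)) (at T within {0..})"
proof -
  have "(\<lambda>T. T / a) ` {0..} \<subseteq> {0..}" using a by auto
  then have "(f has_real_derivative D) (at (T / a) within (\<lambda>T. T / a) ` {0..})"
    using assms(1) by (rule has_field_derivative_subset[rotated])
  moreover have "((\<lambda>T. T / a) has_real_derivative 1 / a) (at T within {0..})"
    using a by (auto intro!: derivative_eq_intros)
  ultimately show ?thesis
    using DERIV_image_chain[of f D "\<lambda>T. T / a" T "{0..}" "1 / a"] by (simp add: comp_def)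
qed

text \<open>Time is measured in units of 1 / a, with k = |l| / a; since the cosine is even, passing
  to |l| does not change \<open>c\<close>. Then (k^2 / 2) (a t) = l^2 t / (2 a).\<close>

lemma char_estimate:
  assumes t: "0 < t"
  shows "\<bar>c l t - exp (- (l\<^sup>2 * t / (2 * a)))\<bar> \<le> 37 / (a * t)"
proof -
  let ?l = "\<bar>l\<bar>"
  interpret tg: telegraph "\<lambda>T. c ?l (T / a)" "\<lambda>T. S ?l (T / a)" "?l / a"
  proof
    show "0 \<le> ?l / a" using a by simp
    show "((\<lambda>T. c ?l (T / a)) has_real_derivative - (?l / a) * S ?l (T / a)) (at T within {0..})" if "0 \<le> T" for T
      by (rule DERIV_cong[OF rescale_deriv[OF c_deriv]]) (use that a in auto)
    show "((\<lambda>T. S ?l (T / a)) has_real_derivative ?l / a * c ?l (T / a) - 2 * S ?l (T / a)) (at T within {0..})"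
      if "0 \<le> T" for T
      by (rule DERIV_cong[OF rescale_deriv[OF S_deriv]]) (use that a in \<open>auto simp: field_simps\<close>)
    show "c ?l (0 / a) = 1" by (simp add: c_def \<tau>_0 prob_space)
    show "S ?l (0 / a) = 0" by (simp add: S_def \<tau>_0)
  qed
  have 1: "c ?l t = c l t" by (cases "0 \<le> l") (simp_all add: c_def)
  have 2: "- ((?l / a)\<^sup>2 / 2) * (a * t) = - (l\<^sup>2 * t / (2 * a))"
    using a by (simp add: power_divide power2_eq_square)
  have 3: "a * t / a = t" "0 < a * t" using a t by simp_all
  show ?thesis
    using tg.estimate[OF 3(2)] by (simp only: 1 2 3(1))
qed

end

section \<open>The diffusion limit\<close>

text \<open>The double integral is the squared norm of the Gaussian mean of
  \<open>cos (l * (y / \<delta>)) *\<^sub>R w (y / \<delta>)\<close>, expanded by d'Alembert's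
  formula.\<close>

lemma (in wave_family) gauss_pd_g:
  assumes meas: "(\<lambda>(t, x). w t x) \<in> borel_measurable (borel \<Otimes>\<^sub>M lborel)"
  shows "gauss_pd g"
proof
  show "continuous_on UNIV g" by (rule g_continuous)
  show "g (- t) = g t" for t by (rule g_even)
  show "\<bar>g t\<bar> \<le> g 0" for t by (rule g_bound)
  fix l \<delta> :: real
  let ?X = "\<lambda>y x. cos (l * (y / \<delta>)) *\<^sub>R w (y / \<delta>) x"
  interpret X: L2_family \<nu> ?X "L2_norm f"
  proof
    note [measurable] = meas
    have "(\<lambda>p. w (fst p / \<delta>) (snd p)) \<in> borel_measurable (borel \<Otimes>\<^sub>M lborel)"
    proof -
      have "(\<lambda>p. (fst p / \<delta>, snd p)) \<in> borel \<Otimes>\<^sub>M lborel \<rightarrow>\<^sub>M borel \<Otimes>\<^sub>M (lborel :: 'a measure)" by measurable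
      from measurable_compose[OF this meas] show ?thesis by simp
    qed
    then have "(\<lambda>p. cos (l * (fst p / \<delta>)) *\<^sub>R w (fst p / \<delta>) (snd p)) \<in> borel_measurable (borel \<Otimes>\<^sub>M lborel)"
      by measurable
    moreover have "sets (\<nu> \<Otimes>\<^sub>M lborel) = sets (borel \<Otimes>\<^sub>M (lborel :: 'a measure))"
      by (rule sets_pair_measure_cong) auto
    ultimately show "(\<lambda>(s, x). ?X s x) \<in> borel_measurable (\<nu> \<Otimes>\<^sub>M lborel)"
      by (simp add: split_beta cong: measurable_cong_sets)
    show "?X s \<in> L2" for s by (rule L2_scaleR[OF wL2])
    have "\<bar>cos (l * (s / \<delta>))\<bar> * L2_norm (w (s / \<delta>)) \<le> 1 * L2_norm f" for s
      by (intro mult_mono abs_cos_le_one norm_w_le L2_norm_nonneg) simp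
    then show "L2_norm (?X s) \<le> L2_norm f" for s
      by (simp only: L2_norm_scaleR mult_1)
  qed
  have "0 \<le> ip X.mean X.mean" by (rule ip_nonneg)
  also have "\<dots> = (\<integral>y. ip (?X y) X.mean \<partial>\<nu>)" by (rule X.ip_mean[OF X.mean_L2])
  also have "\<dots> = (\<integral>y. (\<integral>x. ip (?X x) (?X y) \<partial>\<nu>) \<partial>\<nu>)"
    by (subst ip_commute) (simp only: X.ip_mean[OF X.XL2])
  also have "\<dots> = (\<integral>y. (\<integral>x. cos (l * (x / \<delta>)) * cos (l * (y / \<delta>)) * ((g (x / \<delta> + y / \<delta>) + g (x / \<delta> - y / \<delta>)) / 2) \<partial>\<nu>) \<partial>\<nu>)"
    by (simp only: ip_scaleR_left ip_scaleR_right self.dalembert mult.assoc)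
  finally show "0 \<le> (\<integral>y. (\<integral>x. cos (l * (x / \<delta>)) * cos (l * (y / \<delta>)) * ((g (x / \<delta> + y / \<delta>) + g (x / \<delta> - y / \<delta>)) / 2) \<partial>\<nu>) \<partial>\<nu>)" .
qed

text \<open>The squared distance of the two means expands into three inner products, each a double
  average of \<open>g\<close> by d'Alembert's formula; \<open>I_bound\<close> estimates their
  combination.\<close>

lemma wave_pair_mean_bound:
  fixes w v :: "real \<Rightarrow> 'a::euclidean_space \<Rightarrow> complex"
  assumes wp: "wave_pair f w w' w'' v v' v''"
    and mw: "(\<lambda>(t, x). w t x) \<in> borel_measurable (borel \<Otimes>\<^sub>M lborel)"
    and mv: "(\<lambda>(t, x). v t x) \<in> borel_measurable (borel \<Otimes>\<^sub>M lborel)"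
    and \<alpha>: "prob_space \<alpha>" and \<beta>: "prob_space \<beta>" and s: "sets \<alpha> = sets borel" "sets \<beta> = sets borel"
    and M: "\<And>l. \<bar>(\<integral>t. cos (l * t) \<partial>\<alpha>) - (\<integral>t. cos (l * t) \<partial>\<beta>)\<bar> \<le> M"
  shows "(\<lambda>x. (\<integral>t. w t x \<partial>\<alpha>) - (\<integral>t. v t x \<partial>\<beta>)) \<in> L2"
    and "(L2_norm (\<lambda>x. (\<integral>t. w t x \<partial>\<alpha>) - (\<integral>t. v t x \<partial>\<beta>)))\<^sup>2 \<le> 2 * M\<^sup>2 * (L2_norm f)\<^sup>2"
proof -
  interpret wave_pair f w w' w'' v v' v'' by (rule wp)
  interpret G: gauss_pd W.g by (rule W.gauss_pd_g[OF mw])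
  have cong: "sets (\<gamma> \<Otimes>\<^sub>M lborel) = sets (borel \<Otimes>\<^sub>M (lborel :: 'a measure))" if "sets \<gamma> = sets borel" for \<gamma> :: "real measure"
    by (rule sets_pair_measure_cong) (use that in auto)
  interpret X: L2_family \<alpha> w "L2_norm f"
    by (intro L2_family.intro L2_family_axioms.intro \<alpha> W.wL2 W.norm_w_le)
      (use mw in \<open>simp only: measurable_cong_sets[OF cong[OF s(1)] refl]\<close>)
  interpret Y: L2_family \<beta> v "L2_norm f"
    by (intro L2_family.intro L2_family_axioms.intro \<beta> V.wL2 V.norm_w_le)
      (use mv in \<open>simp only: measurable_cong_sets[OF cong[OF s(2)] refl]\<close>)
  have D: "(\<lambda>x. (\<integral>t. w t x \<partial>\<alpha>) - (\<integral>t. v t x \<partial>\<beta>)) = (\<lambda>x. X.mean x - Y.mean x)"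
    by (simp add: X.mean_def Y.mean_def)
  show "(\<lambda>x. (\<integral>t. w t x \<partial>\<alpha>) - (\<integral>t. v t x \<partial>\<beta>)) \<in> L2"
    unfolding D by (intro L2_diff X.mean_L2 Y.mean_L2)
  have "ip X.mean X.mean = (\<integral>t. ip X.mean (w t) \<partial>\<alpha>)"
    by (subst X.ip_mean[OF X.mean_L2]) (simp only: ip_commute)
  also have "\<dots> = G.I \<alpha> \<alpha> W.g"
    unfolding G.I_def X.ip_mean[OF W.wL2] by (subst ip_commute) (simp only: W.self.dalembert)
  finally have XX: "ip X.mean X.mean = G.I \<alpha> \<alpha> W.g" .
  have "ip Y.mean Y.mean = (\<integral>t. ip Y.mean (v t) \<partial>\<beta>)"
    by (subst Y.ip_mean[OF Y.mean_L2]) (simp only: ip_commute)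
  also have "\<dots> = G.I \<beta> \<beta> W.g"
    unfolding G.I_def Y.ip_mean[OF V.wL2] by (subst ip_commute) (simp only: V.self.dalembert g_eq)
  finally have YY: "ip Y.mean Y.mean = G.I \<beta> \<beta> W.g" .
  have "ip X.mean Y.mean = (\<integral>t. ip Y.mean (w t) \<partial>\<alpha>)"
    by (subst X.ip_mean[OF Y.mean_L2]) (simp only: ip_commute)
  also have "\<dots> = G.I \<alpha> \<beta> W.g"
    unfolding G.I_def Y.ip_mean[OF W.wL2] by (subst ip_commute) (simp only: dalembert)
  finally have XY: "ip X.mean Y.mean = G.I \<alpha> \<beta> W.g" .
  have "(L2_norm (\<lambda>x. X.mean x - Y.mean x))\<^sup>2 = ip X.mean X.mean - 2 * ip X.mean Y.mean + ip Y.mean Y.mean"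
    using ip_expand[OF X.mean_L2 Y.mean_L2, of 1 1] by (simp add: L2_norm_sq)
  also have "\<dots> \<le> 2 * M\<^sup>2 * W.g 0"
    unfolding XX XY YY by (rule G.I_bound[OF \<alpha> \<beta> s]) (use M in \<open>simp add: G.m_def\<close>)
  finally show "(L2_norm (\<lambda>x. (\<integral>t. w t x \<partial>\<alpha>) - (\<integral>t. v t x \<partial>\<beta>)))\<^sup>2 \<le> 2 * M\<^sup>2 * (L2_norm f)\<^sup>2"
    unfolding D W.g_0 .
qed

lemma wiener_process_cos:
  assumes W: "wiener_process Q W" and t: "0 < t"
  shows "(\<integral>\<omega>. cos (l * W t \<omega>) \<partial>Q) = exp (- (l\<^sup>2 * t / 2))"
proof -
  have d: "distributed Q lborel (\<lambda>\<omega>. W t \<omega> - W 0 \<omega>) (normal_density 0 (sqrt t))"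
  proof -
    have "\<forall>s t. 0 \<le> s \<and> s < t \<longrightarrow>
        distributed Q lborel (\<lambda>\<omega>. W t \<omega> - W s \<omega>) (normal_density 0 (sqrt (t - s)))"
      using W by (simp add: wiener_process_def)
    from this[rule_format, of 0 t] t show ?thesis by simp
  qed
  have W0: "\<omega> \<in> space Q \<Longrightarrow> W 0 \<omega> = 0" for \<omega> using W by (simp add: wiener_process_def)
  have "(\<integral>\<omega>. cos (l * W t \<omega>) \<partial>Q) = (\<integral>\<omega>. cos (l * (W t \<omega> - W 0 \<omega>)) \<partial>Q)"
    by (rule Bochner_Integration.integral_cong) (simp_all add: W0)
  also have "\<dots> = (\<integral>x. normal_density 0 (sqrt t) x * cos (l * x) \<partial>lborel)"
    by (rule distributed_integral[OF d, symmetric]) (auto simp: normal_density_nonneg)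
  also have "\<dots> = \<bar>sqrt t\<bar> *\<^sub>R (\<integral>x. normal_density 0 (sqrt t) (0 + sqrt t * x) * cos (l * (0 + sqrt t * x)) \<partial>lborel)"
    by (rule lborel_integral_real_affine) (use t in simp)
  also have "\<dots> = (\<integral>x. std_normal_density x * cos ((l * sqrt t) * x) \<partial>lborel)"
  proof -
    have "sqrt t * normal_density 0 (sqrt t) (0 + sqrt t * x) = std_normal_density x" for x
      using t by (simp add: normal_density_def power_mult_distrib real_sqrt_mult)
    then have "std_normal_density x * cos ((l * sqrt t) * x) =
        sqrt t * (normal_density 0 (sqrt t) (0 + sqrt t * x) * cos (l * (0 + sqrt t * x)))" for x
      by (metis add_0 mult.assoc)
    then show ?thesis using t by simp
  qed
  also have "\<dots> = (\<integral>x. cos ((l * sqrt t) * x) \<partial>\<nu>)"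
    by (rule integral_\<nu>[symmetric]) measurable
  finally show ?thesis
    using t by (simp add: integral_cos_\<nu> power_mult_distrib)
qed

theorem theorem5p4:
  fixes c0 :: real
  assumes "c0 > 0"
  shows "\<exists>C :: real.
    \<forall>(f0 :: 'a::euclidean_space \<Rightarrow> complex) (a :: real) (c :: real) (\<sigma> :: real)
      (wc :: real \<Rightarrow> 'a \<Rightarrow> complex) (w1 :: real \<Rightarrow> 'a \<Rightarrow> complex)
      (P :: 'p measure) (N :: real \<Rightarrow> 'p \<Rightarrow> nat)
      (Q :: 'q measure) (W :: real \<Rightarrow> 'q \<Rightarrow> real)
      (u :: real \<Rightarrow> 'a \<Rightarrow> complex) (h :: real \<Rightarrow> 'a \<Rightarrow> complex).
      f0 \<in> H2 \<and> a > 0 \<and> c \<ge> c0 \<and> \<sigma> > 0 \<and> \<sigma>\<^sup>2 = c\<^sup>2 / a \<and>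
      wave_solution c f0 wc \<and> wave_solution 1 f0 w1 \<and>
      poisson_process P a N \<and> wiener_process Q W \<and>
      u = (\<lambda>t x. \<integral>\<omega>. wc (random_time N t \<omega>) x \<partial>P) \<and>
      h = (\<lambda>t x. \<integral>\<omega>. w1 (\<sigma> * W t \<omega>) x \<partial>Q)
      \<longrightarrow> (\<forall>t>0. (\<lambda>x. h t x - u t x) \<in> L2 \<and>
             L2_norm (\<lambda>x. h t x - u t x)
               \<le> C * H2_norm f0 * (1 / (a * t) + 1 / (c * sqrt (t * a))))"
proof (intro exI[of _ 53] allI impI, elim conjE)
  fix f0 :: "'a \<Rightarrow> complex" and a c \<sigma> :: real and wc w1 :: "real \<Rightarrow> 'a \<Rightarrow> complex"
    and P :: "'p measure" and N :: "real \<Rightarrow> 'p \<Rightarrow> nat" and Q :: "'q measure" and W :: "real \<Rightarrow> 'q \<Rightarrow> real"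
    and u h :: "real \<Rightarrow> 'a \<Rightarrow> complex" and t :: real
  assume f0: "f0 \<in> H2" and a: "a > 0" and cc0: "c \<ge> c0" and "\<sigma> > 0" and \<sigma>: "\<sigma>\<^sup>2 = c\<^sup>2 / a"
    and wc: "wave_solution c f0 wc" and w1: "wave_solution 1 f0 w1"
    and N: "poisson_process P a N" and W: "wiener_process Q W"
    and u: "u = (\<lambda>t x. \<integral>\<omega>. wc (random_time N t \<omega>) x \<partial>P)"
    and h: "h = (\<lambda>t x. \<integral>\<omega>. w1 (\<sigma> * W t \<omega>) x \<partial>Q)" and t: "t > 0"
  have c: "0 < c" using assms cc0 by linarith
  obtain w1' w1'' where F1: "wave_family f0 (\<lambda>t. w1 (t / 1)) w1' w1''"
    using wave_solution_family[OF f0 w1 zero_less_one] by blast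
  obtain wc' wc'' where Fc: "wave_family f0 (\<lambda>t. wc (t / c)) wc' wc''"
    using wave_solution_family[OF f0 wc c] by blast
  have meas: "(\<lambda>p. w (fst p / k) (snd p)) \<in> borel_measurable (borel \<Otimes>\<^sub>M lborel)"
    if "wave_solution k f0 w" for k and w :: "real \<Rightarrow> 'a \<Rightarrow> complex"
  proof -
    have w: "(\<lambda>(t, x). w t x) \<in> borel_measurable (lborel \<Otimes>\<^sub>M lborel)"
      using that by (simp add: wave_solution_def)
    have "(\<lambda>p. (fst p / k, snd p)) \<in> borel \<Otimes>\<^sub>M lborel \<rightarrow>\<^sub>M lborel \<Otimes>\<^sub>M (lborel :: 'a measure)" by measurable
    from measurable_compose[OF this w] show ?thesis by simp
  qed
  have msec: "(\<lambda>s. w (s / k) x) \<in> borel_measurable borel"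
    if "wave_solution k f0 w" for k x and w :: "real \<Rightarrow> 'a \<Rightarrow> complex"
  proof -
    have "(\<lambda>s. (s, x)) \<in> borel \<rightarrow>\<^sub>M borel \<Otimes>\<^sub>M (lborel :: 'a measure)" by measurable
    from measurable_compose[OF this meas[OF that]] show ?thesis by simp
  qed
  interpret poisson P a N by (rule poisson.intro[OF N a])
  interpret Q: prob_space Q using W by (simp add: wiener_process_def)
  have Wm [measurable]: "W t \<in> borel_measurable Q" using W t by (simp add: wiener_process_def)
  \<comment> \<open>\<open>w1\<close> has speed 1 already, while \<open>wc (s / c)\<close> has speed
    1 in the variable \<open>s\<close>; the random times are therefore \<open>\<sigma> * W t\<close>
    and \<open>c * \<tau> t\<close>.\<close>
  define \<alpha> where "\<alpha> = distr Q borel (\<lambda>\<omega>. \<sigma> * W t \<omega>)"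
  define \<beta> where "\<beta> = distr P borel (\<lambda>\<omega>. c * random_time N t \<omega>)"
  have \<alpha>: "prob_space \<alpha>" "sets \<alpha> = sets borel"
    unfolding \<alpha>_def by (auto intro!: Q.prob_space_distr)
  have \<beta>: "prob_space \<beta>" "sets \<beta> = sets borel"
    unfolding \<beta>_def by (auto intro!: prob_space_distr)
  have hx: "h t x = (\<integral>s. w1 (s / 1) x \<partial>\<alpha>)" for x
    unfolding h \<alpha>_def by (subst integral_distr[OF _ msec[OF w1]]) auto
  have ux: "u t x = (\<integral>s. wc (s / c) x \<partial>\<beta>)" for x
    unfolding u \<beta>_def by (subst integral_distr[OF _ msec[OF wc]]) (use c in auto)
  have M: "\<bar>(\<integral>s. cos (l * s) \<partial>\<alpha>) - (\<integral>s. cos (l * s) \<partial>\<beta>)\<bar> \<le> 37 / (a * t)" for l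
  proof -
    have "(\<integral>s. cos (l * s) \<partial>\<alpha>) = (\<integral>\<omega>. cos ((l * \<sigma>) * W t \<omega>) \<partial>Q)"
      unfolding \<alpha>_def by (subst integral_distr) (auto simp: mult.assoc)
    also have "\<dots> = exp (- ((l * \<sigma>)\<^sup>2 * t / 2))" by (rule wiener_process_cos[OF W t])
    \<comment> \<open>The relation \<sigma>^2 = c^2 / a matches the Gaussian exponent with the one
      in \<open>char_estimate\<close> at frequency \<open>l * c\<close>.\<close>
    also have "(l * \<sigma>)\<^sup>2 * t / 2 = (l * c)\<^sup>2 * t / (2 * a)"
      by (simp add: power_mult_distrib \<sigma>)
    finally have 1: "(\<integral>s. cos (l * s) \<partial>\<alpha>) = exp (- ((l * c)\<^sup>2 * t / (2 * a)))" .
    have 2: "(\<integral>s. cos (l * s) \<partial>\<beta>) = poisson.c P N (l * c) t"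
      unfolding \<beta>_def c_def by (subst integral_distr) (auto simp: mult.assoc)
    show ?thesis unfolding 1 2 using char_estimate[OF t, of "l * c"] by (simp only: abs_minus_commute)
  qed
  have m1: "(\<lambda>(t, x). w1 (t / 1) x) \<in> borel_measurable (borel \<Otimes>\<^sub>M lborel)"
    and mc: "(\<lambda>(t, x). wc (t / c) x) \<in> borel_measurable (borel \<Otimes>\<^sub>M lborel)"
    using meas[OF w1] meas[OF wc] by (simp_all add: case_prod_unfold)
  note bound = wave_pair_mean_bound[OF wave_pair.intro[OF F1 Fc] m1 mc \<alpha>(1) \<beta>(1) \<alpha>(2) \<beta>(2) M, folded hx ux]
  show "(\<lambda>x. h t x - u t x) \<in> L2 \<and> L2_norm (\<lambda>x. h t x - u t x)
      \<le> 53 * H2_norm f0 * (1 / (a * t) + 1 / (c * sqrt (t * a)))"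
  proof
    show "(\<lambda>x. h t x - u t x) \<in> L2" by (rule bound(1))
    have "(L2_norm (\<lambda>x. h t x - u t x))\<^sup>2 \<le> 2 * (37 / (a * t))\<^sup>2 * (L2_norm f0)\<^sup>2" by (rule bound(2))
    \<comment> \<open>2738 = 2 * 37^2 is rounded up to the square 2809 = 53^2.\<close>
    also have "\<dots> = 2738 * (L2_norm f0 * (1 / (a * t)))\<^sup>2"
      by (simp add: power_mult_distrib power_divide)
    also have "\<dots> \<le> 2809 * (L2_norm f0 * (1 / (a * t)))\<^sup>2"
      by (intro mult_right_mono) auto
    also have "\<dots> = (53 * L2_norm f0 * (1 / (a * t)))\<^sup>2"
      by (simp only: power_mult_distrib) simp
    finally have "L2_norm (\<lambda>x. h t x - u t x) \<le> 53 * L2_norm f0 * (1 / (a * t))"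
      by (rule power2_le_imp_le) (use a t L2_norm_nonneg[of f0] in simp)
    also have "\<dots> \<le> 53 * H2_norm f0 * (1 / (a * t) + 1 / (c * sqrt (t * a)))"
      using L2_norm_le_H2_norm[OF f0] L2_norm_nonneg[of f0] a t c
      by (intro mult_mono) auto
    finally show "L2_norm (\<lambda>x. h t x - u t x)
      \<le> 53 * H2_norm f0 * (1 / (a * t) + 1 / (c * sqrt (t * a)))" .
  qed
qed

end
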